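(* In the setting of the context ($\mathfrak g=\mathfrak{osp}(2n|2n)$, $n\ge1$), write $\operatorname{rdet}(\mathcal A^{(2n|2n)})=\sum_{m\le 4n-1}c_mD^m\in\mathcal V(\bar{\mathfrak p})(\!(D^{-1})\!)$ and set $w_l:=c_{4n-1-l}$ for $1\le l\le4n-1$; write $A_{2n}=\sum_{i=0}^{2n}a_{2n-i}D^i$ and set $\widetilde w_{2n}:=a_{2n}$. Then $w_1,\dots,w_{4n-1},\widetilde w_{2n}\in\mathcal W(\bar{\mathfrak g},f)$.
   Context: $\mathfrak{gl}(2n|2n)$: index set $I=\{1,\dots,4n\}$ with $p(i)=0$ iff $i\in\{2,4,\dots,2n\}\cup\{2n+1,2n+3,\dots,4n-1\}$, else $p(i)=1$; matrix units $e_{ij}$ of parity $p(i)+p(j)$, $[e_{ij},e_{kl}]=\delta_{jk}e_{il}-(-1)^{(p(i)+p(j))(p(k)+p(l))}\delta_{il}e_{kj}$, $\operatorname{str}(\sum a_{ij}e_{ij})=\sum(-1)^{p(i)}a_{ii}$. Put $i'=4n+1-i$, $\delta_k=1$ if $k\in\{1,3,\dots,2n-1\}$, else $0$. $\theta(e_{ij})=(-1)^{p(i)p(j)+p(j)+1+\delta_i+\delta_j}e_{j'i'}$, $F_{ij}=e_{ij}+\theta(e_{ij})$, $\mathfrak g=\operatorname{span}\{F_{ij}\}\cong\mathfrak{osp}(2n|2n)$ with form $(X|Y)=\operatorname{str}(XY)$, $E_{ij}=\frac12(-1)^{p(i)}F_{ij}$. Set $\bar\imath=i$ ($i\le2n$),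 $\bar\imath=i-1$ ($i\ge2n+1$); grading $F_{ij}\in\mathfrak g_{(\bar\jmath-\bar\imath)/2}$, $\mathfrak n=\mathfrak g_{>0}$, $\mathfrak p=\mathfrak g_{\le0}$; $f=F_{2n+1,2n-1}+\sum_{i=1}^{2n-1}F_{i+1,i}$, matrix $f=\sum f_{ij}e_{ij}$. SUSY affine PVA: $\bar{\mathfrak g}$ parity-reversed copy; $\mathcal V(\bar{\mathfrak g})=S(\mathbb C[D]\otimes\bar{\mathfrak g})$ free supercommutative on $D^m\bar a$, odd derivation $D$, bracket $\{\bar a{}_\chi\bar b\}=(-1)^{p(a)(p(b)+1)}\overline{[a,b]}+\chi(a|b)$ extended by sesquilinearity $\{Dx{}_\chi y\}=-\chi\{x{}_\chi y\}$, $\{x{}_\chi Dy\}=(-1)^{p(x)+1}(D+\chi)\{x{}_\chi y\}$ and Leibniz $\{x{}_\chi yz\}=(-1)^{(p(x)+1)p(y)}y\{x{}_\chi z\}+\{x{}_\chi y\}z$; $\chi$ odd, supercommuting, $D\chi+\chi D=-2\chi^2$. $\mathcal V(\bar{\mathfrak p})=S(\mathbb C[D]\otimes\bar{\mathfrak p})$; $\mathfrak J$ = differential ideal of $\mathcal V(\bar{\mathfrak g})$ generated by $\bar n-(f|n)$, $n\in\mathfrak n$; $\mathcal W(\bar{\mathfrak g},f)=\{w\in\mathcal V(\bar{\mathfrak p}):\{\bar n{}_\chi w\}\in\mathbb C[\chi]\otimes\mathfrak J\ \forall n\in\mathfrak n\}$. $\mathcal V(\bar{\mathfrak p})(\!(D^{-1})\!)$: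 series $\sum_{m\le N}c_mD^m$ (coefficients on the left) with $D\,a=D(a)+(-1)^{p(a)}aD$ and $D^{-1}a=\sum_{m\ge0}(-1)^m((-1)^{p(a)}a^{(2m)}D^{-1-2m}+a^{(2m+1)}D^{-2-2m})$. Matrices: $\mathcal M$ ($4n\times4n$): $\mathcal M_{ij}=\delta_{ij}D+\bar E_{ji}$ ($i\le j$), $\mathcal M_{ij}=-f_{ij}$ ($i>j$). $\mathcal N$: replace column $2n$ of $\mathcal M$ by (column $2n$) $-$ (column $2n+1$). $\widetilde{\mathcal A}$: replace row $2n+1$ of $\mathcal N$ by (row $2n+1$ of $\mathcal N$) $-$ (row $2n$ of $\mathcal N$). $\widetilde{\mathcal A}=\begin{pmatrix}\mu_{11}&\mu_{12}\\\mu_{21}&\mu_{22}\end{pmatrix}$ with $2n\times2n$ blocks. $\mathcal A^{(2n|2n)}$ is the $(4n+1)\times(4n+1)$ matrix whose upper-left, upper-right, lower-left, lower-right $2n\times2n$ blocks are $\mu_{11},\mu_{12},\mu_{21},\mu_{22}$, and whose $(2n+1)$-th row and column are zero except the $(2n+1,2n+1)$ entry $D^{-1}$. $A_{2n}=\operatorname{rdet}(\mu_{11})$. $\operatorname{rdet}(A)=\sum_\sigma\operatorname{sgn}(\sigma)A_{1\sigma(1)}\cdots A_{N\sigma(N)}$. *)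

theory Defs
  imports Complex_Main "HOL-Library.Multiset" "HOL-Library.Product_Lexorder"
    "HOL-Combinatorics.Permutations"
begin

type_synonym mat = "nat \<Rightarrow> nat \<Rightarrow> complex"

definition Iset :: "nat \<Rightarrow> nat set" where "Iset n = {1..4*n}"

definition par :: "nat \<Rightarrow> nat \<Rightarrow> nat" where
  "par n i = (if (even i \<and> 2 \<le> i \<and> i \<le> 2*n) \<or> (odd i \<and> 2*n+1 \<le> i \<and> i \<le> 4*n-1) then 0 else 1)"

definition pr :: "nat \<Rightarrow> nat \<Rightarrow> nat" where "pr n i = 4*n+1-i"

definition dlt :: "nat \<Rightarrow> nat \<Rightarrow> nat" where
  "dlt n k = (if odd k \<and> k \<le> 2*n-1 then 1 else 0)"

definition thsign :: "nat \<Rightarrow> nat \<Rightarrow> nat \<Rightarrow> complex" where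
  "thsign n i j = (-1) ^ (par n i * par n j + par n j + 1 + dlt n i + dlt n j)"

text \<open>F_ij = e_ij + theta(e_ij)\<close>
definition Fmat :: "nat \<Rightarrow> nat \<Rightarrow> nat \<Rightarrow> mat" where
  "Fmat n i j = (\<lambda>a b. (if a = i \<and> b = j then 1 else 0)
        + (if a = pr n j \<and> b = pr n i then thsign n i j else 0))"

definition mmul :: "nat \<Rightarrow> mat \<Rightarrow> mat \<Rightarrow> mat" where
  "mmul n X Y = (\<lambda>a b. \<Sum>c\<in>Iset n. X a c * Y c b)"

definition str :: "nat \<Rightarrow> mat \<Rightarrow> complex" where
  "str n X = (\<Sum>a\<in>Iset n. (-1) ^ par n a * X a a)"

definition bilin :: "nat \<Rightarrow> mat \<Rightarrow> mat \<Rightarrow> complex" where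
  "bilin n X Y = str n (mmul n X Y)"

definition sbr :: "nat \<Rightarrow> nat \<Rightarrow> nat \<Rightarrow> mat \<Rightarrow> mat \<Rightarrow> mat" where
  "sbr n pX pY X Y = (\<lambda>a b. mmul n X Y a b - (-1) ^ (pX * pY) * mmul n Y X a b)"

definition ibar :: "nat \<Rightarrow> nat \<Rightarrow> nat" where
  "ibar n i = (if i \<le> 2*n then i else i - 1)"

text \<open>g = span of the F_ij; n = g_{>0} = span of the F_ij with ibar j > ibar i\<close>
definition gset :: "nat \<Rightarrow> mat set" where
  "gset n = {X. \<exists>c::nat \<Rightarrow> nat \<Rightarrow> complex.
      X = (\<lambda>a b. \<Sum>(i,j)\<in>Iset n \<times> Iset n. c i j * Fmat n i j a b)}"

definition nset :: "nat \<Rightarrow> mat set" where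
  "nset n = {X. \<exists>c::nat \<Rightarrow> nat \<Rightarrow> complex.
      X = (\<lambda>a b. \<Sum>(i,j)\<in>{(i,j)\<in>Iset n \<times> Iset n. ibar n i < ibar n j}. c i j * Fmat n i j a b)}"

text \<open>A basis of g: the F_ij with i + j < 4n+1, and the nonzero F_{i i'}.\<close>
definition basis :: "nat \<Rightarrow> (nat \<times> nat) set" where
  "basis n = {(i,j). i \<in> Iset n \<and> j \<in> Iset n \<and>
      (i + j < 4*n+1 \<or> (i + j = 4*n+1 \<and> thsign n i j = 1))}"

definition Fk :: "nat \<Rightarrow> nat \<times> nat \<Rightarrow> mat" where
  "Fk n k = Fmat n (fst k) (snd k)"

definition coord :: "nat \<Rightarrow> nat \<times> nat \<Rightarrow> mat \<Rightarrow> complex" where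
  "coord n k X = (if fst k + snd k = 4*n+1 then X (fst k) (snd k) / 2 else X (fst k) (snd k))"

definition bpar :: "nat \<Rightarrow> nat \<times> nat \<Rightarrow> nat" where
  "bpar n k = (par n (fst k) + par n (snd k)) mod 2"

definition fmat :: "nat \<Rightarrow> mat" where
  "fmat n = (\<lambda>a b. Fmat n (2*n+1) (2*n-1) a b + (\<Sum>i\<in>{1..2*n-1}. Fmat n (i+1) i a b))"

text \<open>A variable (m,k) stands for D^m (bar b_k), b_k the basis element k of g.
  A monomial is a multiset of variables (odd ones with multiplicity at most 1),
  standing for (product of even variables) * (odd variables in increasing order).
  Elements are finitely supported functions monomial => complex.\<close>

type_synonym var = "nat \<times> (nat \<times> nat)"
type_synonym mono = "var multiset"
type_synonym sp = "mono \<Rightarrow> complex"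

definition vpar :: "nat \<Rightarrow> var \<Rightarrow> nat" where
  "vpar n v = (bpar n (snd v) + 1 + fst v) mod 2"

definition supp :: "sp \<Rightarrow> mono set" where "supp f = {M. f M \<noteq> 0}"

definition oddvars :: "nat \<Rightarrow> mono \<Rightarrow> var set" where
  "oddvars n M = {v \<in> set_mset M. vpar n v = 1}"

definition spzero :: sp where "spzero = (\<lambda>M. 0)"
definition spconst :: "complex \<Rightarrow> sp" where "spconst c = (\<lambda>M. if M = {#} then c else 0)"
definition spvar :: "var \<Rightarrow> sp" where "spvar v = (\<lambda>M. if M = {#v#} then 1 else 0)"
definition spadd :: "sp \<Rightarrow> sp \<Rightarrow> sp" where "spadd f g = (\<lambda>M. f M + g M)"
definition spscale :: "complex \<Rightarrow> sp \<Rightarrow> sp" where "spscale c f = (\<lambda>M. c * f M)"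

definition monosign :: "nat \<Rightarrow> mono \<Rightarrow> mono \<Rightarrow> complex" where
  "monosign n M1 M2 = (if oddvars n M1 \<inter> oddvars n M2 = {}
     then (-1) ^ card {(a,b). a \<in> oddvars n M1 \<and> b \<in> oddvars n M2 \<and> b < a} else 0)"

definition spmul :: "nat \<Rightarrow> sp \<Rightarrow> sp \<Rightarrow> sp" where
  "spmul n f g = (\<lambda>M. \<Sum>(M1,M2)\<in>supp f \<times> supp g.
       if M1 + M2 = M then f M1 * g M2 * monosign n M1 M2 else 0)"

definition sigma :: "nat \<Rightarrow> sp \<Rightarrow> sp" where
  "sigma n f = (\<lambda>M. (-1) ^ card (oddvars n M) * f M)"

definition mlist :: "nat \<Rightarrow> mono \<Rightarrow> var list" where
  "mlist n M = sorted_list_of_multiset (filter_mset (\<lambda>v. vpar n v = 0) M)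
             @ sorted_list_of_multiset (filter_mset (\<lambda>v. vpar n v = 1) M)"

fun listprod :: "nat \<Rightarrow> var list \<Rightarrow> sp" where
  "listprod n [] = spconst 1"
| "listprod n (v # vs) = spmul n (spvar v) (listprod n vs)"

definition dv :: "var \<Rightarrow> var" where "dv v = (Suc (fst v), snd v)"

fun Dlist :: "nat \<Rightarrow> var list \<Rightarrow> sp" where
  "Dlist n [] = spzero"
| "Dlist n (v # vs) = spadd (spmul n (spvar (dv v)) (listprod n vs))
      (spscale ((-1) ^ vpar n v) (spmul n (spvar v) (Dlist n vs)))"

definition Dsp :: "nat \<Rightarrow> sp \<Rightarrow> sp" where
  "Dsp n f = (\<lambda>M. \<Sum>M'\<in>supp f. f M' * Dlist n (mlist n M') M)"

definition barX :: "nat \<Rightarrow> mat \<Rightarrow> sp" where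
  "barX n X = (\<lambda>M. \<Sum>k\<in>basis n. coord n k X * spvar (0, k) M)"

definition valid :: "nat \<Rightarrow> sp \<Rightarrow> bool" where
  "valid n f = (finite (supp f) \<and> (\<forall>M\<in>supp f.
      (\<forall>v. vpar n v = 1 \<longrightarrow> count M v \<le> 1) \<and> (\<forall>v\<in>set_mset M. snd v \<in> basis n)))"

text \<open>V(pbar): only variables D^m bar b_k with b_k in p = g_{<=0}\<close>
definition Vp :: "nat \<Rightarrow> sp set" where
  "Vp n = {f. valid n f \<and> (\<forall>M\<in>supp f. \<forall>v\<in>set_mset M.
       ibar n (snd (snd v)) \<le> ibar n (fst (snd v)))}"

inductive_set Jset :: "nat \<Rightarrow> sp set" for n where
  gen: "X \<in> nset n \<Longrightarrow> spadd (barX n X) (spconst (- bilin n (fmat n) X)) \<in> Jset n"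
| zero: "spzero \<in> Jset n"
| add: "x \<in> Jset n \<Longrightarrow> y \<in> Jset n \<Longrightarrow> spadd x y \<in> Jset n"
| mul: "x \<in> Jset n \<Longrightarrow> valid n y \<Longrightarrow> spmul n y x \<in> Jset n"
| der: "x \<in> Jset n \<Longrightarrow> Dsp n x \<in> Jset n"

text \<open>F k = coefficient of chi^k (chi written on the left)\<close>
type_synonym cv = "nat \<Rightarrow> sp"

definition cvzero :: cv where "cvzero = (\<lambda>k. spzero)"
definition cvadd :: "cv \<Rightarrow> cv \<Rightarrow> cv" where "cvadd F G = (\<lambda>k. spadd (F k) (G k))"
definition cvscale :: "complex \<Rightarrow> cv \<Rightarrow> cv" where "cvscale c F = (\<lambda>k. spscale c (F k))"
definition chi :: "cv \<Rightarrow> cv" where "chi F = (\<lambda>k. if k = 0 then spzero else F (k - 1))"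

text \<open>D acting on C[chi] (x) V, using D chi + chi D = -2 chi^2\<close>
definition Dcv :: "nat \<Rightarrow> cv \<Rightarrow> cv" where
  "Dcv n F = (\<lambda>k. if even k
      then spadd (Dsp n (F k)) (if k = 0 then spzero else spscale (-2) (F (k - 1)))
      else spscale (-1) (Dsp n (F k)))"

definition lmul :: "nat \<Rightarrow> sp \<Rightarrow> cv \<Rightarrow> cv" where
  "lmul n y F = (\<lambda>k. if even k then spmul n y (F k) else spmul n (sigma n y) (F k))"

definition rmul :: "nat \<Rightarrow> cv \<Rightarrow> sp \<Rightarrow> cv" where
  "rmul n F z = (\<lambda>k. spmul n (F k) z)"

definition brk_base :: "nat \<Rightarrow> nat \<times> nat \<Rightarrow> nat \<times> nat \<Rightarrow> cv" where
  "brk_base n a b = (\<lambda>k. if k = 0 then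
        spscale ((-1) ^ (bpar n a * (bpar n b + 1)))
          (barX n (sbr n (bpar n a) (bpar n b) (Fk n a) (Fk n b)))
      else if k = 1 then spconst (bilin n (Fk n a) (Fk n b)) else spzero)"

definition brk_var :: "nat \<Rightarrow> nat \<times> nat \<Rightarrow> var \<Rightarrow> cv" where
  "brk_var n a v = ((\<lambda>F. cvscale ((-1) ^ bpar n a) (cvadd (Dcv n F) (chi F))) ^^ fst v)
      (brk_base n a (snd v))"

text \<open>Leibniz rule {x _chi y z} = (-1)^((p(x)+1)p(y)) y {x _chi z} + {x _chi y} z\<close>
fun brk_list :: "nat \<Rightarrow> nat \<times> nat \<Rightarrow> var list \<Rightarrow> cv" where
  "brk_list n a [] = cvzero"
| "brk_list n a (v # vs) = cvadd
      (cvscale ((-1) ^ (bpar n a * vpar n v)) (lmul n (spvar v) (brk_list n a vs)))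
      (rmul n (brk_var n a v) (listprod n vs))"

definition brk :: "nat \<Rightarrow> nat \<times> nat \<Rightarrow> sp \<Rightarrow> cv" where
  "brk n a w = (\<lambda>k M. \<Sum>M'\<in>supp w. w M' * brk_list n a (mlist n M') k M)"

definition brkX :: "nat \<Rightarrow> mat \<Rightarrow> sp \<Rightarrow> cv" where
  "brkX n X w = (\<lambda>k M. \<Sum>a\<in>basis n. coord n a X * brk n a w k M)"

definition Wset :: "nat \<Rightarrow> sp set" where
  "Wset n = {w \<in> Vp n. \<forall>X\<in>nset n. \<forall>k. brkX n X w k \<in> Jset n}"

text \<open>S k = coefficient c_k of D^k (coefficients on the left); supports bounded above\<close>
type_synonym pd = "int \<Rightarrow> sp"

definition pdzero :: pd where "pdzero = (\<lambda>k. spzero)"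
definition pdadd :: "pd \<Rightarrow> pd \<Rightarrow> pd" where "pdadd A B = (\<lambda>k. spadd (A k) (B k))"
definition pdscale :: "complex \<Rightarrow> pd \<Rightarrow> pd" where "pdscale c A = (\<lambda>k. spscale c (A k))"
definition pdconst :: "sp \<Rightarrow> pd" where "pdconst c = (\<lambda>k. if k = 0 then c else spzero)"
definition pdDop :: pd where "pdDop = (\<lambda>k. if k = 1 then spconst 1 else spzero)"
definition pdDinvop :: pd where "pdDinvop = (\<lambda>k. if k = -1 then spconst 1 else spzero)"

text \<open>D o S, using D a = D(a) + (-1)^p(a) a D\<close>
definition pdD :: "nat \<Rightarrow> pd \<Rightarrow> pd" where
  "pdD n S = (\<lambda>k. spadd (Dsp n (S k)) (sigma n (S (k - 1))))"

text \<open>D^-1 o S, using D^-1 a = sum_m (-1)^m ((-1)^p(a) a^(2m) D^(-1-2m) + a^(2m+1) D^(-2-2m))\<close>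
definition pdDinv :: "nat \<Rightarrow> pd \<Rightarrow> pd" where
  "pdDinv n S = (\<lambda>k M. \<Sum>j\<in>{j. k < j \<and> S j \<noteq> spzero}.
      (let r = nat (j - k - 1) in
        if even r then (-1) ^ (r div 2) * sigma n ((Dsp n ^^ r) (S j)) M
        else (-1) ^ ((r - 1) div 2) * (Dsp n ^^ r) (S j) M))"

definition pdDpow :: "nat \<Rightarrow> int \<Rightarrow> pd \<Rightarrow> pd" where
  "pdDpow n i S = (if 0 \<le> i then (pdD n ^^ nat i) S else (pdDinv n ^^ nat (- i)) S)"

definition pdmul :: "nat \<Rightarrow> pd \<Rightarrow> pd \<Rightarrow> pd" where
  "pdmul n A S = (\<lambda>k M. \<Sum>i\<in>{i. A i \<noteq> spzero \<and> pdDpow n i S k \<noteq> spzero}.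
      spmul n (A i) (pdDpow n i S k) M)"

definition rdet :: "nat \<Rightarrow> nat \<Rightarrow> (nat \<Rightarrow> nat \<Rightarrow> pd) \<Rightarrow> pd" where
  "rdet n N A = (\<lambda>k M. \<Sum>\<sigma>\<in>{\<sigma>. \<sigma> permutes {1..N}}.
      of_int (sign \<sigma>) * foldr (pdmul n) (map (\<lambda>i. A i (\<sigma> i)) [1..<N+1]) (pdconst (spconst 1)) k M)"

definition Ebar :: "nat \<Rightarrow> nat \<Rightarrow> nat \<Rightarrow> sp" where
  "Ebar n j i = spscale ((1/2) * (-1) ^ par n j) (barX n (Fmat n j i))"

definition Mmat :: "nat \<Rightarrow> nat \<Rightarrow> nat \<Rightarrow> pd" where
  "Mmat n i j = (if i \<le> j then pdadd (if i = j then pdDop else pdzero) (pdconst (Ebar n j i))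
                 else pdconst (spconst (- fmat n i j)))"

definition Nmat :: "nat \<Rightarrow> nat \<Rightarrow> nat \<Rightarrow> pd" where
  "Nmat n i j = (if j = 2*n then pdadd (Mmat n i (2*n)) (pdscale (-1) (Mmat n i (2*n+1)))
                 else Mmat n i j)"

definition Atil :: "nat \<Rightarrow> nat \<Rightarrow> nat \<Rightarrow> pd" where
  "Atil n i j = (if i = 2*n+1 then pdadd (Nmat n (2*n+1) j) (pdscale (-1) (Nmat n (2*n) j))
                 else Nmat n i j)"

definition mu11 :: "nat \<Rightarrow> nat \<Rightarrow> nat \<Rightarrow> pd" where
  "mu11 n i j = Atil n i j"

definition shift :: "nat \<Rightarrow> nat \<Rightarrow> nat" where
  "shift n i = (if i \<le> 2*n then i else i - 1)"

text \<open>A^(2n|2n): (4n+1) x (4n+1), blocks mu_ab, middle row/column zero except D^-1\<close>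
definition Abig :: "nat \<Rightarrow> nat \<Rightarrow> nat \<Rightarrow> pd" where
  "Abig n i j = (if i = 2*n+1 \<or> j = 2*n+1
      then (if i = 2*n+1 \<and> j = 2*n+1 then pdDinvop else pdzero)
      else Atil n (shift n i) (shift n j))"

end

theory Submission
  imports Defs "HOL-Library.Function_Algebras"
begin

text \<open>
  Let \<open>a\<close> be a basis element of \<open>\<nn>\<close> with parity \<open>p\<close>. Each \<open>\<chi>\<close>-coefficient of \<open>{a \<chi> w}\<close> is a derivation
  of \<open>\<V>(g)\<close>, and together they form a derivation \<open>\<delta>\<close> into a bimodule that commutes with \<open>D\<close>. On
  \<open>L = D + (E\<^sub>j\<^sub>i)\<close>, which modulo the ideal \<open>J\<close> equals the matrix \<open>\<M>\<close>, it acts as an infinitesimal gauge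
  transformation, \<open>\<delta>L = L X - (-1)^p X L\<close> with \<open>X = \<epsilon> a\<close> strictly upper triangular.

  The row determinant \<open>R\<close> of a Hessenberg matrix is obtained by eliminating: there is a vector \<open>c\<close> whose
  last entry is constant and with \<open>\<M> c = (R, 0, \<dots>, 0)\<close>; here the column and row operations and the entry \<open>D^(-1)\<close>
  of \<open>\<A>^(2n|2n)\<close> are undone. Applying \<open>\<delta>\<close> gives \<open>\<M> (\<delta>c + X c) = (\<delta>R, 0, \<dots>, 0)\<close> modulo \<open>J\<close>, where the
  last entry of \<open>\<delta>c + X c\<close> vanishes. Back substitution shows that the whole vector vanishes, hence \<open>\<delta>R = 0\<close>.

  For \<open>A\<^sub>2\<^sub>n\<close> the same elimination yields \<open>\<M> c = (A\<^sub>2\<^sub>n, 0, \<dots>, 0, -2D, 0, \<dots>, 0)\<close>; the error term \<open>-2D\<close> has no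
  constant coefficient, so back substitution only shows that the constant coefficient of \<open>\<delta>A\<^sub>2\<^sub>n\<close> vanishes.
\<close>

section \<open>The free supercommutative algebra\<close>

text \<open>The obstacle is the middle. Since \<open>ibar\<close> identifies 2n and 2n+1, f has no
  entry at (2n+1, 2n), but it has entries at (2n+1, 2n-1) and (2n+2, 2n), so M is not Hessenberg.
  The column and row operations cancel these two entries and put -2D at (2n+1, 2n); the extra D^(-1)
  turns it into the scalar -2, so that the elimination vector has a constant last entry. The
  truncated block has no such factor, hence the error -2D. In the back substitution the two middle
  unknowns are found together: their sum vanishes by row 2n+2, D kills their difference, and D is
  injective modulo J on series bounded above.

  Matrix entries are treated as operators on series: the row determinant multiplies rows in order,
  so it can be applied to 1 from the last row upwards. Entries and brackets of variables have degree
  at most one, so the product rules are stated for left factors of that kind. The chi^m coefficient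
  of a bracket is a derivation of parity p + m, which accounts for the signs (-1)^(p + m).\<close>

declare split_paired_All [simp del] split_paired_Ex [simp del]

text \<open>Under an eta-expanded \<open>\<lambda>x. f x\<close> these would rewrite \<open>f + g\<close> into a lambda term.\<close>
declare plus_fun_apply [simp del] zero_fun_apply [simp del] minus_apply [simp del] uminus_apply [simp del]

lemmas fun_arith_apply = plus_fun_apply zero_fun_apply minus_apply uminus_apply

lemma spadd_eq [simp]: "spadd f g = f + g"
  by (simp add: spadd_def plus_fun_def)

lemma spzero_eq [simp]: "spzero = 0"
  by (simp add: spzero_def zero_fun_def)

lemma sum_fun_apply: "(\<Sum>i\<in>A. f i) x = (\<Sum>i\<in>A. f i x)"
  by (induction A rule: infinite_finite_induct) (auto simp: fun_arith_apply)

interpretation sp: vector_space spscale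
  by unfold_locales (auto simp: spscale_def plus_fun_def algebra_simps)

lemma spscale_apply: "spscale c f M = c * f M"
  by (simp add: spscale_def)

abbreviation fs :: "sp \<Rightarrow> bool" where "fs f \<equiv> finite (supp f)"

lemma supp_add: "supp (f + g) \<subseteq> supp f \<union> supp g"
  by (auto simp: supp_def fun_arith_apply)

lemma fs_add [intro, simp]: "fs f \<Longrightarrow> fs g \<Longrightarrow> fs (f + g)"
  by (meson finite_Un finite_subset supp_add)

lemma supp_zero [simp]: "supp 0 = {}"
  by (auto simp: supp_def fun_arith_apply)

lemma supp_scale: "supp (spscale c f) \<subseteq> supp f"
  by (auto simp: supp_def spscale_def)

lemma fs_scale [intro, simp]: "fs f \<Longrightarrow> fs (spscale c f)"
  by (meson finite_subset supp_scale)

lemma fs_uminus [simp]: "fs (- f) = fs f"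
  by (simp add: supp_def fun_arith_apply)

lemma fs_sum [intro]: "(\<And>i. i \<in> A \<Longrightarrow> fs (f i)) \<Longrightarrow> fs (sum f A)"
  by (induction A rule: infinite_finite_induct) auto

definition mon :: "mono \<Rightarrow> sp" where "mon M = (\<lambda>M'. if M' = M then 1 else 0)"

lemma supp_mon [simp]: "supp (mon M) = {M}"
  by (auto simp: supp_def mon_def)

lemma spvar_eq_mon: "spvar v = mon {#v#}"
  by (simp add: spvar_def mon_def)

lemma spconst_eq_mon: "spconst c = spscale c (mon {#})"
  by (auto simp: spconst_def mon_def spscale_def)

lemma fs_spvar [simp]: "fs (spvar v)" and fs_spconst [simp]: "fs (spconst c)"
  by (auto simp: spvar_eq_mon spconst_eq_mon)

lemma fs_expand: "fs f \<Longrightarrow> f = (\<Sum>M\<in>supp f. spscale (f M) (mon M))"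
  by (rule ext) (auto simp: sum_fun_apply spscale_def mon_def supp_def if_distrib sum.delta' cong: if_cong)

lemma vpar_cases: "vpar n v = 0 \<or> vpar n v = 1"
  by (auto simp: vpar_def)

lemma vpar_mod [simp]: "vpar n v mod 2 = vpar n v"
  by (simp add: vpar_def)

lemma finite_oddvars [simp]: "finite (oddvars n M)"
  by (simp add: oddvars_def)

lemma oddvars_add [simp]: "oddvars n (M + N) = oddvars n M \<union> oddvars n N"
  by (auto simp: oddvars_def)

lemma oddvars_empty [simp]: "oddvars n {#} = {}"
  by (auto simp: oddvars_def)

lemma oddvars_single: "oddvars n {#v#} = (if vpar n v = 1 then {v} else {})"
  by (auto simp: oddvars_def)

lemma monosign_empty [simp]: "monosign n {#} M = 1"
  by (simp add: monosign_def)

lemma monosign_single: "monosign n {#v#} M = (if vpar n v = 1 then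
    (if v \<in># M then 0 else (-1) ^ card {b \<in> oddvars n M. b < v}) else 1)"
proof -
  have "{(a, b). a = v \<and> b \<in> oddvars n M \<and> b < a} = Pair v ` {b \<in> oddvars n M. b < v}" by auto
  then have "card {(a, b). a = v \<and> b \<in> oddvars n M \<and> b < a} = card {b \<in> oddvars n M. b < v}"
    by (simp add: card_image inj_on_def)
  moreover have "v \<in># M \<longleftrightarrow> v \<in> oddvars n M" if "vpar n v = 1"
    using that by (simp add: oddvars_def)
  ultimately show ?thesis by (auto simp: monosign_def oddvars_single)
qed

lemma spmul_finite_supersets:
  assumes "finite A" "finite B" "supp f \<subseteq> A" "supp g \<subseteq> B"
  shows "spmul n f g M = (\<Sum>(M1,M2)\<in>A \<times> B. if M1 + M2 = M then f M1 * g M2 * monosign n M1 M2 else 0)"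
  unfolding spmul_def
  by (rule sum.mono_neutral_left) (use assms in \<open>auto simp: supp_def split: if_splits\<close>)

lemma spmul_add_left:
  assumes "fs f" "fs g" "fs h"
  shows "spmul n (f + g) h = spmul n f h + spmul n g h"
proof
  fix M
  show "spmul n (f + g) h M = (spmul n f h + spmul n g h) M"
    using spmul_finite_supersets[of "supp f \<union> supp g" "supp h" "f + g" h n M]
      spmul_finite_supersets[of "supp f \<union> supp g" "supp h" f h n M]
      spmul_finite_supersets[of "supp f \<union> supp g" "supp h" g h n M] assms supp_add[of f g]
    by (simp add: sum.distrib[symmetric] split_def fun_arith_apply) (rule sum.cong, auto simp: algebra_simps fun_arith_apply)
qed

lemma spmul_add_right:
  assumes "fs f" "fs g" "fs h"
  shows "spmul n h (f + g) = spmul n h f + spmul n h g"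
proof
  fix M
  show "spmul n h (f + g) M = (spmul n h f + spmul n h g) M"
    using spmul_finite_supersets[of "supp h" "supp f \<union> supp g" h "f + g" n M]
      spmul_finite_supersets[of "supp h" "supp f \<union> supp g" h f n M]
      spmul_finite_supersets[of "supp h" "supp f \<union> supp g" h g n M] assms supp_add[of f g]
    by (simp add: sum.distrib[symmetric] split_def fun_arith_apply) (rule sum.cong, auto simp: algebra_simps fun_arith_apply)
qed

lemma spmul_zero_left [simp]: "spmul n 0 f = 0" and spmul_zero_right [simp]: "spmul n f 0 = 0"
  by (auto simp: spmul_def fun_eq_iff fun_arith_apply)

lemma spmul_scale_left: "spmul n (spscale c f) g = spscale c (spmul n f g)"
proof (cases "c = 0")
  case False
  then have "supp (spscale c f) = supp f" by (auto simp: supp_def spscale_def)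
  then show ?thesis
    by (auto simp: spmul_def spscale_def fun_eq_iff sum_distrib_left split_def intro!: sum.cong)
qed auto

lemma spmul_scale_right: "spmul n f (spscale c g) = spscale c (spmul n f g)"
proof (cases "c = 0")
  case False
  then have "supp (spscale c g) = supp g" by (auto simp: supp_def spscale_def)
  then show ?thesis
    by (auto simp: spmul_def spscale_def fun_eq_iff sum_distrib_left split_def intro!: sum.cong)
qed auto

lemma spmul_uminus_left [simp]: "spmul n (- f) g = - spmul n f g"
  using spmul_scale_left[of n "-1" f g] by simp

lemma spmul_sum_left:
  "finite A \<Longrightarrow> (\<And>i. i \<in> A \<Longrightarrow> fs (f i)) \<Longrightarrow> fs h \<Longrightarrow> spmul n (sum f A) h = (\<Sum>i\<in>A. spmul n (f i) h)"
  by (induction A rule: finite_induct) (simp_all add: spmul_add_left fs_sum)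

lemma spmul_sum_right:
  "finite A \<Longrightarrow> (\<And>i. i \<in> A \<Longrightarrow> fs (f i)) \<Longrightarrow> fs h \<Longrightarrow> spmul n h (sum f A) = (\<Sum>i\<in>A. spmul n h (f i))"
  by (induction A rule: finite_induct) (simp_all add: spmul_add_right fs_sum)

lemma supp_spmul: "supp (spmul n f g) \<subseteq> (\<lambda>(a, b). a + b) ` {(a, b). a \<in> supp f \<and> b \<in> supp g \<and> monosign n a b \<noteq> 0}"
proof
  fix M assume "M \<in> supp (spmul n f g)"
  then have "(\<Sum>(M1,M2)\<in>supp f \<times> supp g. if M1 + M2 = M then f M1 * g M2 * monosign n M1 M2 else 0) \<noteq> 0"
    by (simp only: supp_def mem_Collect_eq spmul_def[of n f g, symmetric] cong: sum.cong) (simp add: spmul_def supp_def)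
  then obtain x where "x \<in> supp f \<times> supp g"
      "(case x of (M1,M2) \<Rightarrow> if M1 + M2 = M then f M1 * g M2 * monosign n M1 M2 else 0) \<noteq> 0"
    by (meson sum.not_neutral_contains_not_neutral)
  then show "M \<in> (\<lambda>(a, b). a + b) ` {(a, b). a \<in> supp f \<and> b \<in> supp g \<and> monosign n a b \<noteq> 0}"
    by (auto split: if_splits)
qed

lemma fs_spmul [intro, simp]: "fs f \<Longrightarrow> fs g \<Longrightarrow> fs (spmul n f g)"
  by (rule finite_subset[OF supp_spmul], rule finite_imageI, rule finite_subset[of _ "supp f \<times> supp g"]) auto

lemma spmul_mon: "spmul n (mon A) (mon B) = spscale (monosign n A B) (mon (A + B))"
proof
  fix M
  have "spmul n (mon A) (mon B) M = (if A + B = M then mon A A * mon B B * monosign n A B else 0)"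
    by (simp add: spmul_def)
  then show "spmul n (mon A) (mon B) M = spscale (monosign n A B) (mon (A + B)) M"
    by (simp add: mon_def spscale_def)
qed

lemma spmul_one_left [simp]: "fs f \<Longrightarrow> spmul n (mon {#}) f = f"
  by (auto simp: spmul_def mon_def supp_def sum.cartesian_product[symmetric] fun_eq_iff sum.delta' cong: if_cong)

lemma spmul_spconst: "fs f \<Longrightarrow> spmul n (spconst c) f = spscale c f"
  by (simp add: spconst_eq_mon spmul_scale_left)

text \<open>\<^const>\<open>spmul\<close> by a variable, but linear without finiteness provisos.\<close>

definition lv :: "nat \<Rightarrow> var \<Rightarrow> sp \<Rightarrow> sp" where
  "lv n v f = (\<lambda>M. if v \<in># M then monosign n {#v#} (M - {#v#}) * f (M - {#v#}) else 0)"

lemma spmul_spvar: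
  assumes "fs f" shows "spmul n (spvar v) f = lv n v f"
proof
  fix M
  have "spmul n (spvar v) f M = (\<Sum>M2\<in>supp f. if {#v#} + M2 = M then f M2 * monosign n {#v#} M2 else 0)"
    by (simp add: spmul_def spvar_eq_mon sum.cartesian_product[symmetric])
       (simp add: mon_def cong: if_cong)
  also have "\<dots> = (\<Sum>M2\<in>supp f. if M2 = M - {#v#} then (if v \<in># M then f M2 * monosign n {#v#} M2 else 0) else 0)"
    by (rule sum.cong) auto
  also have "\<dots> = lv n v f M"
    using assms by (auto simp: lv_def sum.delta' supp_def)
  finally show "spmul n (spvar v) f M = lv n v f M" .
qed

lemma lv_add: "lv n v (f + g) = lv n v f + lv n v g"
  and lv_scale: "lv n v (spscale c f) = spscale c (lv n v f)"
  and lv_zero [simp]: "lv n v 0 = 0"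
  by (auto simp: lv_def spscale_def fun_eq_iff fun_arith_apply algebra_simps)

lemma lv_uminus [simp]: "lv n v (- f) = - lv n v f"
  using lv_scale[of n v "-1" f] by simp

lemma lv_diff: "lv n v (f - g) = lv n v f - lv n v g"
  using lv_add[of n v f "- g"] by simp

lemma lv_sum: "lv n v (sum f A) = (\<Sum>i\<in>A. lv n v (f i))"
  by (induction A rule: infinite_finite_induct) (auto simp: lv_add)

lemma fs_lv [intro, simp]: "fs f \<Longrightarrow> fs (lv n v f)"
  by (simp flip: spmul_spvar)

lemma lv_mon: "lv n v (mon M) = spscale (monosign n {#v#} M) (mon (M + {#v#}))"
  using spmul_mon[of n "{#v#}" M] by (simp flip: spmul_spvar spvar_eq_mon add: add.commute)

text \<open>For two odd variables each side counts the odd variables below \<open>v\<close> and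
  below \<open>w\<close>. The counts differ only in whether the other one of the two is included,
  which happens on exactly one side.\<close>

lemma lv_commute: "lv n v (lv n w f) = spscale ((-1) ^ (vpar n v * vpar n w)) (lv n w (lv n v f))"
proof (cases "v = w")
  case True
  show ?thesis
  proof (cases "vpar n v = 1")
    case odd: True
    have "lv n v (lv n v f) = 0"
      by (rule ext) (auto simp: lv_def monosign_single odd fun_arith_apply)
    then show ?thesis using True by simp
  qed (use True vpar_cases[of n v] in auto)
next
  case ne: False
  show ?thesis
  proof
    fix M
    let ?O = "oddvars n (M - {#v#} - {#w#})"
    let ?s = "\<lambda>v M. monosign n {#v#} M"
    have mem: "v \<in># M - {#w#} \<longleftrightarrow> v \<in># M" "w \<in># M - {#v#} \<longleftrightarrow> w \<in># M"
      using ne by (auto simp: in_diff_count)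
    have comm: "M - {#w#} - {#v#} = M - {#v#} - {#w#}" by (rule diff_right_commute)
    have key: "?s v (M - {#v#}) * ?s w (M - {#v#} - {#w#}) =
      (-1) ^ (vpar n v * vpar n w) * (?s w (M - {#w#}) * ?s v (M - {#v#} - {#w#}))"
      if "v \<in># M" "w \<in># M"
    proof (cases "vpar n v = 1 \<and> vpar n w = 1")
      case True
      show ?thesis
      proof (cases "v \<in># M - {#v#} \<or> w \<in># M - {#w#}")
        case True
        have "v \<in># M - {#v#} - {#w#} \<longleftrightarrow> v \<in># M - {#v#}" "w \<in># M - {#v#} - {#w#} \<longleftrightarrow> w \<in># M - {#w#}"
          using ne by (auto simp: in_diff_count)
        then show ?thesis using True \<open>vpar n v = 1 \<and> vpar n w = 1\<close> by (auto simp: monosign_single)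
      next
        case False
        have nm: "v \<notin># M - {#v#} - {#w#}" "w \<notin># M - {#v#} - {#w#}"
          using ne False by (auto simp: in_diff_count)
        have *: "oddvars n (M - {#v#}) = insert w ?O" "oddvars n (M - {#w#}) = insert v ?O"
          using ne that True by (auto simp: oddvars_def in_diff_count)
        have nO: "v \<notin> ?O" "w \<notin> ?O" using nm by (auto simp: oddvars_def)
        have c1: "card {b \<in> insert w ?O. b < v} = card {b \<in> ?O. b < v} + (if w < v then 1 else 0)"
        proof -
          have "{b \<in> insert w ?O. b < v} = (if w < v then insert w {b \<in> ?O. b < v} else {b \<in> ?O. b < v})" by auto
          then show ?thesis using nO by auto
        qed
        have c2: "card {b \<in> insert v ?O. b < w} = card {b \<in> ?O. b < w} + (if v < w then 1 else 0)"
        proof -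
          have "{b \<in> insert v ?O. b < w} = (if v < w then insert v {b \<in> ?O. b < w} else {b \<in> ?O. b < w})" by auto
          then show ?thesis using nO by auto
        qed
        show ?thesis using True False nm ne unfolding monosign_single * c1 c2
          by (auto simp: not_less_iff_gr_or_eq power_add)
      qed
    next
      case False
      have ?thesis if "vpar n w \<noteq> 1" "vpar n v = 1"
      proof -
        have "oddvars n (M - {#v#}) = ?O" 
          using that ne by (auto simp: oddvars_def in_diff_count split: if_splits)
        moreover have "v \<in># M - {#v#} - {#w#} \<longleftrightarrow> v \<in># M - {#v#}" using ne by (auto simp: in_diff_count)
        ultimately show ?thesis using that vpar_cases[of n w] by (simp add: monosign_single)
      qed
      moreover have ?thesis if "vpar n v \<noteq> 1" "vpar n w = 1"
      proof -
        have "oddvars n (M - {#w#}) = ?O" 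
          using that ne by (auto simp: oddvars_def in_diff_count split: if_splits)
        moreover have "w \<in># M - {#v#} - {#w#} \<longleftrightarrow> w \<in># M - {#w#}" using ne by (auto simp: in_diff_count)
        ultimately show ?thesis using that vpar_cases[of n v] by (simp add: monosign_single)
      qed
      moreover have ?thesis if "vpar n v \<noteq> 1" "vpar n w \<noteq> 1"
        using that vpar_cases[of n v] by (simp add: monosign_single)
      ultimately show ?thesis using False by blast
    qed
    show "lv n v (lv n w f) M = spscale ((-1) ^ (vpar n v * vpar n w)) (lv n w (lv n v f)) M"
      using key by (auto simp: lv_def spscale_def mem add_mset_commute[of w v] mult.assoc[symmetric])
  qed
qed

lemma lv_odd_square: "vpar n v = 1 \<Longrightarrow> lv n v (lv n v f) = 0"
  by (rule ext) (auto simp: lv_def monosign_single fun_arith_apply)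

text \<open>Homogeneous elements of degree at most one; constants count as even. Matrix entries,
  brackets of variables and the ideal generators attached to the \<open>Fmat n i j\<close> are of
  this kind.\<close>

inductive linhom :: "nat \<Rightarrow> nat \<Rightarrow> sp \<Rightarrow> bool" for n q where
  const: "even q \<Longrightarrow> linhom n q (spconst c)"
| var: "vpar n v = q mod 2 \<Longrightarrow> linhom n q (spscale c (spvar v))"
| add: "linhom n q f \<Longrightarrow> linhom n q g \<Longrightarrow> linhom n q (f + g)"

lemma linhom_fs [simp]: "linhom n q f \<Longrightarrow> fs f"
  by (induction rule: linhom.induct) auto

lemma linhom_zero [simp]: "linhom n q 0"
proof -
  \<comment> \<open>Constants are excluded for odd \<open>q\<close>, so zero is written as a zero
    multiple of a variable; a variable and its derivative supply both parities.\<close>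
  obtain v where "vpar n v = q mod 2"
  proof (cases "vpar n (0, 0, 0) = q mod 2")
    case False
    then have "vpar n (1, 0, 0) = q mod 2" by (auto simp: vpar_def) presburger
    then show ?thesis using that by blast
  qed (use that in blast)
  from linhom.var[OF this, of 0] show ?thesis by simp
qed

lemma linhom_scale [simp, intro]: "linhom n q f \<Longrightarrow> linhom n q (spscale c f)"
proof (induction rule: linhom.induct)
  case (const d)
  have "spscale c (spconst d) = spconst (c * d)" by (auto simp: spscale_def spconst_def)
  then show ?case using const linhom.const by metis
next
  case (var v d)
  then show ?case using linhom.var[of n v q "c * d"] by simp
next
  case (add f g)
  then show ?case by (simp add: sp.scale_right_distrib linhom.add)
qed

lemma linhom_spvar [intro]: "vpar n v = q mod 2 \<Longrightarrow> linhom n q (spvar v)"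
  using linhom.var[of n v q 1] by simp

lemma linhom_uminus [simp, intro]: "linhom n q f \<Longrightarrow> linhom n q (- f)"
  using linhom_scale[of n q f "-1"] by simp

lemma linhom_diff [intro]: "linhom n q f \<Longrightarrow> linhom n q g \<Longrightarrow> linhom n q (f - g)"
  using linhom.add[of n q f "- g"] by simp

lemma linhom_sum [intro]: "(\<And>i. i \<in> A \<Longrightarrow> linhom n q (f i)) \<Longrightarrow> linhom n q (sum f A)"
  by (induction A rule: infinite_finite_induct) (auto intro: linhom.add)

lemma linhom_cong: "linhom n q f \<Longrightarrow> q mod 2 = r mod 2 \<Longrightarrow> linhom n r f"
  by (induction rule: linhom.induct) (auto intro: linhom.intros simp: even_iff_mod_2_eq_zero)

lemma minus_one_power_mod2: "q mod 2 = r mod 2 \<Longrightarrow> (-1::complex) ^ q = (-1) ^ r"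
  by (metis minus_one_power_iff even_iff_mod_2_eq_zero)

text \<open>Linearity reduces this to two variables; a constant occurs only for even
  \<open>q\<close>, where the sign is 1.\<close>

lemma linhom_lv_commute:
  assumes "linhom n q x" "fs f"
  shows "spmul n x (lv n v f) = spscale ((-1) ^ (q * vpar n v)) (lv n v (spmul n x f))"
  using assms
proof (induction rule: linhom.induct)
  case (const c)
  then show ?case by (simp add: spmul_spconst lv_scale)
next
  case (var w c)
  have "(-1::complex) ^ (vpar n w * vpar n v) = (-1) ^ (q * vpar n v)"
    by (rule minus_one_power_mod2) (simp add: var mod_mult_left_eq)
  then show ?case using var lv_commute[of n w v f]
    by (simp add: spmul_scale_left spmul_spvar lv_scale mult.commute)
next
  case (add x y)
  then show ?case by (simp add: spmul_add_left lv_add sp.scale_right_distrib)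
qed

lemma spmul_diff_left: "fs f \<Longrightarrow> fs g \<Longrightarrow> fs h \<Longrightarrow> spmul n (f - g) h = spmul n f h - spmul n g h"
  using spmul_add_left[of f "- g" h n] by simp

lemma fs_listprod [simp]: "fs (listprod n vs)"
  by (induction vs) auto

lemma listprod_Cons [simp]: "listprod n (v # vs) = lv n v (listprod n vs)"
  by (simp add: spmul_spvar)

lemma listprod_Nil [simp]: "listprod n [] = mon {#}"
  by (simp add: spconst_eq_mon)

declare listprod.simps [simp del]

definition good :: "nat \<Rightarrow> mono \<Rightarrow> bool" where
  "good n M \<longleftrightarrow> (\<forall>v. vpar n v = 1 \<longrightarrow> count M v \<le> 1)"

lemma mset_mlist [simp]: "mset (mlist n M) = M"
proof -
  have "filter_mset (\<lambda>v. vpar n v = 1) M = filter_mset (\<lambda>v. \<not> vpar n v = 0) M"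
    by (intro filter_mset_cong refl) (metis vpar_cases zero_neq_one)
  then show ?thesis by (simp add: mlist_def flip: multiset_partition)
qed

lemma listprod_even_append:
  "\<forall>v\<in>set xs. vpar n v = 0 \<Longrightarrow> listprod n ys = mon N \<Longrightarrow> listprod n (xs @ ys) = mon (mset xs + N)"
  by (induction xs) (auto simp: lv_mon monosign_single)

lemma listprod_sorted_odd:
  "\<forall>v\<in>set xs. vpar n v = 1 \<Longrightarrow> sorted xs \<Longrightarrow> distinct xs \<Longrightarrow> listprod n xs = mon (mset xs)"
proof (induction xs)
  case (Cons v xs)
  have "{b \<in> oddvars n (mset xs). b < v} = {}"
    using Cons.prems by (auto simp: oddvars_def)
  then have "monosign n {#v#} (mset xs) = 1"
    using Cons.prems by (simp add: monosign_single del: Collect_empty_eq)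
  then show ?case using Cons by (simp add: lv_mon)
qed auto

text \<open>\<open>mlist\<close> puts even variables first and odd ones in increasing order, so no
  factor passes a smaller odd variable and all signs are 1.\<close>

lemma listprod_mlist:
  assumes "good n M" shows "listprod n (mlist n M) = mon M"
proof -
  let ?O = "filter_mset (\<lambda>v. vpar n v = 1) M" and ?E = "filter_mset (\<lambda>v. vpar n v = 0) M"
  have "distinct (sorted_list_of_multiset ?O)"
    using assms by (auto simp: distinct_count_atmost_1 good_def not_in_iff Suc_le_eq intro!: antisym)
  then have "listprod n (sorted_list_of_multiset ?O) = mon ?O"
    using listprod_sorted_odd[of "sorted_list_of_multiset ?O" n] by auto
  then have "listprod n (mlist n M) = mon (mset (sorted_list_of_multiset ?E) + ?O)"
    unfolding mlist_def by (intro listprod_even_append) auto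
  also have "mset (sorted_list_of_multiset ?E) + ?O = mset (mlist n M)"
    by (simp add: mlist_def)
  finally show ?thesis by simp
qed

section \<open>Derivations\<close>

text \<open>The parity \<open>q\<close> derivation with prescribed values \<open>d v\<close>, on words in the variables.
  Both the differential \<open>q = 1\<close> and every \<open>\<chi>\<close>-coefficient of a bracket are of this kind.\<close>

fun der :: "nat \<Rightarrow> nat \<Rightarrow> (var \<Rightarrow> sp) \<Rightarrow> var list \<Rightarrow> sp" where
  "der n q d [] = 0"
| "der n q d (v # vs) = spscale ((-1) ^ (q * vpar n v)) (lv n v (der n q d vs)) + spmul n (d v) (listprod n vs)"

definition derX :: "nat \<Rightarrow> nat \<Rightarrow> (var \<Rightarrow> sp) \<Rightarrow> sp \<Rightarrow> sp" where
  "derX n q d f = (\<Sum>M\<in>supp f. spscale (f M) (der n q d (mlist n M)))"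

text \<open>Values of degree at most one cover both D and the brackets, and
  \<open>linhom_lv_commute\<close> moves them past variables.\<close>

definition dvals :: "nat \<Rightarrow> nat \<Rightarrow> (var \<Rightarrow> sp) \<Rightarrow> bool" where
  "dvals n q d \<longleftrightarrow> (\<forall>v. linhom n (vpar n v + q) (d v))"

lemma dvalsD: "dvals n q d \<Longrightarrow> linhom n (vpar n v + q) (d v)"
  unfolding dvals_def by blast

lemma dvals_fs: "dvals n q d \<Longrightarrow> fs (d v)"
  using dvalsD linhom_fs by blast

text \<open>The word-level product rule respects the supercommutation relations: moving the value of
  \<open>v\<close> past \<open>w\<close> costs an extra sign \<open>q * vpar n w\<close>, which
  cancels the sign with which the derivation itself passes \<open>w\<close>.\<close>

lemma der_swap:
  assumes "dvals n q d"
  shows "der n q d (v # w # vs) = spscale ((-1) ^ (vpar n v * vpar n w)) (der n q d (w # v # vs))"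
proof -
  let ?P = "listprod n vs" and ?X = "der n q d vs"
  have d: "linhom n (vpar n u + q) (d u)" for u by (rule dvalsD[OF assms])
  have 1: "spmul n (d v) (lv n w ?P) = spscale ((-1) ^ ((vpar n v + q) * vpar n w)) (lv n w (spmul n (d v) ?P))"
    by (rule linhom_lv_commute[OF d]) simp
  have 2: "spmul n (d w) (lv n v ?P) = spscale ((-1) ^ ((vpar n w + q) * vpar n v)) (lv n v (spmul n (d w) ?P))"
    by (rule linhom_lv_commute[OF d]) simp
  have 3: "lv n v (lv n w ?X) = spscale ((-1) ^ (vpar n v * vpar n w)) (lv n w (lv n v ?X))"
    by (rule lv_commute)
  show ?thesis using vpar_cases[of n v] vpar_cases[of n w]
    by (auto simp: 1 2 3 lv_add lv_scale sp.scale_right_distrib minus_one_power_iff)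
qed

lemma der_cong:
  assumes "der n q d xs = spscale c (der n q d ys)" "listprod n xs = spscale c (listprod n ys)"
  shows "der n q d (v # xs) = spscale c (der n q d (v # ys))"
    "listprod n (v # xs) = spscale c (listprod n (v # ys))"
  using assms by (simp_all add: lv_scale spmul_scale_right sp.scale_right_distrib mult.commute)

lemma der_move:
  assumes "dvals n q d"
  shows "\<exists>c\<in>{1,-1}. der n q d (xs @ v # ys) = spscale c (der n q d (v # xs @ ys)) \<and>
     listprod n (xs @ v # ys) = spscale c (listprod n (v # xs @ ys))"
proof (induction xs)
  case Nil
  show ?case by (rule bexI[of _ 1]) auto
next
  case (Cons x xs)
  then obtain c where c: "c \<in> {1,-1}" "der n q d (xs @ v # ys) = spscale c (der n q d (v # xs @ ys))"
     "listprod n (xs @ v # ys) = spscale c (listprod n (v # xs @ ys))" by blast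
  let ?e = "(-1) ^ (vpar n x * vpar n v) :: complex"
  have "der n q d (x # xs @ v # ys) = spscale c (spscale ?e (der n q d (v # x # xs @ ys)))"
    by (simp only: der_cong(1)[OF c(2,3)] der_swap[OF assms, of x v])
  moreover have "listprod n (x # xs @ v # ys) = spscale c (spscale ?e (listprod n (v # x # xs @ ys)))"
    using der_cong(2)[OF c(2,3), of x] lv_commute[of n x v "listprod n (xs @ ys)"] by simp
  ultimately show ?case using c(1)
    by (intro bexI[of _ "c * ?e"]) (auto simp: minus_one_power_iff)
qed

text \<open>The same sign serves the derivative and the word, so the value of a derivation does not
  depend on the ordering that \<open>mlist\<close> chooses.\<close>

lemma der_perm:
  assumes "dvals n q d" "mset xs = mset ys"
  shows "\<exists>c\<in>{1,-1}. der n q d xs = spscale c (der n q d ys) \<and> listprod n xs = spscale c (listprod n ys)"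
  using assms(2)
proof (induction ys arbitrary: xs)
  case Nil
  show ?case using Nil by (intro bexI[of _ 1]) auto
next
  case (Cons v ys)
  then obtain A B where xs: "xs = A @ v # B"
    by (metis list.set_intros(1) set_mset_mset split_list)
  from der_move[OF assms(1), of A v B] obtain c where c: "c \<in> {1,-1}"
    "der n q d xs = spscale c (der n q d (v # A @ B))" "listprod n xs = spscale c (listprod n (v # A @ B))"
    unfolding xs by blast
  have "mset (A @ B) = mset ys" using Cons.prems by (simp add: xs)
  from Cons.IH[OF this] obtain e where e: "e \<in> {1,-1}"
    "der n q d (A @ B) = spscale e (der n q d ys)" "listprod n (A @ B) = spscale e (listprod n ys)" by blast
  from der_cong[OF e(2,3), of v] c e(1) show ?case
    by (intro bexI[of _ "c * e"]) (auto simp del: der.simps listprod_Cons)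
qed

lemma sp_eq_neg_self: "(x::sp) = - x \<Longrightarrow> x = 0"
proof -
  assume "x = - x"
  then have "x M = - x M" for M by (metis uminus_apply)
  then show "x = 0" by (auto simp: fun_eq_iff fun_arith_apply eq_neg_iff_add_eq_0)
qed

text \<open>Swapping the two equal odd letters leaves the word unchanged but reverses the
  sign.\<close>

lemma der_repeated_odd:
  assumes "dvals n q d" "vpar n v = 1"
  shows "der n q d (v # v # vs) = 0" "listprod n (v # v # vs) = 0"
  using der_swap[OF assms(1), of v v vs] assms(2)
  by (simp_all only: listprod_Cons lv_odd_square) (auto intro!: sp_eq_neg_self simp del: der.simps)

lemma derX_eq_superset:
  "finite A \<Longrightarrow> supp f \<subseteq> A \<Longrightarrow> derX n q d f = (\<Sum>M\<in>A. spscale (f M) (der n q d (mlist n M)))"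
  unfolding derX_def by (rule sum.mono_neutral_left) (auto simp: supp_def)

lemma derX_add:
  assumes "fs f" "fs g" shows "derX n q d (f + g) = derX n q d f + derX n q d g"
  using derX_eq_superset[of "supp f \<union> supp g" "f + g" n q d] derX_eq_superset[of "supp f \<union> supp g" f n q d]
    derX_eq_superset[of "supp f \<union> supp g" g n q d] assms supp_add[of f g]
  by (simp add: sum.distrib[symmetric] sp.scale_left_distrib fun_arith_apply)

lemma derX_scale: "derX n q d (spscale c f) = spscale c (derX n q d f)"
proof (cases "c = 0")
  case False
  then have "supp (spscale c f) = supp f" by (auto simp: supp_def spscale_def)
  then show ?thesis by (simp add: derX_def sp.scale_sum_right spscale_apply)
qed (simp add: derX_def)

lemma derX_zero [simp]: "derX n q d 0 = 0"
  by (simp add: derX_def)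

lemma derX_uminus [simp]: "derX n q d (- f) = - derX n q d f"
  using derX_scale[of n q d "-1" f] by simp

lemma derX_diff: "fs f \<Longrightarrow> fs g \<Longrightarrow> derX n q d (f - g) = derX n q d f - derX n q d g"
  using derX_add[of f "- g" n q d] by simp

lemma derX_sum: "finite A \<Longrightarrow> (\<And>i. i \<in> A \<Longrightarrow> fs (f i)) \<Longrightarrow> derX n q d (sum f A) = (\<Sum>i\<in>A. derX n q d (f i))"
  by (induction A rule: finite_induct) (simp_all add: derX_add fs_sum)

lemma derX_mon: "derX n q d (mon M) = der n q d (mlist n M)"
  by (simp add: derX_def) (simp add: mon_def)

text \<open>Sorting the word changes both sides by the same sign; if an odd variable repeats, two
  copies can be moved to the front and both sides vanish.\<close>

lemma derX_listprod:
  assumes "dvals n q d" shows "derX n q d (listprod n vs) = der n q d vs"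
proof (cases "good n (mset vs)")
  case True
  obtain c where "der n q d vs = spscale c (der n q d (mlist n (mset vs)))"
      "listprod n vs = spscale c (listprod n (mlist n (mset vs)))"
    using der_perm[OF assms, of vs "mlist n (mset vs)"] unfolding mset_mlist by blast
  then show ?thesis using True by (simp add: listprod_mlist derX_scale derX_mon)
next
  case False
  then obtain v where v: "vpar n v = 1" "count (mset vs) v \<ge> 2" by (auto simp: good_def not_le)
  then have "replicate_mset 2 v \<subseteq># mset vs" by (simp add: count_le_replicate_mset_subset_eq)
  then obtain N where "mset vs = replicate_mset 2 v + N" by (metis subset_mset.le_iff_add)
  moreover obtain ws where "mset ws = N" using ex_mset by blast
  ultimately have "mset vs = mset (v # v # ws)" by (simp add: numeral_2_eq_2)
  from der_perm[OF assms this] der_repeated_odd[OF assms v(1), of ws] show ?thesis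
    by (auto simp del: der.simps listprod_Cons)
qed

text \<open>The set \<open>S\<close> will be the variables of g, those of p, or all variables. A
  monomial repeating an odd variable is a nonzero function although its word evaluates to zero, so
  the product rule requires \<open>good\<close>.\<close>

definition gval :: "nat \<Rightarrow> var set \<Rightarrow> sp \<Rightarrow> bool" where
  "gval n S f \<longleftrightarrow> fs f \<and> (\<forall>M\<in>supp f. good n M \<and> set_mset M \<subseteq> S)"

lemma gval_fs [simp]: "gval n S f \<Longrightarrow> fs f"
  by (simp add: gval_def)

lemma gval_zero [simp, intro]: "gval n S 0"
  by (simp add: gval_def)

lemma gval_add [simp, intro]: "gval n S f \<Longrightarrow> gval n S g \<Longrightarrow> gval n S (f + g)"
  using supp_add[of f g] by (auto simp: gval_def)

lemma gval_scale [simp, intro]: "gval n S f \<Longrightarrow> gval n S (spscale c f)"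
  using supp_scale[of c f] by (auto simp: gval_def)

lemma gval_uminus [simp, intro]: "gval n S f \<Longrightarrow> gval n S (- f)"
  using gval_scale[of n S f "-1"] by simp

lemma gval_diff [simp, intro]: "gval n S f \<Longrightarrow> gval n S g \<Longrightarrow> gval n S (f - g)"
  using gval_add[of n S f "- g"] by simp

lemma gval_sum [intro]: "(\<And>i. i \<in> A \<Longrightarrow> gval n S (f i)) \<Longrightarrow> gval n S (sum f A)"
  by (induction A rule: infinite_finite_induct) auto

lemma gval_one [simp, intro]: "gval n S (mon {#})"
  by (simp add: gval_def good_def)

lemma gval_spconst [simp, intro]: "gval n S (spconst c)"
  by (simp add: spconst_eq_mon)

lemma gval_spvar [intro]: "v \<in> S \<Longrightarrow> gval n S (spvar v)"
  by (simp add: gval_def good_def spvar_eq_mon)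

lemma good_add:
  assumes "good n A" "good n B" "monosign n A B \<noteq> 0" shows "good n (A + B)"
  unfolding good_def
proof (intro allI impI)
  fix v assume v: "vpar n v = 1"
  have "oddvars n A \<inter> oddvars n B = {}" using assms(3) by (auto simp: monosign_def split: if_splits)
  then have "v \<notin># A \<or> v \<notin># B" using v by (auto simp: oddvars_def)
  then show "count (A + B) v \<le> 1" using assms(1,2) v by (auto simp: good_def not_in_iff)
qed

lemma gval_spmul [simp, intro]: "gval n S f \<Longrightarrow> gval n S g \<Longrightarrow> gval n S (spmul n f g)"
  using supp_spmul[of n f g] by (fastforce simp: gval_def intro: good_add)

lemma gval_lv [intro]: "v \<in> S \<Longrightarrow> gval n S f \<Longrightarrow> gval n S (lv n v f)"
  by (metis gval_fs gval_spmul gval_spvar spmul_spvar)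

lemma gval_listprod: "set vs \<subseteq> S \<Longrightarrow> gval n S (listprod n vs)"
  by (induction vs) auto

lemma gval_mono: "gval n S f \<Longrightarrow> S \<subseteq> T \<Longrightarrow> gval n T f"
  by (auto simp: gval_def)

lemma gval_induct [consumes 1, case_names one lv add scale]:
  assumes "gval n S f"
    and "P (mon {#})"
    and "\<And>v f. v \<in> S \<Longrightarrow> gval n S f \<Longrightarrow> P f \<Longrightarrow> P (lv n v f)"
    and add: "\<And>f g. gval n S f \<Longrightarrow> gval n S g \<Longrightarrow> P f \<Longrightarrow> P g \<Longrightarrow> P (f + g)"
    and scale: "\<And>c f. gval n S f \<Longrightarrow> P f \<Longrightarrow> P (spscale c f)"
  shows "P f"
proof -
  have lp: "P (listprod n vs)" if "set vs \<subseteq> S" for vs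
    using that by (induction vs) (auto intro: assms gval_listprod)
  have "P 0" using scale[of "mon {#}" 0] assms(2) by simp
  have "P (\<Sum>M\<in>A. spscale (f M) (mon M)) \<and> gval n S (\<Sum>M\<in>A. spscale (f M) (mon M))" if "finite A" "A \<subseteq> supp f" for A
    using that
  proof (induction A rule: finite_induct)
    case (insert M A)
    then have "good n M" "set (mlist n M) \<subseteq> S"
      using assms(1) by (auto simp: gval_def simp flip: set_mset_mset)
    then have "P (mon M)" "gval n S (mon M)"
      using lp[of "mlist n M"] gval_listprod[of "mlist n M" S n] by (simp_all add: listprod_mlist)
    then show ?case using insert by (auto intro!: add scale)
  qed (use \<open>P 0\<close> in auto)
  then have "P (\<Sum>M\<in>supp f. spscale (f M) (mon M))" using assms(1) by simp
  moreover have "(\<Sum>M\<in>supp f. spscale (f M) (mon M)) = f"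
    by (rule fs_expand[symmetric]) (use assms(1) in simp)
  ultimately show ?thesis by simp
qed

lemma der_gval:
  assumes "\<And>v. v \<in> S \<Longrightarrow> gval n S (d v)"
  shows "set vs \<subseteq> S \<Longrightarrow> gval n S (der n q d vs)"
  by (induction vs) (auto intro!: assms gval_listprod)

lemma derX_gval:
  assumes "\<And>v. v \<in> S \<Longrightarrow> gval n S (d v)" "gval n S f"
  shows "gval n S (derX n q d f)"
  unfolding derX_def
proof (intro gval_sum gval_scale der_gval assms(1))
  fix M assume "M \<in> supp f"
  then have "set_mset M \<subseteq> S" using assms(2) by (simp add: gval_def)
  then show "set (mlist n M) \<subseteq> S" by (metis mset_mlist set_mset_mset)
qed

lemma derX_one [simp]: "dvals n q d \<Longrightarrow> derX n q d (mon {#}) = 0"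
  using derX_listprod[of n q d "[]"] by simp

text \<open>For a good monomial this is the recursion of \<open>der\<close> on the word
  \<open>v # mlist n M\<close>; that word need not be sorted, which \<open>derX_listprod\<close>
  permits.\<close>

lemma derX_lv:
  assumes "dvals n q d" "gval n S f"
  shows "derX n q d (lv n v f) = spscale ((-1) ^ (q * vpar n v)) (lv n v (derX n q d f)) + spmul n (d v) f"
proof -
  have d: "fs (d v)" by (rule dvals_fs[OF assms(1)])
  have *: "derX n q d (lv n v (mon M)) = spscale ((-1) ^ (q * vpar n v)) (lv n v (derX n q d (mon M))) + spmul n (d v) (mon M)"
    if "good n M" for M
    using derX_listprod[OF assms(1), of "v # mlist n M"] derX_listprod[OF assms(1), of "mlist n M"]
    by (simp add: listprod_mlist that)
  have fin: "finite (supp f)" using assms(2) by simp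
  have "derX n q d (lv n v f) = (\<Sum>M\<in>supp f. spscale (f M) (derX n q d (lv n v (mon M))))"
    by (subst fs_expand[of f]) (simp_all add: fin lv_sum lv_scale derX_sum derX_scale)
  also have "\<dots> = (\<Sum>M\<in>supp f. spscale ((-1) ^ (q * vpar n v)) (lv n v (derX n q d (spscale (f M) (mon M)))) + spmul n (d v) (spscale (f M) (mon M)))"
    using assms(2) by (intro sum.cong refl)
      (simp add: gval_def * derX_scale lv_scale spmul_scale_right sp.scale_right_distrib mult.commute)
  also have "\<dots> = spscale ((-1) ^ (q * vpar n v)) (lv n v (derX n q d (\<Sum>M\<in>supp f. spscale (f M) (mon M))))
      + spmul n (d v) (\<Sum>M\<in>supp f. spscale (f M) (mon M))"
    by (simp add: sum.distrib fin derX_sum lv_sum spmul_sum_right d sp.scale_sum_right)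
  finally show ?thesis using fs_expand[of f] fin by simp
qed

lemma fs_derX: "dvals n q d \<Longrightarrow> fs (derX n q d f)"
proof -
  assume "dvals n q d"
  then have d: "fs (d v)" for v by (rule dvals_fs)
  have "fs (der n q d vs)" for vs by (induction vs) (auto simp: d)
  then show ?thesis by (auto simp: derX_def intro!: fs_sum)
qed

lemma linhom_spmul_one: "linhom n r x \<Longrightarrow> spmul n x (mon {#}) = x"
proof (induction rule: linhom.induct)
  case (const c)
  then show ?case by (simp add: spmul_spconst) (simp add: spconst_eq_mon)
next
  case (var v c)
  then show ?case
    by (simp add: spmul_scale_left spmul_spvar lv_mon spvar_eq_mon[symmetric] monosign_single)
qed (simp_all add: spmul_add_left)

lemma lv_one: "lv n v (mon {#}) = spvar v"
  by (simp add: lv_mon spvar_eq_mon monosign_single)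

lemma derX_spvar: "dvals n q d \<Longrightarrow> derX n q d (spvar v) = d v"
  using derX_lv[of n q d UNIV "mon {#}" v]
  by (simp add: lv_one linhom_spmul_one[OF dvalsD])

lemma derX_spmul_linhom:
  assumes "dvals n q d" "linhom n r x" "gval n S f"
  shows "derX n q d (spmul n x f) = spmul n (derX n q d x) f + spscale ((-1) ^ (q * r)) (spmul n x (derX n q d f))"
  using assms(2)
proof (induction rule: linhom.induct)
  case (const c)
  then show ?case using assms(3) fs_derX[OF assms(1), of f]
    by (simp add: spmul_spconst derX_scale) (simp add: spconst_eq_mon derX_scale assms(1))
next
  case (var v c)
  have "(-1::complex) ^ (q * vpar n v) = (-1) ^ (q * r)"
    by (rule minus_one_power_mod2) (simp add: var mod_mult_right_eq)
  then show ?case using derX_lv[OF assms(1,3), of v] assms(3) fs_derX[OF assms(1), of f]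
    by (simp add: spmul_scale_left spmul_spvar derX_scale derX_spvar[OF assms(1)] sp.scale_right_distrib mult.commute add.commute)
next
  case (add f g)
  then show ?case using assms(3) fs_derX[OF assms(1)]
    by (simp add: spmul_add_left derX_add sp.scale_right_distrib)
qed

section \<open>The parity involution\<close>

lemma sigma_add: "sigma n (f + g) = sigma n f + sigma n g"
  and sigma_scale: "sigma n (spscale c f) = spscale c (sigma n f)"
  and sigma_zero [simp]: "sigma n 0 = 0"
  and sigma_uminus [simp]: "sigma n (- f) = - sigma n f"
  and sigma_diff: "sigma n (f - g) = sigma n f - sigma n g"
  by (auto simp: sigma_def fun_eq_iff fun_arith_apply spscale_def algebra_simps)

lemma sigma_sum: "sigma n (sum f A) = (\<Sum>i\<in>A. sigma n (f i))"
  by (induction A rule: infinite_finite_induct) (auto simp: sigma_add)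

lemma sigma_sigma [simp]: "sigma n (sigma n f) = f"
  by (auto simp: sigma_def simp flip: mult.assoc power_mult_distrib)

lemma sigma_eq_0_iff [simp]: "sigma n f = 0 \<longleftrightarrow> f = 0"
  by (metis sigma_sigma sigma_zero)

lemma supp_sigma [simp]: "supp (sigma n f) = supp f"
  by (auto simp: supp_def sigma_def)

lemma gval_sigma [simp]: "gval n S (sigma n f) = gval n S f"
  by (simp add: gval_def)

lemma sigma_apply: "sigma n f M = (-1) ^ card (oddvars n M) * f M"
  by (simp add: sigma_def)

lemma sigma_spmul: "sigma n (spmul n f g) = spmul n (sigma n f) (sigma n g)"
proof -
  have *: "(-1) ^ card (oddvars n (A + B)) * monosign n A B =
      (-1) ^ card (oddvars n A) * (-1) ^ card (oddvars n B) * monosign n A B" for A B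
    by (auto simp: monosign_def card_Un_disjoint power_add)
  show ?thesis
  proof
    fix M
    have "(-1) ^ card (oddvars n M) * (if A + B = M then f A * g B * monosign n A B else 0) =
      (if A + B = M then sigma n f A * sigma n g B * monosign n A B else 0)" for A B
      using *[of A B] by (auto simp: sigma_def)
    then show "sigma n (spmul n f g) M = spmul n (sigma n f) (sigma n g) M"
      unfolding sigma_apply[of n "spmul n f g"] unfolding spmul_def supp_sigma
      by (simp add: sum_distrib_left split_def)
  qed
qed

lemma sigma_one [simp]: "sigma n (mon {#}) = mon {#}"
  by (auto simp: sigma_def mon_def)

lemma sigma_linhom: "linhom n q x \<Longrightarrow> sigma n x = spscale ((-1) ^ q) x"
proof (induction rule: linhom.induct)
  case (const c)
  then show ?case by (auto simp: spconst_eq_mon sigma_scale)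
next
  case (var v c)
  have "sigma n (spvar v) = spscale ((-1) ^ q) (spvar v)"
    using var vpar_cases[of n v]
    by (auto simp: sigma_def spvar_eq_mon mon_def spscale_def oddvars_single minus_one_power_iff even_iff_mod_2_eq_zero)
  then show ?case by (simp add: sigma_scale mult.commute)
qed (simp add: sigma_add sp.scale_right_distrib)

lemma sigma_lv: "fs f \<Longrightarrow> sigma n (lv n v f) = spscale ((-1) ^ vpar n v) (lv n v (sigma n f))"
  using sigma_spmul[of n "spvar v" f] sigma_linhom[OF linhom_spvar[of n v "vpar n v"]]
  by (simp add: spmul_spvar spmul_scale_left)

lemma sigma_spmul_linhom:
  "linhom n q x \<Longrightarrow> sigma n (spmul n x f) = spscale ((-1) ^ q) (spmul n x (sigma n f))"
  by (simp add: sigma_spmul sigma_linhom spmul_scale_left)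

lemma derX_sigma:
  assumes "dvals n q d" "gval n S f"
  shows "derX n q d (sigma n f) = spscale ((-1) ^ q) (sigma n (derX n q d f))"
  using assms(2)
proof (induction rule: gval_induct)
  case (lv v f)
  have d: "linhom n (vpar n v + q) (d v)" by (rule dvalsD[OF assms(1)])
  have g: "gval n S (sigma n f)" using lv by simp
  show ?case
    using lv vpar_cases[of n v]
    by (auto simp: sigma_lv derX_scale derX_lv[OF assms(1) g] derX_lv[OF assms(1) lv(2)] sigma_add sigma_scale
      sigma_spmul_linhom[OF d] fs_derX[OF assms(1)] lv_scale sp.scale_right_distrib minus_one_power_iff)
next
  case (add f g)
  then show ?case by (simp add: sigma_add derX_add sp.scale_right_distrib)
next
  case (scale c f)
  then show ?case by (simp add: sigma_scale derX_scale mult.commute)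
qed (use assms in simp)

section \<open>The differential and the brackets\<close>

definition BV :: "nat \<Rightarrow> var set" where "BV n = {v. snd v \<in> basis n}"

definition PV :: "nat \<Rightarrow> var set" where
  "PV n = {v. snd v \<in> basis n \<and> ibar n (snd (snd v)) \<le> ibar n (fst (snd v))}"

lemma valid_iff_gval: "valid n f \<longleftrightarrow> gval n (BV n) f"
  by (auto simp: valid_def gval_def BV_def good_def)

lemma Vp_iff_gval: "f \<in> Vp n \<longleftrightarrow> gval n (PV n) f"
  by (auto simp: Vp_def valid_def gval_def PV_def good_def)

lemma dv_closed: "v \<in> BV n \<Longrightarrow> dv v \<in> BV n" "v \<in> PV n \<Longrightarrow> dv v \<in> PV n"
  by (auto simp: BV_def PV_def dv_def)

lemma PV_subset_BV: "PV n \<subseteq> BV n"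
  by (auto simp: BV_def PV_def)

lemma vpar_dv: "vpar n (dv v) = (vpar n v + 1) mod 2"
  by (simp add: vpar_def dv_def mod_simps)

lemma dvals_D: "dvals n 1 (\<lambda>v. spvar (dv v))"
  by (auto simp: dvals_def vpar_dv)

lemma Dlist_eq_der: "Dlist n vs = der n 1 (\<lambda>v. spvar (dv v)) vs \<and> fs (Dlist n vs)"
  by (induction vs) (auto simp: spmul_spvar)

lemma Dsp_eq_derX: "Dsp n f = derX n 1 (\<lambda>v. spvar (dv v)) f"
  by (rule ext) (simp add: Dsp_def derX_def sum_fun_apply spscale_apply Dlist_eq_der)

lemma Dsp_add: "fs f \<Longrightarrow> fs g \<Longrightarrow> Dsp n (f + g) = Dsp n f + Dsp n g"
  and Dsp_diff: "fs f \<Longrightarrow> fs g \<Longrightarrow> Dsp n (f - g) = Dsp n f - Dsp n g"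
  and Dsp_scale: "Dsp n (spscale c f) = spscale c (Dsp n f)"
  and Dsp_zero [simp]: "Dsp n 0 = 0"
  and Dsp_uminus [simp]: "Dsp n (- f) = - Dsp n f"
  by (simp_all add: Dsp_eq_derX derX_add derX_diff derX_scale)

lemma Dsp_one [simp]: "Dsp n (mon {#}) = 0"
  unfolding Dsp_eq_derX by (rule derX_one[OF dvals_D])

lemma fs_Dsp [simp, intro]: "fs (Dsp n f)"
  unfolding Dsp_eq_derX by (rule fs_derX[OF dvals_D])

lemma Dsp_lv:
  "gval n S f \<Longrightarrow> Dsp n (lv n v f) = spscale ((-1) ^ vpar n v) (lv n v (Dsp n f)) + lv n (dv v) f"
  using derX_lv[OF dvals_D, of n S f v] by (simp add: Dsp_eq_derX spmul_spvar)

lemma Dsp_spmul_linhom: "linhom n r x \<Longrightarrow> gval n S f \<Longrightarrow>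
    Dsp n (spmul n x f) = spmul n (Dsp n x) f + spscale ((-1) ^ r) (spmul n x (Dsp n f))"
  using derX_spmul_linhom[OF dvals_D, of n r x S f] by (simp add: Dsp_eq_derX)

lemma Dsp_sigma: "gval n S f \<Longrightarrow> Dsp n (sigma n f) = - sigma n (Dsp n f)"
  using derX_sigma[OF dvals_D, of n S f] by (simp add: Dsp_eq_derX)

lemma Dsp_spvar: "Dsp n (spvar v) = spvar (dv v)"
  using derX_spvar[OF dvals_D] by (simp add: Dsp_eq_derX)

lemma gval_Dsp: "gval n S f \<Longrightarrow> (\<And>v. v \<in> S \<Longrightarrow> dv v \<in> S) \<Longrightarrow> gval n S (Dsp n f)"
  unfolding Dsp_eq_derX by (rule derX_gval) auto

lemma gval_Dsp_BV [simp, intro]: "gval n (BV n) f \<Longrightarrow> gval n (BV n) (Dsp n f)"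
  and gval_Dsp_PV [simp, intro]: "gval n (PV n) f \<Longrightarrow> gval n (PV n) (Dsp n f)"
  and gval_Dsp_UNIV [simp, intro]: "gval n UNIV f \<Longrightarrow> gval n UNIV (Dsp n f)"
  by (auto intro: gval_Dsp dv_closed)

lemma linhom_Dsp: "linhom n q x \<Longrightarrow> linhom n (q + 1) (Dsp n x)"
proof (induction rule: linhom.induct)
  case (var v c)
  then show ?case
    by (auto simp: Dsp_scale Dsp_spvar vpar_dv mod_simps intro!: linhom_scale linhom_spvar)
qed (simp_all add: Dsp_add linhom.add, simp add: spconst_eq_mon Dsp_scale)

section \<open>Parity of matrices and of brackets\<close>

lemma par_pr: "i \<in> Iset n \<Longrightarrow> par n (pr n i) = par n i"
  by (auto simp: par_def pr_def Iset_def)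

lemma pr_pr [simp]: "i \<in> Iset n \<Longrightarrow> pr n (pr n i) = i"
  by (auto simp: pr_def Iset_def)

lemma pr_in_Iset: "pr n i \<in> Iset n \<longleftrightarrow> i \<in> Iset n"
  by (auto simp: pr_def Iset_def)

lemma finite_Iset [simp]: "finite (Iset n)"
  by (simp add: Iset_def)

lemma finite_basis [simp]: "finite (basis n)"
  by (rule finite_subset[of _ "Iset n \<times> Iset n"]) (auto simp: basis_def)

lemma Fmat_par:
  assumes "x \<in> Iset n" "y \<in> Iset n" "Fmat n i j x y \<noteq> 0"
  shows "(par n x + par n y) mod 2 = (par n i + par n j) mod 2"
proof -
  have "(x = i \<and> y = j) \<or> (x = pr n j \<and> y = pr n i)"
    using assms(3) by (auto simp: Fmat_def split: if_splits)
  then show ?thesis using assms(1,2) par_pr[of i n] par_pr[of j n] by (auto simp: pr_in_Iset add.commute)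
qed

definition mhom :: "nat \<Rightarrow> nat \<Rightarrow> mat \<Rightarrow> bool" where
  "mhom n q X \<longleftrightarrow> (\<forall>x\<in>Iset n. \<forall>y\<in>Iset n. X x y \<noteq> 0 \<longrightarrow> (par n x + par n y) mod 2 = q mod 2)"

lemma mhom_Fmat: "mhom n (par n i + par n j) (Fmat n i j)"
  using Fmat_par by (auto simp: mhom_def)

lemma mhom_cong: "mhom n q X \<Longrightarrow> q mod 2 = r mod 2 \<Longrightarrow> mhom n r X"
  by (auto simp: mhom_def)

lemma mhom_Fk: "mhom n (bpar n a) (Fk n a)"
  unfolding Fk_def bpar_def by (rule mhom_cong[OF mhom_Fmat]) simp

lemma mhom_mmul:
  assumes "mhom n q X" "mhom n r Y" shows "mhom n (q + r) (mmul n X Y)"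
  unfolding mhom_def
proof (intro ballI impI)
  fix x y assume xy: "x \<in> Iset n" "y \<in> Iset n" "mmul n X Y x y \<noteq> 0"
  have "(\<Sum>c\<in>Iset n. X x c * Y c y) \<noteq> 0" using xy(3) by (simp add: mmul_def)
  then obtain c where c: "c \<in> Iset n" "X x c * Y c y \<noteq> 0"
    by (rule sum.not_neutral_contains_not_neutral)
  then have "X x c \<noteq> 0" "Y c y \<noteq> 0" by auto
  then have "(par n x + par n c) mod 2 = q mod 2" "(par n c + par n y) mod 2 = r mod 2"
    using assms xy(1,2) c(1) unfolding mhom_def by blast+
  then have "((par n x + par n c) + (par n c + par n y)) mod 2 = (q + r) mod 2"
    by (rule mod_add_cong)
  moreover have "(par n x + par n c) + (par n c + par n y) = (par n x + par n y) + 2 * par n c" by simp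
  ultimately show "(par n x + par n y) mod 2 = (q + r) mod 2" by (metis mod_mult_self2)
qed

lemma mhom_sbr: "mhom n q X \<Longrightarrow> mhom n r Y \<Longrightarrow> mhom n (q + r) (sbr n p p' X Y)"
  using mhom_mmul[of n q X r Y] mhom_mmul[of n r Y q X]
  by (fastforce simp: mhom_def sbr_def add.commute)

lemma bilin_hom:
  assumes "mhom n q X" "mhom n r Y" "bilin n X Y \<noteq> 0" shows "even (q + r)"
proof -
  obtain x where "x \<in> Iset n" "mmul n X Y x x \<noteq> 0"
    using assms(3) unfolding bilin_def str_def by (metis (no_types, lifting) mult_zero_right sum.neutral)
  then have "(par n x + par n x) mod 2 = (q + r) mod 2"
    using mhom_mmul[OF assms(1,2)] unfolding mhom_def by blast
  then show ?thesis by (metis even_add even_iff_mod_2_eq_zero)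
qed

lemma barX_eq: "barX n X = (\<Sum>k\<in>basis n. spscale (coord n k X) (spvar (0, k)))"
  by (rule ext) (simp add: barX_def sum_fun_apply spscale_apply)

lemma linhom_barX:
  assumes "mhom n q X" shows "linhom n (q + 1) (barX n X)"
  unfolding barX_eq
proof (rule linhom_sum)
  fix k assume k: "k \<in> basis n"
  show "linhom n (q + 1) (spscale (coord n k X) (spvar (0, k)))"
  proof (cases "X (fst k) (snd k) = 0")
    case False
    then have "(par n (fst k) + par n (snd k)) mod 2 = q mod 2"
      using assms k by (auto simp: mhom_def basis_def)
    then have "vpar n (0, k) = (q + 1) mod 2" by (simp add: vpar_def bpar_def) presburger
    then show ?thesis by (rule linhom.var)
  qed (simp add: coord_def)
qed

lemma gval_barX [simp, intro]: "gval n (BV n) (barX n X)"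
  unfolding barX_eq by (auto simp: BV_def intro!: gval_sum gval_spvar)

text \<open>chi is odd, so the coefficient of chi^k has its parity shifted by \<open>k\<close>. The
  constant at \<open>k = 1\<close> is admissible because the form pairs only elements of equal
  parity.\<close>

lemma linhom_brk_base: "linhom n (bpar n b + 1 + bpar n a + k) (brk_base n a b k)"
proof -
  consider "k = 0" | "k = 1" | "k > 1" by linarith
  then show ?thesis
  proof cases
    case 1
    then show ?thesis unfolding brk_base_def
      by (auto intro!: linhom_scale linhom_cong[OF linhom_barX[OF mhom_sbr[OF mhom_Fk mhom_Fk]]])
         presburger
  next
    case 2
    show ?thesis
    proof (cases "bilin n (Fk n a) (Fk n b) = 0")
      case True
      then show ?thesis using 2 by (simp add: brk_base_def spconst_eq_mon)
    next
      case False
      then have "even (bpar n a + bpar n b)" by (rule bilin_hom[OF mhom_Fk mhom_Fk])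
      then show ?thesis using 2 by (auto simp: brk_base_def intro!: linhom.const)
    qed
  qed (simp add: brk_base_def)
qed

text \<open>The term -2 chi^2 of the commutation rule and the extra chi of sesquilinearity merge
  into one formula valid for even and odd \<open>k\<close>.\<close>

lemma brk_var_Suc: "brk_var n a (Suc m, b) k = spscale ((-1) ^ (bpar n a + k))
    (Dsp n (brk_var n a (m, b) k) - (if k = 0 then 0 else brk_var n a (m, b) (k - 1)))"
proof -
  have *: "brk_var n a (Suc m, b) = cvscale ((-1) ^ bpar n a)
      (cvadd (Dcv n (brk_var n a (m, b))) (chi (brk_var n a (m, b))))"
    by (simp add: brk_var_def)
  have **: "spscale 2 x = x + x" for x
    using sp.scale_left_distrib[of 1 1 x] by simp
  show ?thesis unfolding *
    by (auto simp: cvscale_def cvadd_def Dcv_def chi_def ** add.assoc minus_one_power_iff)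
qed

lemma brk_var_dv: "brk_var n a (dv v) k = spscale ((-1) ^ (bpar n a + k))
    (Dsp n (brk_var n a v k) - (if k = 0 then 0 else brk_var n a v (k - 1)))"
  using brk_var_Suc[of n a "fst v" "snd v" k] by (simp add: dv_def)

lemma brk_var_0: "brk_var n a (0, b) = brk_base n a b"
  by (simp add: brk_var_def)

lemma linhom_brk_var: "linhom n (vpar n (m, b) + (bpar n a + k)) (brk_var n a (m, b) k)"
proof (induction m arbitrary: k)
  case 0
  show ?case unfolding brk_var_0
    by (rule linhom_cong[OF linhom_brk_base]) (simp only: vpar_def fst_conv snd_conv mod_add_left_eq add_0_right add.assoc)
next
  case (Suc m)
  have v: "vpar n (Suc m, b) = (vpar n (m, b) + 1) mod 2" by (simp add: vpar_def mod_simps)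
  have "linhom n (vpar n (Suc m, b) + (bpar n a + k)) (Dsp n (brk_var n a (m, b) k))"
    by (rule linhom_cong[OF linhom_Dsp[OF Suc]]) (simp only: v mod_add_left_eq, simp only: add_ac)
  moreover have "linhom n (vpar n (Suc m, b) + (bpar n a + k)) (brk_var n a (m, b) (k - 1))" if "k \<noteq> 0"
    by (rule linhom_cong[OF Suc]) (use that in \<open>simp only: v mod_add_left_eq, cases k, simp_all add: mod_Suc_eq\<close>)
  ultimately show ?case unfolding brk_var_Suc by (auto intro!: linhom_scale linhom_diff)
qed

lemma dvals_brk: "dvals n (bpar n a + k) (\<lambda>v. brk_var n a v k)"
  unfolding dvals_def using linhom_brk_var[of n "fst v" "snd v" for v] by (metis prod.collapse)

lemma gval_brk_var: "gval n (BV n) (brk_var n a (m, b) k)"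
proof (induction m arbitrary: k)
  case 0
  show ?case by (auto simp: brk_var_0 brk_base_def)
next
  case (Suc m)
  then show ?case unfolding brk_var_Suc by auto
qed

text \<open>Moving chi^k to the left past a variable, encoded by \<open>sigma\<close> in
  \<open>lmul\<close>, adds \<open>k\<close> to the parity of the derivation.\<close>

lemma brk_list_eq_der: "brk_list n a vs k = der n (bpar n a + k) (\<lambda>v. brk_var n a v k) vs"
proof (induction vs)
  case (Cons v vs)
  let ?X = "der n (bpar n a + k) (\<lambda>v. brk_var n a v k) vs"
  have "fs (brk_var n a u k)" for u by (rule dvals_fs[OF dvals_brk])
  then have X: "fs ?X" by (induction vs) auto
  have s: "sigma n (spvar v) = spscale ((-1) ^ vpar n v) (spvar v)"
    by (rule sigma_linhom) auto
  show ?case using X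
    by (auto simp: cvadd_def cvscale_def lmul_def rmul_def Cons s spmul_scale_left spmul_spvar
        power_add distrib_right minus_one_power_iff simp del: listprod_Cons)
qed (simp add: cvzero_def)

lemma brk_eq_derX: "brk n a w k = derX n (bpar n a + k) (\<lambda>v. brk_var n a v k) w"
  by (rule ext) (simp add: brk_def derX_def sum_fun_apply spscale_apply brk_list_eq_der)

lemma brk_add: "fs f \<Longrightarrow> fs g \<Longrightarrow> brk n a (f + g) k = brk n a f k + brk n a g k"
  and brk_scale: "brk n a (spscale c f) k = spscale c (brk n a f k)"
  and brk_zero [simp]: "brk n a 0 k = 0"
  and brk_uminus [simp]: "brk n a (- f) k = - brk n a f k"
  and brk_sum: "finite A \<Longrightarrow> (\<And>i. i \<in> A \<Longrightarrow> fs (h i)) \<Longrightarrow> brk n a (sum h A) k = (\<Sum>i\<in>A. brk n a (h i) k)"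
  by (simp_all add: brk_eq_derX derX_add derX_scale derX_sum)

lemma brk_one [simp]: "brk n a (mon {#}) k = 0"
  by (simp add: brk_eq_derX dvals_brk)

lemma fs_brk [simp, intro]: "fs (brk n a f k)"
  by (simp add: brk_eq_derX fs_derX dvals_brk)

lemma brk_lv: "gval n S f \<Longrightarrow> brk n a (lv n v f) k =
    spscale ((-1) ^ ((bpar n a + k) * vpar n v)) (lv n v (brk n a f k)) + spmul n (brk_var n a v k) f"
  unfolding brk_eq_derX by (rule derX_lv[OF dvals_brk])

lemma brk_spmul_linhom: "linhom n r x \<Longrightarrow> gval n S f \<Longrightarrow>
    brk n a (spmul n x f) k = spmul n (brk n a x k) f
      + spscale ((-1) ^ ((bpar n a + k) * r)) (spmul n x (brk n a f k))"
  unfolding brk_eq_derX by (rule derX_spmul_linhom[OF dvals_brk])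

lemma brk_sigma: "gval n S f \<Longrightarrow> brk n a (sigma n f) k = spscale ((-1) ^ (bpar n a + k)) (sigma n (brk n a f k))"
  unfolding brk_eq_derX by (rule derX_sigma[OF dvals_brk])

lemma brk_spvar: "brk n a (spvar v) k = brk_var n a v k"
  unfolding brk_eq_derX by (rule derX_spvar[OF dvals_brk])

lemma gval_brk [simp, intro]: "gval n (BV n) f \<Longrightarrow> gval n (BV n) (brk n a f k)"
  unfolding brk_eq_derX by (rule derX_gval) (metis gval_brk_var prod.collapse)

lemma gval_brk_UNIV: "gval n UNIV f \<Longrightarrow> gval n UNIV (brk n a f k)"
  unfolding brk_eq_derX by (rule derX_gval) (metis gval_brk_var prod.collapse gval_mono subset_UNIV)

text \<open>On variables this is \<open>brk_var_dv\<close>. It propagates to products since D and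
  the chi-coefficients are derivations; the coefficient at \<open>k - 1\<close> is one of the
  opposite parity.\<close>

lemma brk_Dsp:
  assumes "gval n S f"
  shows "brk n a (Dsp n f) k = spscale ((-1) ^ (bpar n a + k))
    (Dsp n (brk n a f k) - (if k = 0 then 0 else brk n a f (k - 1)))"
proof -
  have "gval n UNIV f" using assms gval_mono by blast
  then show ?thesis
  proof (induction rule: gval_induct)
    case (lv v f)
    let ?q = "bpar n a + k"
    have l: "linhom n (vpar n v + (bpar n a + j)) (brk_var n a v j)" for j
      using dvals_brk dvalsD by blast
    have g: "gval n UNIV (brk n a f j)" "fs (brk n a f j)" "fs (brk_var n a v j)" "fs f" for j
      using lv gval_brk_UNIV dvals_fs[OF dvals_brk] by simp_all
    have pv: "vpar n (dv v) = (if vpar n v = 0 then 1 else 0)"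
      using vpar_cases[of n v] by (auto simp: vpar_dv)
    have ks: "(-1::complex) ^ (bpar n a + (k - 1)) = - ((-1) ^ (bpar n a + k))" if "k \<noteq> 0"
      using that by (cases k) auto
    have "brk n a (Dsp n (lv n v f)) k =
      spscale ((-1) ^ (?q * vpar n (dv v))) (lv n (dv v) (brk n a f k)) + spmul n (brk_var n a (dv v) k) f
      + spscale ((-1) ^ vpar n v) (spscale ((-1) ^ (?q * vpar n v)) (lv n v (brk n a (Dsp n f) k)) + spmul n (brk_var n a v k) (Dsp n f))"
      using lv(2) by (simp add: Dsp_lv brk_add brk_scale brk_lv[of n UNIV] add.commute)
    also have "\<dots> = spscale ((-1) ^ ?q) (Dsp n (brk n a (lv n v f) k) - (if k = 0 then 0 else brk n a (lv n v f) (k - 1)))"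
    proof -
      have A: "Dsp n (brk n a (lv n v f) k) = spscale ((-1) ^ (?q * vpar n v))
          (spscale ((-1) ^ vpar n v) (lv n v (Dsp n (brk n a f k))) + lv n (dv v) (brk n a f k))
          + (spmul n (Dsp n (brk_var n a v k)) f + spscale ((-1) ^ (vpar n v + ?q)) (spmul n (brk_var n a v k) (Dsp n f)))"
        using g lv(2) by (simp add: brk_lv[OF lv(2)] Dsp_add Dsp_scale Dsp_lv[OF g(1)] Dsp_spmul_linhom[OF l lv(2)])
      have B: "brk n a (lv n v f) (k - 1) = spscale ((-1) ^ ((bpar n a + (k - 1)) * vpar n v)) (lv n v (brk n a f (k - 1)))
          + spmul n (brk_var n a v (k - 1)) f" by (rule brk_lv[OF lv(2)])
      have C: "spmul n (brk_var n a (dv v) k) f = spscale ((-1) ^ ?q) (spmul n (Dsp n (brk_var n a v k)) f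
          - (if k = 0 then 0 else spmul n (brk_var n a v (k - 1)) f))"
        unfolding brk_var_dv using g spmul_add_left[of "Dsp n (brk_var n a v k)" "- brk_var n a v (k - 1)" f n]
        by (auto simp: spmul_scale_left)
      show ?thesis using vpar_cases[of n v] unfolding A B C lv(3) pv
        apply (cases "k = 0"; cases "even ?q"; elim disjE)
        apply (simp_all add: lv_scale lv_diff ks sp.scale_right_distrib sp.scale_right_diff_distrib minus_one_power_iff split del: if_split)
        done
    qed
    finally show ?case .
  next
    case (add f g)
    then show ?case by (auto simp: Dsp_add brk_add sp.scale_right_distrib sp.scale_right_diff_distrib)
  next
    case (scale c f)
    then show ?case by (auto simp: Dsp_scale brk_scale mult.commute sp.scale_right_diff_distrib)
  qed auto
qed

section \<open>The Lie superalgebra\<close>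

definition posi :: "nat \<Rightarrow> (nat \<times> nat) set" where
  "posi n = {(i,j)\<in>Iset n \<times> Iset n. ibar n i < ibar n j}"

lemma finite_posi [simp]: "finite (posi n)"
  by (rule finite_subset[of _ "Iset n \<times> Iset n"]) (auto simp: posi_def)

lemma ibar_pr: "i \<in> Iset n \<Longrightarrow> ibar n (pr n i) = 4 * n - ibar n i"
  by (auto simp: ibar_def pr_def Iset_def)

lemma ibar_le: "i \<in> Iset n \<Longrightarrow> ibar n i < 4 * n"
  by (auto simp: ibar_def Iset_def)

lemma dlt_pr: "i \<in> Iset n \<Longrightarrow> dlt n i + dlt n (pr n i) = par n i"
  by (auto simp: dlt_def pr_def Iset_def par_def) presburger+

lemma Fmat_posi:
  assumes "(i, j) \<in> posi n" "x \<in> Iset n" "y \<in> Iset n" "Fmat n i j x y \<noteq> 0"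
  shows "ibar n x < ibar n y"
proof -
  have "(x = i \<and> y = j) \<or> (x = pr n j \<and> y = pr n i)"
    using assms(4) by (auto simp: Fmat_def split: if_splits)
  moreover have "i \<in> Iset n" "j \<in> Iset n" "ibar n i < ibar n j" using assms(1) by (auto simp: posi_def)
  ultimately show ?thesis using ibar_le[of j n] by (auto simp: ibar_pr)
qed

text \<open>This says that \<theta> is an involution; all exponents pair up once
  \<open>dlt_pr\<close> is used.\<close>

lemma thsign_pr: "i \<in> Iset n \<Longrightarrow> j \<in> Iset n \<Longrightarrow> thsign n (pr n j) (pr n i) * thsign n i j = 1"
proof -
  assume ij: "i \<in> Iset n" "j \<in> Iset n"
  have "thsign n (pr n j) (pr n i) * thsign n i j =
     (-1) ^ (2 * (par n i * par n j + 1) + par n i + par n j + (dlt n i + dlt n (pr n i)) + (dlt n j + dlt n (pr n j)))"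
    unfolding thsign_def par_pr[OF ij(1)] par_pr[OF ij(2)] power_add[symmetric]
    by (rule arg_cong[of _ _ "(^) (-1)"]) (simp add: algebra_simps)
  also have "\<dots> = (-1) ^ (2 * (par n i * par n j + 1 + par n i + par n j))"
    unfolding dlt_pr[OF ij(1)] dlt_pr[OF ij(2)]
    by (rule arg_cong[of _ _ "(^) (-1)"]) (simp add: algebra_simps)
  finally show ?thesis by simp
qed

lemma sum_two_units:
  fixes A :: "'a \<Rightarrow> complex"
  assumes "finite I" "j \<in> I" "j' \<in> I"
  shows "(\<Sum>c\<in>I. A c * ((if c = j \<and> P then 1 else 0) + (if c = j' \<and> Q then t c else 0))) =
     (if P then A j else 0) + (if Q then A j' * t j' else 0)"
proof -
  have "(\<Sum>c\<in>I. A c * ((if c = j \<and> P then 1 else 0) + (if c = j' \<and> Q then t c else 0))) =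
    (\<Sum>c\<in>I. (if c = j then (if P then A j else 0) else 0) + (if c = j' then (if Q then A j' * t j' else 0) else 0))"
    by (rule sum.cong) (auto simp: distrib_left)
  then show ?thesis using assms by (simp add: sum.distrib)
qed

text \<open>Matrices of parity \<open>q\<close> that are fixed by \<open>\<theta>\<close>.\<close>

definition osp :: "nat \<Rightarrow> nat \<Rightarrow> mat \<Rightarrow> bool" where
  "osp n q a \<longleftrightarrow> mhom n q a \<and>
     (\<forall>i\<in>Iset n. \<forall>j\<in>Iset n. a (pr n j) (pr n i) = thsign n i j * a i j)"

lemma osp_Fmat:
  assumes "k \<in> Iset n" "l \<in> Iset n" shows "osp n (par n k + par n l) (Fmat n k l)"
  unfolding osp_def
proof (intro conjI mhom_Fmat ballI)
  fix i j assume ij: "i \<in> Iset n" "j \<in> Iset n"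
  have e: "pr n j = k \<longleftrightarrow> j = pr n k" "pr n i = l \<longleftrightarrow> i = pr n l" "pr n j = pr n l \<longleftrightarrow> j = l" "pr n i = pr n k \<longleftrightarrow> i = k"
    using assms ij by (metis pr_pr)+
  show "Fmat n k l (pr n j) (pr n i) = thsign n i j * Fmat n k l i j"
    unfolding Fmat_def e
  proof -
    have "(if j = k' \<and> i = l' then 1 else 0) + (if j = l \<and> i = k then thsign n k l else 0) =
       thsign n i j * ((if i = k \<and> j = l then 1 else 0) + (if i = l' \<and> j = k' then thsign n k l else 0))"
      if "thsign n l' k' * thsign n k l = 1" for k' l'
      using that by (auto simp: distrib_left)
    from this[OF thsign_pr[OF assms]]
    show "(if j = pr n k \<and> i = pr n l then 1 else 0) + (if j = l \<and> i = k then thsign n k l else 0) =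
       thsign n i j * ((if i = k \<and> j = l then 1 else 0) + (if i = pr n l \<and> j = pr n k then thsign n k l else 0))" .
  qed
qed

lemma osp_add: "osp n q a \<Longrightarrow> osp n q b \<Longrightarrow> osp n q (\<lambda>x y. a x y + b x y)"
  unfolding osp_def mhom_def by (simp add: algebra_simps) (metis add.right_neutral)

lemma osp_sum:
  assumes "finite A" "\<And>i. i \<in> A \<Longrightarrow> osp n q (f i)"
  shows "osp n q (\<lambda>x y. \<Sum>i\<in>A. f i x y)"
  using assms
proof (induction A rule: finite_induct)
  case empty
  show ?case by (simp add: osp_def mhom_def)
next
  case (insert i A)
  then show ?case using osp_add[of n q "f i" "\<lambda>x y. \<Sum>i\<in>A. f i x y"] by simp
qed

lemma osp_cong: "osp n q a \<Longrightarrow> q mod 2 = r mod 2 \<Longrightarrow> osp n r a"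
  by (simp add: osp_def mhom_def)

lemma osp_fmat: "1 \<le> n \<Longrightarrow> osp n 1 (fmat n)"
  unfolding fmat_def
proof (intro osp_add osp_sum)
  assume n: "1 \<le> n"
  show "osp n 1 (Fmat n (2*n+1) (2*n-1))"
    using n by (intro osp_cong[OF osp_Fmat]) (auto simp: Iset_def par_def)
  fix i assume "i \<in> {1..2*n-1}"
  then show "osp n 1 (Fmat n (i+1) i)"
    using n by (intro osp_cong[OF osp_Fmat]) (auto simp: Iset_def par_def)
qed simp

lemma osp_Fk: "fst b \<in> Iset n \<Longrightarrow> snd b \<in> Iset n \<Longrightarrow> osp n (bpar n b) (Fk n b)"
  unfolding Fk_def bpar_def by (rule osp_cong[OF osp_Fmat]) simp_all

lemma thsign_cases: "thsign n i j = 1 \<or> thsign n i j = -1"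
  by (auto simp: thsign_def minus_one_power_iff)

text \<open>\<open>basis\<close> picks one index from each orbit of (x, y) -> (y', x'). At a fixed
  point, where x + y = 4n+1, \<open>Fmat\<close> is twice a matrix unit or zero; hence the half in
  \<open>coord\<close> and the sign condition in \<open>basis\<close>.\<close>

lemma osp_expand:
  assumes "osp n q a" "x \<in> Iset n" "y \<in> Iset n"
  shows "a x y = (\<Sum>b\<in>basis n. coord n b a * Fk n b x y)"
proof -
  have F: "Fk n b x y = (if b = (x, y) then 1 else 0) + (if b = (pr n y, pr n x) then thsign n (pr n y) (pr n x) else 0)"
    if "b \<in> basis n" for b
  proof -
    have "fst b \<in> Iset n" "snd b \<in> Iset n" using that by (auto simp: basis_def)
    then have "x = pr n (snd b) \<and> y = pr n (fst b) \<longleftrightarrow> b = (pr n y, pr n x)"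
      using assms(2,3) by (cases b) (auto simp: pr_in_Iset)
    moreover have "x = fst b \<and> y = snd b \<longleftrightarrow> b = (x, y)" by (cases b) auto
    ultimately show ?thesis unfolding Fk_def Fmat_def by auto
  qed
  define u where "u = (pr n y, pr n x)"
  define t where "t = thsign n (pr n y) (pr n x)"
  have "(\<Sum>b\<in>basis n. coord n b a * Fk n b x y) =
    (\<Sum>b\<in>basis n. (if b = (x, y) then coord n (x, y) a else 0) + (if b = u then coord n u a * t else 0))"
    by (rule sum.cong) (simp_all only: F distrib_left flip: u_def t_def, simp)
  also have "\<dots> = (if (x, y) \<in> basis n then coord n (x, y) a else 0) +
     (if u \<in> basis n then coord n u a * t else 0)"
    by (simp add: sum.distrib)
  also have "\<dots> = a x y"
  proof -
    have I: "pr n x \<in> Iset n" "pr n y \<in> Iset n" using assms by (auto simp: pr_in_Iset)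
    have sym: "a (pr n j) (pr n i) = thsign n i j * a i j" if "i \<in> Iset n" "j \<in> Iset n" for i j
      using assms(1) that by (auto simp: osp_def)
    have a2: "a (pr n y) (pr n x) * thsign n (pr n y) (pr n x) = a x y"
      using sym[OF I(2) I(1)] assms(2,3) by simp
    have s: "pr n x + pr n y = 8 * n + 2 - (x + y)" using assms(2,3) by (auto simp: pr_def Iset_def)
    have le: "x + y \<le> 8 * n" using assms(2,3) by (auto simp: Iset_def)
    consider "x + y < 4*n+1" | "x + y > 4*n+1" | "x + y = 4*n+1" by linarith
    then show ?thesis
    proof cases
      case 1
      then show ?thesis using s assms(2,3) by (auto simp: basis_def coord_def u_def t_def)
    next
      case 2
      then show ?thesis using s le I a2 by (auto simp: basis_def coord_def u_def t_def)
    next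
      case 3
      then have xy: "pr n y = x" "pr n x = y" using assms(2,3) by (auto simp: pr_def Iset_def)
      show ?thesis
      proof (cases "thsign n x y = 1")
        case True
        then show ?thesis using 3 assms(2,3) by (auto simp: xy basis_def coord_def u_def t_def)
      next
        case False
        then have "thsign n x y = -1" using thsign_cases by blast
        then have "a x y = - a x y" using a2 by (simp add: xy)
        then have "a x y = 0" by (simp add: eq_neg_iff_add_eq_0)
        then show ?thesis using 3 False by (auto simp: xy basis_def u_def t_def)
      qed
    qed
  qed
  finally show ?thesis by simp
qed

text \<open>The commutator with the matrix unit at (j, i) alone has this shape. Invariance of
  \<open>a\<close> under \<theta> makes the \<theta>-halves fit the same sums.\<close>

lemma sbr_osp_Fmat:
  assumes "osp n q a" "i \<in> Iset n" "j \<in> Iset n" "x \<in> Iset n" "y \<in> Iset n"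
    and r: "r mod 2 = (par n i + par n j) mod 2"
  shows "sbr n q r a (Fmat n j i) x y =
    (\<Sum>k\<in>Iset n. a k j * Fmat n k i x y) - (-1) ^ (q * (par n i + par n j)) * (\<Sum>l\<in>Iset n. a i l * Fmat n j l x y)"
proof -
  let ?s = "(-1) ^ (q * (par n i + par n j)) :: complex"
  have s: "(-1) ^ (q * r) = ?s"
    by (rule minus_one_power_mod2) (metis r mod_mult_right_eq)
  have I: "pr n x \<in> Iset n" "pr n y \<in> Iset n" "pr n i \<in> Iset n" "pr n j \<in> Iset n"
    using assms by (auto simp: pr_in_Iset)
  have sym: "a (pr n j) (pr n i) = thsign n i j * a i j" if "i \<in> Iset n" "j \<in> Iset n" for i j
    using assms(1) that by (auto simp: osp_def)
  have hom: "(par n u + par n v) mod 2 = q mod 2" if "a u v \<noteq> 0" "u \<in> Iset n" "v \<in> Iset n" for u v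
    using assms(1) that by (auto simp: osp_def mhom_def)
  have pc: "pr n u = v \<longleftrightarrow> u = pr n v" if "u \<in> Iset n" "v \<in> Iset n" for u v
    using that by (metis pr_pr)
  have 1: "mmul n a (Fmat n j i) x y = (if y = i then a x j else 0) + (if y = pr n j then a x (pr n i) * thsign n j i else 0)"
    unfolding mmul_def Fmat_def by (rule sum_two_units) (use assms I in simp_all)
  have 2: "mmul n (Fmat n j i) a x y = (if x = j then a i y else 0) + (if x = pr n i then a (pr n j) y * thsign n j i else 0)"
  proof -
    have "mmul n (Fmat n j i) a x y = (\<Sum>c\<in>Iset n. a c y * ((if c = i \<and> x = j then 1 else 0) + (if c = pr n j \<and> x = pr n i then thsign n j i else 0)))"
      unfolding mmul_def Fmat_def by (simp only: conj_commute mult.commute)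
    also have "\<dots> = (if x = j then a i y else 0) + (if x = pr n i then a (pr n j) y * thsign n j i else 0)"
      by (rule sum_two_units) (use assms I in simp_all)
    finally show ?thesis .
  qed
  have 3: "(\<Sum>k\<in>Iset n. a k j * Fmat n k i x y) = (if y = i then a x j else 0) + (if x = pr n i then a (pr n y) j * thsign n (pr n y) i else 0)"
  proof -
    have "(\<Sum>k\<in>Iset n. a k j * Fmat n k i x y) = (\<Sum>k\<in>Iset n. a k j * ((if k = x \<and> y = i then 1 else 0) + (if k = pr n y \<and> x = pr n i then thsign n k i else 0)))"
      using pc[OF _ assms(5)] by (intro sum.cong refl) (simp only: Fmat_def conj_commute eq_commute[of x] eq_commute[of y])
    also have "\<dots> = (if y = i then a x j else 0) + (if x = pr n i then a (pr n y) j * thsign n (pr n y) i else 0)"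
      by (rule sum_two_units) (use assms I in simp_all)
    finally show ?thesis .
  qed
  have 4: "(\<Sum>l\<in>Iset n. a i l * Fmat n j l x y) = (if x = j then a i y else 0) + (if y = pr n j then a i (pr n x) * thsign n j (pr n x) else 0)"
  proof -
    have "(\<Sum>l\<in>Iset n. a i l * Fmat n j l x y) = (\<Sum>l\<in>Iset n. a i l * ((if l = y \<and> x = j then 1 else 0) + (if l = pr n x \<and> y = pr n j then thsign n j l else 0)))"
      using pc[OF _ assms(4)] by (intro sum.cong refl) (simp only: Fmat_def conj_commute eq_commute[of x] eq_commute[of y])
    also have "\<dots> = (if x = j then a i y else 0) + (if y = pr n j then a i (pr n x) * thsign n j (pr n x) else 0)"
      by (rule sum_two_units) (use assms I in simp_all)
    finally show ?thesis .
  qed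
  \<comment> \<open>The \<theta>-halves match crosswise: that of \<open>a\<close> times F belongs to
    the second sum, that of F times \<open>a\<close> (in \<open>6\<close>) to the first.\<close>
  have 5: "a x (pr n i) * thsign n j i = - ?s * (a i (pr n x) * thsign n j (pr n x))"
  proof (cases "a i (pr n x) = 0")
    case True
    then show ?thesis using sym[of i "pr n x"] assms I by simp
  next
    case False
    then have "(par n i + par n x) mod 2 = q mod 2" using hom[OF _ assms(2) I(1)] par_pr[OF assms(4)] by simp
    then have q: "?s = (-1) ^ ((par n i + par n x) * (par n i + par n j))"
      by (intro minus_one_power_mod2) (metis mod_mult_left_eq)
    have "thsign n i (pr n x) * thsign n j i = - ?s * thsign n j (pr n x)"
      unfolding q thsign_def par_pr[OF assms(4)]
      by (simp add: minus_one_power_iff) (auto simp: par_def dlt_def)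
    from arg_cong[OF this, of "\<lambda>z. a i (pr n x) * z"]
    show ?thesis using sym[of i "pr n x"] assms I by (simp add: mult_ac)
  qed
  have 6: "- ?s * (a (pr n j) y * thsign n j i) = a (pr n y) j * thsign n (pr n y) i"
  proof (cases "a (pr n y) j = 0")
    case True
    then show ?thesis using sym[of "pr n y" j] assms I by simp
  next
    case False
    then have "(par n y + par n j) mod 2 = q mod 2" using hom[OF _ I(2) assms(3)] par_pr[OF assms(5)] by simp
    then have q: "?s = (-1) ^ ((par n y + par n j) * (par n i + par n j))"
      by (intro minus_one_power_mod2) (metis mod_mult_left_eq)
    have "- ?s * thsign n j i * thsign n (pr n y) j = thsign n (pr n y) i"
      unfolding q thsign_def par_pr[OF assms(5)]
      by (simp add: minus_one_power_iff) (auto simp: par_def dlt_def)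
    from arg_cong[OF this, of "\<lambda>z. a (pr n y) j * z"]
    show ?thesis using sym[of "pr n y" j] assms I by (simp add: mult_ac)
  qed
  show ?thesis unfolding sbr_def 1 2 3 4 s 5 6[symmetric]
    by (auto simp: algebra_simps)
qed

text \<open>The two halves of \<open>Fmat\<close> contribute equally; the resulting factor 2 is what
  the normalization of \<open>Ebar\<close> removes.\<close>

lemma bilin_osp_Fmat:
  assumes "osp n q a" "i \<in> Iset n" "j \<in> Iset n"
  shows "bilin n a (Fmat n j i) = 2 * (-1) ^ par n i * a i j"
proof -
  have I: "pr n i \<in> Iset n" "pr n j \<in> Iset n" using assms by (auto simp: pr_in_Iset)
  have 1: "mmul n a (Fmat n j i) x x = (if x = i then a x j else 0) + (if x = pr n j then a x (pr n i) * thsign n j i else 0)"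
    for x
    unfolding mmul_def Fmat_def by (rule sum_two_units) (use assms I in simp_all)
  have "bilin n a (Fmat n j i) = (\<Sum>x\<in>Iset n. (-1) ^ par n x * (if x = i then a x j else 0) +
      (-1) ^ par n x * (if x = pr n j then a x (pr n i) * thsign n j i else 0))"
    unfolding bilin_def str_def 1 distrib_left ..
  also have "\<dots> = (-1) ^ par n i * a i j + (-1) ^ par n j * (a (pr n j) (pr n i) * thsign n j i)"
    using assms I par_pr[OF assms(3)] by (simp add: sum.distrib if_distrib[of "\<lambda>z. _ * z"] cong: if_cong)
  also have "a (pr n j) (pr n i) = thsign n i j * a i j" using assms by (auto simp: osp_def)
  also have "(-1) ^ par n j * (thsign n i j * a i j * thsign n j i) = (-1) ^ par n i * a i j"
    unfolding thsign_def by (simp add: minus_one_power_iff)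
  finally show ?thesis by simp
qed

lemma barX_cong: "(\<And>x y. x \<in> Iset n \<Longrightarrow> y \<in> Iset n \<Longrightarrow> X x y = Y x y) \<Longrightarrow> barX n X = barX n Y"
  unfolding barX_eq by (intro sum.cong refl) (auto simp: coord_def basis_def)

lemma barX_lincomb: "finite A \<Longrightarrow> barX n (\<lambda>x y. \<Sum>i\<in>A. c i * X i x y) = (\<Sum>i\<in>A. spscale (c i) (barX n (X i)))"
proof -
  assume "finite A"
  have c: "coord n k (\<lambda>x y. \<Sum>i\<in>A. c i * X i x y) = (\<Sum>i\<in>A. c i * coord n k (X i))" for k
    by (simp add: coord_def sum_divide_distrib)
  show ?thesis unfolding barX_eq c sp.scale_sum_left sp.scale_sum_right
    by (subst sum.swap) simp
qed

lemma bilin_lincomb: "bilin n a (\<lambda>x y. \<Sum>i\<in>A. c i * X i x y) = (\<Sum>i\<in>A. c i * bilin n a (X i))"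
proof -
  have "mmul n a (\<lambda>x y. \<Sum>i\<in>A. c i * X i x y) x y = (\<Sum>i\<in>A. c i * mmul n a (X i) x y)" for x y
    unfolding mmul_def sum_distrib_left by (subst sum.swap) (simp add: algebra_simps)
  then show ?thesis
    unfolding bilin_def str_def sum_distrib_left by (subst sum.swap) (simp add: algebra_simps sum_distrib_left)
qed

lemma bilin_cong: "(\<And>x y. x \<in> Iset n \<Longrightarrow> y \<in> Iset n \<Longrightarrow> X x y = Y x y) \<Longrightarrow> bilin n a X = bilin n a Y"
  by (simp add: bilin_def str_def mmul_def)

lemma sbr_lincomb: "sbr n p r a (\<lambda>x y. \<Sum>i\<in>A. c i * X i x y) x y = (\<Sum>i\<in>A. c i * sbr n p r a (X i) x y)"
proof -
  have "mmul n a (\<lambda>x y. \<Sum>i\<in>A. c i * X i x y) x y = (\<Sum>i\<in>A. c i * mmul n a (X i) x y)"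
    unfolding mmul_def sum_distrib_left by (subst sum.swap) (simp add: algebra_simps)
  moreover have "mmul n (\<lambda>x y. \<Sum>i\<in>A. c i * X i x y) a x y = (\<Sum>i\<in>A. c i * mmul n (X i) a x y)"
    unfolding mmul_def sum_distrib_left sum_distrib_right by (subst sum.swap) (simp add: algebra_simps)
  ultimately show ?thesis by (simp add: sbr_def sum_subtractf sum_distrib_left algebra_simps)
qed

lemma sbr_cong: "(\<And>x y. x \<in> Iset n \<Longrightarrow> y \<in> Iset n \<Longrightarrow> X x y = Y x y) \<Longrightarrow> x \<in> Iset n \<Longrightarrow> y \<in> Iset n \<Longrightarrow>
    sbr n p r a X x y = sbr n p r a Y x y"
  by (simp add: sbr_def mmul_def)

lemma linhom_Ebar: "linhom n (par n i + par n j + 1) (Ebar n j i)"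
  unfolding Ebar_def by (rule linhom_scale, rule linhom_cong[OF linhom_barX[OF mhom_Fmat]]) (simp add: add_ac)

lemma gval_Ebar [simp, intro]: "gval n (BV n) (Ebar n j i)"
  by (simp add: Ebar_def)

lemma barX_Fmat: "barX n (Fmat n j i) = spscale (2 * (-1) ^ par n j) (Ebar n j i)"
  by (simp add: Ebar_def)

text \<open>In the normalization \<open>Ebar\<close> the bracket with \<open>a\<close> becomes a
  matrix commutator with \<open>Fk n a\<close>, and its chi-term is an entry of
  \<open>Fk n a\<close> up to a sign that depends on the parity of \<open>a\<close> only.\<close>

lemma brk_Ebar:
  assumes "i \<in> Iset n" "j \<in> Iset n" "fst a \<in> Iset n" "snd a \<in> Iset n"
  shows "brk n a (Ebar n j i) 0 =
      (\<Sum>k\<in>Iset n. spscale ((-1) ^ (bpar n a * (par n i + par n j)) * Fk n a k j) (Ebar n k i))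
    - (\<Sum>l\<in>Iset n. spscale ((-1) ^ bpar n a * Fk n a i l) (Ebar n j l))" (is ?A)
    and "brk n a (Ebar n j i) 1 = spconst ((-1) ^ bpar n a * Fk n a i j)" (is ?B)
    and "k > 1 \<Longrightarrow> brk n a (Ebar n j i) k = 0"
proof -
  let ?F = "Fmat n j i" and ?p = "bpar n a"
  define P where "P = par n i + par n j"
  have oF: "osp n P ?F" unfolding P_def using osp_Fmat[of j n i] assms by (simp add: add.commute)
  have oa: "osp n ?p (Fk n a)" by (rule osp_Fk) fact+
  have E: "brk n a (Ebar n j i) m = spscale (1/2 * (-1) ^ par n j) (\<Sum>b\<in>basis n. spscale (coord n b ?F) (brk_base n a b m))" for m
    unfolding Ebar_def barX_eq
    by (simp add: brk_scale brk_sum brk_spvar brk_var_0)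
  have bp: "bpar n b mod 2 = P mod 2" if "b \<in> basis n" "coord n b ?F \<noteq> 0" for b
  proof -
    have "?F (fst b) (snd b) \<noteq> 0" using that by (auto simp: coord_def split: if_splits)
    then show ?thesis using oF that(1) by (auto simp: osp_def mhom_def basis_def bpar_def)
  qed
  show "k > 1 \<Longrightarrow> brk n a (Ebar n j i) k = 0" unfolding E by (simp add: brk_base_def)
  show ?B
  proof -
    have "(\<Sum>b\<in>basis n. spscale (coord n b ?F) (brk_base n a b 1)) = spscale (\<Sum>b\<in>basis n. coord n b ?F * bilin n (Fk n a) (Fk n b)) (mon {#})"
      by (simp add: brk_base_def spconst_eq_mon sp.scale_sum_left)
    also have "(\<Sum>b\<in>basis n. coord n b ?F * bilin n (Fk n a) (Fk n b)) = bilin n (Fk n a) ?F"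
      unfolding bilin_lincomb[symmetric] by (rule bilin_cong) (rule osp_expand[OF oF, symmetric])
    also have "\<dots> = 2 * (-1) ^ par n i * Fk n a i j" by (rule bilin_osp_Fmat[OF oa]) fact+
    finally have "brk n a (Ebar n j i) 1 = spconst ((-1) ^ (par n i + par n j) * Fk n a i j)"
      unfolding E by (simp add: spconst_eq_mon power_add mult_ac)
    moreover have "(-1) ^ (par n i + par n j) = ((-1) ^ ?p :: complex)" if "Fk n a i j \<noteq> 0"
      using that oa assms by (intro minus_one_power_mod2) (auto simp: osp_def mhom_def)
    ultimately show ?thesis by (cases "Fk n a i j = 0") auto
  qed
  show ?A
  proof -
    \<comment> \<open>Only basis elements with the parity of F_ji have a nonzero coordinate, so the
      sign can leave the sum.\<close>
    have 1: "spscale (coord n b ?F) (brk_base n a b 0) =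
        spscale ((-1) ^ (?p * (P + 1))) (spscale (coord n b ?F) (barX n (sbr n ?p P (Fk n a) (Fk n b))))"
      if b: "b \<in> basis n" for b
    proof (cases "coord n b ?F = 0")
      case False
      from bp[OF b this] have "(-1::complex) ^ (?p * (bpar n b + 1)) = (-1) ^ (?p * (P + 1))"
        "(-1::complex) ^ (?p * bpar n b) = (-1) ^ (?p * P)"
        by (intro minus_one_power_mod2; metis mod_mult_right_eq mod_add_left_eq)+
      then show ?thesis by (simp add: brk_base_def sbr_def mult.commute)
    qed simp
    have 2: "(\<Sum>b\<in>basis n. spscale (coord n b ?F) (brk_base n a b 0)) =
       spscale ((-1) ^ (?p * (P + 1))) (barX n (sbr n ?p P (Fk n a) ?F))"
    proof -
      have "(\<Sum>b\<in>basis n. spscale (coord n b ?F) (barX n (sbr n ?p P (Fk n a) (Fk n b)))) =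
        barX n (\<lambda>x y. \<Sum>b\<in>basis n. coord n b ?F * sbr n ?p P (Fk n a) (Fk n b) x y)"
        by (simp add: barX_lincomb)
      also have "\<dots> = barX n (sbr n ?p P (Fk n a) ?F)"
        unfolding sbr_lincomb[symmetric]
        by (rule barX_cong) (rule sbr_cong, rule osp_expand[OF oF, symmetric])
      finally have *: "barX n (sbr n ?p P (Fk n a) ?F) =
        (\<Sum>b\<in>basis n. spscale (coord n b ?F) (barX n (sbr n ?p P (Fk n a) (Fk n b))))" by simp
      show ?thesis unfolding * sp.scale_sum_right by (rule sum.cong[OF refl 1])
    qed
    have 3: "barX n (sbr n ?p P (Fk n a) ?F) = (\<Sum>k\<in>Iset n. spscale (Fk n a k j) (barX n (Fmat n k i)))
        - spscale ((-1) ^ (?p * P)) (\<Sum>l\<in>Iset n. spscale (Fk n a i l) (barX n (Fmat n j l)))"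
    proof -
      have "barX n (sbr n ?p P (Fk n a) ?F) = barX n (\<lambda>x y. \<Sum>m\<in>{0,1::nat}. (if m = 0 then 1 else - ((-1) ^ (?p * P))) *
         (if m = 0 then (\<Sum>k\<in>Iset n. Fk n a k j * Fmat n k i x y) else (\<Sum>l\<in>Iset n. Fk n a i l * Fmat n j l x y)))"
        using sbr_osp_Fmat[OF oa assms(1,2), of _ _ P] by (intro barX_cong) (simp add: P_def)
      also have "\<dots> = barX n (\<lambda>x y. \<Sum>k\<in>Iset n. Fk n a k j * Fmat n k i x y)
          - spscale ((-1) ^ (?p * P)) (barX n (\<lambda>x y. \<Sum>l\<in>Iset n. Fk n a i l * Fmat n j l x y))"
        by (subst barX_lincomb) simp_all
      finally show ?thesis by (simp add: barX_lincomb)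
    qed
    \<comment> \<open>A nonzero entry at (k, j) forces the parities of k and j to add up to that of
      \<open>a\<close>; this absorbs the sign left by passing from F_ki to
      \<open>Ebar n k i\<close>.\<close>
    have 4: "spscale (1/2 * (-1) ^ par n j * (-1) ^ (?p * (P + 1))) (spscale (Fk n a k j) (barX n (Fmat n k i))) =
       spscale ((-1) ^ (?p * P) * Fk n a k j) (Ebar n k i)" if "k \<in> Iset n" for k
    proof (cases "Fk n a k j = 0")
      case False
      then have "(par n k + par n j) mod 2 = ?p mod 2" using oa assms that by (auto simp: osp_def mhom_def)
      then have "((-1) ^ ?p :: complex) = (-1) ^ (par n k + par n j)" by (intro minus_one_power_mod2) simp
      then have "((-1) ^ par n j * (-1) ^ (?p * (P + 1)) * (-1) ^ par n k :: complex) = (-1) ^ (?p * P)"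
        by (auto simp: power_add minus_one_power_iff)
      then have "1/2 * (-1) ^ par n j * (-1) ^ (?p * (P + 1)) * (Fk n a k j * (2 * (-1) ^ par n k)) = (-1) ^ (?p * P) * Fk n a k j"
        by (simp add: mult_ac)
      then show ?thesis by (simp only: barX_Fmat sp.scale_scale)
    qed simp
    have 5: "spscale (1/2 * (-1) ^ par n j * (-1) ^ (?p * (P + 1)) * (-1) ^ (?p * P)) (spscale (Fk n a i l) (barX n (Fmat n j l))) =
       spscale ((-1) ^ ?p * Fk n a i l) (Ebar n j l)" for l
    proof -
      have "((-1) ^ par n j * (-1) ^ (?p * (P + 1)) * (-1) ^ (?p * P) * (-1) ^ par n j :: complex) = (-1) ^ ?p"
        by (auto simp: power_add minus_one_power_iff)
      then have "1/2 * (-1) ^ par n j * (-1) ^ (?p * (P + 1)) * (-1) ^ (?p * P) * (Fk n a i l * (2 * (-1) ^ par n j)) = (-1) ^ ?p * Fk n a i l"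
        by (simp add: mult_ac)
      then show ?thesis by (simp only: barX_Fmat sp.scale_scale)
    qed
    have "brk n a (Ebar n j i) 0 =
      (\<Sum>k\<in>Iset n. spscale (1/2 * (-1) ^ par n j * (-1) ^ (?p * (P + 1))) (spscale (Fk n a k j) (barX n (Fmat n k i))))
      - (\<Sum>l\<in>Iset n. spscale (1/2 * (-1) ^ par n j * (-1) ^ (?p * (P + 1)) * (-1) ^ (?p * P)) (spscale (Fk n a i l) (barX n (Fmat n j l))))"
      unfolding E 2 3 by (simp only: sp.scale_right_diff_distrib sp.scale_sum_right sp.scale_scale mult_ac)
    also have "\<dots> = (\<Sum>k\<in>Iset n. spscale ((-1) ^ (?p * P) * Fk n a k j) (Ebar n k i))
       - (\<Sum>l\<in>Iset n. spscale ((-1) ^ ?p * Fk n a i l) (Ebar n j l))"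
      using 4 5 by simp
    finally show ?thesis by (simp only: P_def)
  qed
qed


section \<open>The differential ideal\<close>

lemma Jset_gval: "x \<in> Jset n \<Longrightarrow> gval n (BV n) x"
  by (induction rule: Jset.induct) (auto simp: valid_iff_gval)

lemma Jset_fs [simp]: "x \<in> Jset n \<Longrightarrow> fs x"
  using Jset_gval gval_fs by blast

lemma Jset_zero [simp, intro]: "0 \<in> Jset n"
  using Jset.zero[of n] by simp

lemma Jset_add [intro]: "x \<in> Jset n \<Longrightarrow> y \<in> Jset n \<Longrightarrow> x + y \<in> Jset n"
  using Jset.add[of x n y] by simp

lemma Jset_mul: "x \<in> Jset n \<Longrightarrow> gval n (BV n) y \<Longrightarrow> spmul n y x \<in> Jset n"
  by (auto simp: valid_iff_gval intro: Jset.mul)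

lemma Jset_scale [intro]: "x \<in> Jset n \<Longrightarrow> spscale c x \<in> Jset n"
  using Jset_mul[of x n "spconst c"] by (simp add: spmul_spconst)

lemma Jset_uminus [simp, intro]: "x \<in> Jset n \<Longrightarrow> - x \<in> Jset n"
  using Jset_scale[of x n "-1"] by simp

lemma Jset_scale_iff: "c \<noteq> 0 \<Longrightarrow> spscale c x \<in> Jset n \<longleftrightarrow> x \<in> Jset n"
  using Jset_scale[of "spscale c x" n "inverse c"] Jset_scale[of x n c] by auto

lemma Jset_diff [intro]: "x \<in> Jset n \<Longrightarrow> y \<in> Jset n \<Longrightarrow> x - y \<in> Jset n"
  using Jset_add[of x n "- y"] by simp

lemma Jset_sum [intro]: "(\<And>i. i \<in> A \<Longrightarrow> f i \<in> Jset n) \<Longrightarrow> sum f A \<in> Jset n"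
  by (induction A rule: infinite_finite_induct) auto

lemma Jset_lv: "x \<in> Jset n \<Longrightarrow> v \<in> BV n \<Longrightarrow> lv n v x \<in> Jset n"
  using Jset_mul[of x n "spvar v"] by (auto simp: spmul_spvar)

lemma Jset_Dsp [intro]: "x \<in> Jset n \<Longrightarrow> Dsp n x \<in> Jset n"
  by (rule Jset.der)

text \<open>\<open>Jset\<close> is closed under left multiplication by definition. A homogeneous
  linear \<open>x\<close> passes each variable of \<open>u\<close> up to sign, which turns right
  multiplication into left multiplication.\<close>

lemma Jset_linhom_mult:
  assumes "x \<in> Jset n" "linhom n q x" "gval n (BV n) u"
  shows "spmul n x u \<in> Jset n"
  using assms(3)
proof (induction rule: gval_induct)
  case one
  then show ?case using assms by (simp add: linhom_spmul_one)
next
  case (lv v f)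
  then show ?case using linhom_lv_commute[OF assms(2), of f v] by (auto intro: Jset_lv)
next
  case (add f g)
  then show ?case using assms by (auto simp: spmul_add_right)
next
  case (scale c f)
  then show ?case by (auto simp: spmul_scale_right)
qed

abbreviation Jgen :: "nat \<Rightarrow> mat \<Rightarrow> sp" where
  "Jgen n X \<equiv> barX n X + spconst (- bilin n (fmat n) X)"

lemma Jgen_Fmat:
  assumes "(i, j) \<in> posi n" shows "Jgen n (Fmat n i j) \<in> Jset n"
proof -
  have "Fmat n i j \<in> nset n" unfolding nset_def mem_Collect_eq
  proof (intro exI ext)
    fix a b
    show "Fmat n i j a b = (\<Sum>(k, l)\<in>{(i,j)\<in>Iset n \<times> Iset n. ibar n i < ibar n j}.
       (if (k, l) = (i, j) then 1 else 0) * Fmat n k l a b)"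
      using assms unfolding posi_def[symmetric]
      by (subst sum.remove[of _ "(i, j)"]) (auto intro!: sum.neutral split: if_splits)
  qed
  then show ?thesis using Jset.gen by fastforce
qed

lemma linhom_Jgen_Fmat:
  assumes "1 \<le> n" shows "linhom n (par n i + par n j + 1) (Jgen n (Fmat n i j))"
proof (cases "bilin n (fmat n) (Fmat n i j) = 0")
  case True
  then have "spconst (- bilin n (fmat n) (Fmat n i j)) = 0" by (simp add: spconst_eq_mon)
  then show ?thesis using linhom_barX[OF mhom_Fmat] by simp
next
  case False
  then have "even (1 + (par n i + par n j))"
    using osp_fmat[OF assms] by (intro bilin_hom[OF _ mhom_Fmat]) (auto simp: osp_def)
  then show ?thesis by (intro linhom.add linhom_barX mhom_Fmat linhom.const) simp
qed

text \<open>The ideal is graded: f is an odd matrix and the form is even, so the generator of each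
  \<open>Fmat n i j\<close> is homogeneous, and these span all generators.\<close>

lemma Jset_sigma:
  assumes "1 \<le> n" shows "x \<in> Jset n \<Longrightarrow> sigma n x \<in> Jset n"
proof (induction rule: Jset.induct)
  case (gen X)
  then obtain c where X: "X = (\<lambda>a b. \<Sum>k\<in>posi n. c k * Fmat n (fst k) (snd k) a b)"
    unfolding nset_def posi_def[symmetric] by (auto simp: split_def)
  have c: "spconst (- (\<Sum>k\<in>posi n. c k * bilin n (fmat n) (Fmat n (fst k) (snd k)))) =
     (\<Sum>k\<in>posi n. spscale (c k) (spconst (- bilin n (fmat n) (Fmat n (fst k) (snd k)))))"
    by (simp add: spconst_eq_mon sum_negf flip: sp.scale_sum_left)
  have "Jgen n X = (\<Sum>k\<in>posi n. spscale (c k) (Jgen n (Fmat n (fst k) (snd k))))"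
    unfolding X by (simp add: barX_lincomb bilin_lincomb c sum.distrib sp.scale_right_distrib)
  then have "sigma n (Jgen n X) = (\<Sum>k\<in>posi n. spscale (c k) (sigma n (Jgen n (Fmat n (fst k) (snd k)))))"
    by (simp add: sigma_sum sigma_scale)
  also have "\<dots> = (\<Sum>k\<in>posi n. spscale (c k) (spscale ((-1) ^ (par n (fst k) + par n (snd k) + 1)) (Jgen n (Fmat n (fst k) (snd k)))))"
    by (simp only: sigma_linhom[OF linhom_Jgen_Fmat[OF assms]])
  also have "\<dots> \<in> Jset n" by (intro Jset_sum Jset_scale Jgen_Fmat) auto
  finally show ?case by simp
next
  case (add x y)
  then show ?case by (auto simp: sigma_add)
next
  case (mul x y)
  then show ?case by (auto simp: sigma_spmul valid_iff_gval intro!: Jset_mul)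
next
  case (der x)
  then show ?case using Dsp_sigma[OF Jset_gval, of x n] by (metis Jset_Dsp Jset_uminus minus_minus)
qed simp

section \<open>The nilpotent element\<close>

text \<open>The last two terms are the \<theta>-images of F_(2n+1,2n-1) and of the subdiagonal
  elements. Together the subdiagonal is filled except at (2n+1, 2n), and there are two further
  entries at distance two.\<close>

lemma fmat_entry:
  assumes "1 \<le> n" "x \<in> Iset n" "y \<in> Iset n"
  shows "fmat n x y = (if x = y + 1 \<and> y \<le> 2*n-1 then 1 else 0) + (if x = 2*n+1 \<and> y = 2*n-1 then 1 else 0)
    + (if x = 2*n+2 \<and> y = 2*n then -1 else 0)
    + (if x = y + 1 \<and> y \<ge> 2*n+1 then thsign n (4*n+1-y) (4*n-y) else 0)"
proof -
  have pc: "z = pr n k \<longleftrightarrow> k = pr n z" if "z \<in> Iset n" "k \<in> Iset n" for z k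
    using that by (metis pr_pr)
  have 1: "Fmat n (2*n+1) (2*n-1) x y = (if x = 2*n+1 \<and> y = 2*n-1 then 1 else 0) + (if x = 2*n+2 \<and> y = 2*n then -1 else 0)"
  proof -
    have "pr n (2*n-1) = 2*n+2" "pr n (2*n+1) = 2*n" using assms(1) by (auto simp: pr_def)
    moreover have "thsign n (2*n+1) (2*n-1) = -1"
      using assms(1) by (auto simp: thsign_def par_def dlt_def)
    ultimately show ?thesis by (simp add: Fmat_def)
  qed
  have 2: "(\<Sum>i\<in>{1..2*n-1}. Fmat n (i+1) i x y) = (if x = y + 1 \<and> y \<le> 2*n-1 then 1 else 0) +
     (if x = y + 1 \<and> y \<ge> 2*n+1 then thsign n (4*n+1-y) (4*n-y) else 0)"
  proof -
    have "(\<Sum>i\<in>{1..2*n-1}. Fmat n (i+1) i x y) = (\<Sum>i\<in>{1..2*n-1}. (if i = y then (if x = y + 1 then 1 else 0) else 0)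
       + (if i = 4*n-y then (if x = y + 1 then thsign n (4*n+1-y) (4*n-y) else 0) else 0))"
    proof (rule sum.cong[OF refl])
      fix i assume i: "i \<in> {1..2*n-1}"
      have "x = pr n i \<and> y = pr n (i+1) \<longleftrightarrow> i = 4*n-y \<and> x = y + 1"
        using i assms by (auto simp: pr_def Iset_def)
      moreover have "x = i + 1 \<and> y = i \<longleftrightarrow> i = y \<and> x = y + 1" by auto
      moreover have "Suc (4*n - y) = 4*n+1-y" if "i = 4*n-y" using i that by auto
      ultimately show "Fmat n (i+1) i x y = (if i = y then (if x = y + 1 then 1 else 0) else 0)
         + (if i = 4*n-y then (if x = y + 1 then thsign n (4*n+1-y) (4*n-y) else 0) else 0)"
        by (simp only: Fmat_def) auto
    qed
    also have "\<dots> = (if y \<in> {1..2*n-1} then (if x = y + 1 then 1 else 0) else 0)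
        + (if 4*n-y \<in> {1..2*n-1} then (if x = y + 1 then thsign n (4*n+1-y) (4*n-y) else 0) else 0)"
      by (simp only: sum.distrib) simp
    also have "(y \<in> {1..2*n-1}) = (y \<le> 2*n-1)" using assms by (auto simp: Iset_def)
    also have "(if 4*n-y \<in> {1..2*n-1} then (if x = y + 1 then thsign n (4*n+1-y) (4*n-y) else 0) else 0) =
      (if x = y + 1 \<and> y \<ge> 2*n+1 then thsign n (4*n+1-y) (4*n-y) else 0)"
      using assms by (auto simp: Iset_def)
    finally show ?thesis by simp
  qed
  show ?thesis unfolding fmat_def 1 2 by simp
qed

lemma fmat_ibar:
  assumes "1 \<le> n" "x \<in> Iset n" "y \<in> Iset n" "fmat n x y \<noteq> 0" shows "ibar n x = ibar n y + 1"
  using assms(4) unfolding fmat_entry[OF assms(1-3)]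
  using assms(1-3) by (auto simp: ibar_def Iset_def split: if_splits)

lemma fmat_odd: "1 \<le> n \<Longrightarrow> x \<in> Iset n \<Longrightarrow> y \<in> Iset n \<Longrightarrow> fmat n x y \<noteq> 0 \<Longrightarrow> odd (par n x + par n y)"
  using osp_fmat[of n] unfolding osp_def mhom_def odd_iff_mod_2_eq_one by force

text \<open>By \<open>bilin_osp_Fmat\<close> this is a multiple of the ideal generator of F_ji; the
  signs agree because f is odd.\<close>

lemma Ebar_cong_fmat:
  assumes n: "1 \<le> n" and ij: "i \<in> Iset n" "j \<in> Iset n" "j < i"
  shows "Ebar n j i + spconst (fmat n i j) \<in> Jset n"
    "linhom n (par n i + par n j + 1) (Ebar n j i + spconst (fmat n i j))"
proof -
  have b: "bilin n (fmat n) (Fmat n j i) = 2 * (-1) ^ par n i * fmat n i j"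
    by (rule bilin_osp_Fmat[OF osp_fmat[OF n] ij(1,2)])
  have E: "Ebar n j i + spconst (fmat n i j) = spscale (1/2 * (-1) ^ par n j) (Jgen n (Fmat n j i))"
  proof (cases "fmat n i j = 0")
    case False
    then have "odd (par n i + par n j)" using fmat_odd n ij by blast
    then show ?thesis unfolding b
      by (simp add: Ebar_def sp.scale_right_distrib sp.scale_right_diff_distrib spconst_eq_mon minus_one_power_iff)
  qed (simp add: Ebar_def b spconst_eq_mon)
  show "linhom n (par n i + par n j + 1) (Ebar n j i + spconst (fmat n i j))"
    unfolding E by (intro linhom_scale linhom_cong[OF linhom_Jgen_Fmat[OF n]]) (simp add: add_ac)
  show "Ebar n j i + spconst (fmat n i j) \<in> Jset n"
  proof (cases "ibar n j < ibar n i")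
    case True
    then show ?thesis unfolding E using ij by (intro Jset_scale Jgen_Fmat) (auto simp: posi_def)
  next
    case False
    \<comment> \<open>The only position below the diagonal where F_ji is not of positive degree;
      there F_ji itself vanishes.\<close>
    then have "j = 2*n" "i = 2*n+1" using ij by (auto simp: ibar_def split: if_splits)
    then have "Fmat n j i = (\<lambda>a b. 0)"
      using n by (auto simp: Fmat_def pr_def thsign_def par_def dlt_def fun_eq_iff)
    then have "Jgen n (Fmat n j i) = 0"
      by (simp add: barX_eq coord_def bilin_def str_def mmul_def spconst_eq_mon cong: if_cong)
    then show ?thesis unfolding E by simp
  qed
qed

lemma Fk_pos_entry:
  assumes "a \<in> basis n" "ibar n (fst a) < ibar n (snd a)" "x \<in> Iset n" "y \<in> Iset n" "Fk n a x y \<noteq> 0"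
  shows "ibar n x < ibar n y"
  using Fmat_posi[of "fst a" "snd a" n x y] assms by (auto simp: Fk_def posi_def basis_def)

text \<open>\<open>brkX\<close> is linear in X, and an element of n has nonzero coordinates only at
  basis elements of positive degree.\<close>

lemma Wset_I:
  assumes "w \<in> Vp n"
    and "\<And>a k. a \<in> basis n \<Longrightarrow> ibar n (fst a) < ibar n (snd a) \<Longrightarrow> brk n a w k \<in> Jset n"
  shows "w \<in> Wset n"
proof -
  have "brkX n X w k \<in> Jset n" if XN: "X \<in> nset n" for X k
  proof -
    have "brkX n X w k = (\<Sum>a\<in>basis n. spscale (coord n a X) (brk n a w k))"
      by (rule ext) (simp add: brkX_def sum_fun_apply spscale_apply)
    also have "\<dots> \<in> Jset n"
    proof (rule Jset_sum)
      fix a assume a: "a \<in> basis n"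
      show "spscale (coord n a X) (brk n a w k) \<in> Jset n"
      proof (cases "X (fst a) (snd a) = 0")
        case True
        then show ?thesis by (simp add: coord_def)
      next
        case False
        obtain c where X: "X = (\<lambda>a b. \<Sum>(i,j)\<in>posi n. c i j * Fmat n i j a b)"
          using XN unfolding nset_def posi_def[symmetric] by blast
        have "(\<Sum>(i,j)\<in>posi n. c i j * Fmat n i j (fst a) (snd a)) \<noteq> 0" using False X by simp
        then obtain e where "e \<in> posi n" "(case e of (i, j) \<Rightarrow> c i j * Fmat n i j (fst a) (snd a)) \<noteq> 0"
          by (rule sum.not_neutral_contains_not_neutral)
        then have "ibar n (fst a) < ibar n (snd a)"
          using a Fmat_posi[of "fst e" "snd e" n "fst a" "snd a"] by (auto simp: basis_def split_def)
        then show ?thesis by (intro Jset_scale assms(2) a)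
      qed
    qed
    finally show ?thesis .
  qed
  then show ?thesis using assms(1) by (simp add: Wset_def)
qed

section \<open>Pseudodifferential series and the inverse of D\<close>

lemma pdadd_eq [simp]: "pdadd A B = A + B"
  by (rule ext) (simp add: pdadd_def plus_fun_apply)

lemma pdzero_eq [simp]: "pdzero = 0"
  by (rule ext) (simp add: pdzero_def zero_fun_apply)

interpretation pd: vector_space pdscale
  by unfold_locales
    (auto simp: pdscale_def fun_eq_iff plus_fun_apply sp.scale_right_distrib sp.scale_left_distrib)

lemma pdscale_apply: "pdscale c S k = spscale c (S k)"
  by (simp add: pdscale_def)

lemma pd_zero_apply: "(0 :: pd) k = 0" and pd_add_apply: "(S + S' :: pd) k = S k + S' k"
  and pd_uminus_apply: "(- S :: pd) k = - S k" and pd_diff_apply: "(S - S' :: pd) k = S k - S' k"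
  by (rule zero_fun_apply plus_fun_apply uminus_apply minus_apply)+

text \<open>The bound from above makes the sum in \<open>pdDinv\<close> finite and D
  injective.\<close>

definition inP :: "nat \<Rightarrow> pd \<Rightarrow> bool" where
  "inP n S \<longleftrightarrow> (\<forall>k. gval n (PV n) (S k)) \<and> (\<exists>N. \<forall>k>N. S k = 0)"

lemma inP_gval: "inP n S \<Longrightarrow> gval n (PV n) (S k)"
  by (simp add: inP_def)

lemma inP_gval_BV: "inP n S \<Longrightarrow> gval n (BV n) (S k)"
  using inP_gval gval_mono PV_subset_BV by blast

lemma inP_fs [simp]: "inP n S \<Longrightarrow> fs (S k)"
  using inP_gval gval_fs by blast

lemma inP_zero [simp, intro]: "inP n 0"
  by (simp add: inP_def pd_zero_apply)

lemma inP_add [simp, intro]: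
  assumes "inP n S" "inP n S'" shows "inP n (S + S')"
proof -
  obtain N N' where "\<forall>k>N. S k = 0" "\<forall>k>N'. S' k = 0" using assms by (auto simp: inP_def)
  then have "\<forall>k>max N N'. (S + S') k = 0" by (simp add: pd_add_apply)
  moreover have "gval n (PV n) ((S + S') k)" for k using assms by (simp add: inP_def pd_add_apply)
  ultimately show ?thesis unfolding inP_def by blast
qed

lemma inP_scale [simp, intro]: "inP n S \<Longrightarrow> inP n (pdscale c S)"
  by (force simp: inP_def pdscale_apply)

lemma inP_uminus [simp, intro]: "inP n S \<Longrightarrow> inP n (- S)"
  using inP_scale[of n S "-1"] by simp

lemma inP_diff [simp, intro]: "inP n S \<Longrightarrow> inP n S' \<Longrightarrow> inP n (S - S')"
  using inP_add[of n S "- S'"] by simp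

lemma inP_sum [intro]: "(\<And>i. i \<in> A \<Longrightarrow> inP n (f i)) \<Longrightarrow> inP n (sum f A)"
  by (induction A rule: infinite_finite_induct) auto

lemma pdD_apply: "pdD n S k = Dsp n (S k) + sigma n (S (k - 1))"
  by (simp add: pdD_def)

lemma inP_pdD [simp, intro]:
  assumes "inP n S" shows "inP n (pdD n S)"
proof -
  obtain N where "\<forall>k>N. S k = 0" using assms by (auto simp: inP_def)
  then have "\<forall>k>N+1. pdD n S k = 0" by (simp add: pdD_apply)
  then show ?thesis using assms by (auto simp: inP_def pdD_apply)
qed

lemma pdD_add: "inP n S \<Longrightarrow> inP n S' \<Longrightarrow> pdD n (S + S') = pdD n S + pdD n S'"
  by (rule ext) (simp add: pdD_apply pd_add_apply Dsp_add sigma_add)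

lemma pdD_scale: "pdD n (pdscale c S) = pdscale c (pdD n S)"
  by (rule ext) (simp add: pdD_apply pdscale_apply Dsp_scale sigma_scale sp.scale_right_distrib)

lemma pdD_zero [simp]: "pdD n 0 = 0"
  by (rule ext) (simp add: pdD_apply pd_zero_apply)

lemma pdD_uminus: "pdD n (- S) = - pdD n S"
  using pdD_scale[of n "-1" S] by simp

text \<open>The coefficient of D^(k+1) in D S is \<open>sigma n (S k)\<close> plus the derivative of
  \<open>S (k + 1)\<close>, so vanishing propagates downwards from the bound.\<close>

lemma pdD_injective:
  assumes "inP n S" "pdD n S = 0" shows "S = 0"
proof -
  obtain N where N: "\<forall>k>N. S k = 0" using assms by (auto simp: inP_def)
  have *: "S (N - int m) = 0" for m
  proof (induction m rule: less_induct)
    case (less m)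
    have "S (N - int m + 1) = 0"
    proof (cases m)
      case (Suc j)
      then show ?thesis using less[of j] by (simp add: algebra_simps)
    qed (use N in simp)
    moreover have "pdD n S (N - int m + 1) = 0" using assms(2) by (simp add: pd_zero_apply)
    ultimately show ?case by (simp add: pdD_apply)
  qed
  have "S k = 0" for k
  proof (cases "k > N")
    case False
    then show ?thesis using *[of "nat (N - k)"] by simp
  qed (use N in simp)
  then show ?thesis by (auto simp: fun_eq_iff zero_fun_apply)
qed

text \<open>The coefficient of D^(-1-r) in D^(-1) x.\<close>

definition tau :: "nat \<Rightarrow> nat \<Rightarrow> sp \<Rightarrow> sp" where
  "tau n r x = (if even r then spscale ((-1) ^ (r div 2)) (sigma n ((Dsp n ^^ r) x))
     else spscale ((-1) ^ ((r - 1) div 2)) ((Dsp n ^^ r) x))"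

lemma gval_funpow_Dsp: "gval n (PV n) x \<Longrightarrow> gval n (PV n) ((Dsp n ^^ r) x)"
  by (induction r) auto

lemma gval_tau: "gval n (PV n) x \<Longrightarrow> gval n (PV n) (tau n r x)"
  by (simp add: tau_def gval_funpow_Dsp)

lemma funpow_Dsp_zero: "(Dsp n ^^ r) 0 = 0"
  by (induction r) auto

lemma funpow_Dsp_add: "gval n (PV n) x \<Longrightarrow> gval n (PV n) y \<Longrightarrow>
   (Dsp n ^^ r) (x + y) = (Dsp n ^^ r) x + (Dsp n ^^ r) y"
  by (induction r) (auto simp: Dsp_add gval_fs[OF gval_funpow_Dsp])

lemma funpow_Dsp_scale: "(Dsp n ^^ r) (spscale c x) = spscale c ((Dsp n ^^ r) x)"
  by (induction r) (auto simp: Dsp_scale)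

lemma tau_zero [simp]: "tau n r 0 = 0"
  by (simp add: tau_def funpow_Dsp_zero)

lemma tau_add: "gval n (PV n) x \<Longrightarrow> gval n (PV n) y \<Longrightarrow> tau n r (x + y) = tau n r x + tau n r y"
  by (simp add: tau_def funpow_Dsp_add sigma_add sp.scale_right_distrib)

lemma tau_scale: "tau n r (spscale c x) = spscale c (tau n r x)"
  by (simp add: tau_def funpow_Dsp_scale sigma_scale mult.commute)

lemma pdDinv_eq:
  assumes "\<forall>k>N. S k = 0"
  shows "pdDinv n S k = (\<Sum>j\<in>{k<..N}. tau n (nat (j - k - 1)) (S j))"
proof
  fix M
  have "pdDinv n S k M = (\<Sum>j\<in>{j. k < j \<and> S j \<noteq> 0}. tau n (nat (j - k - 1)) (S j) M)"
    unfolding pdDinv_def spzero_eq by (rule sum.cong) (auto simp: tau_def Let_def spscale_apply)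
  also have "\<dots> = (\<Sum>j\<in>{k<..N}. tau n (nat (j - k - 1)) (S j) M)"
    by (rule sum.mono_neutral_left) (use assms in \<open>auto simp: zero_fun_apply not_le[symmetric]\<close>)
  finally show "pdDinv n S k M = (\<Sum>j\<in>{k<..N}. tau n (nat (j - k - 1)) (S j)) M"
    by (simp add: sum_fun_apply)
qed

lemma inP_pdDinv [simp, intro]:
  assumes "inP n S" shows "inP n (pdDinv n S)"
proof -
  obtain N where N: "\<forall>k>N. S k = 0" using assms by (auto simp: inP_def)
  have "gval n (PV n) (pdDinv n S k)" for k
    unfolding pdDinv_eq[OF N] by (intro gval_sum gval_tau inP_gval assms)
  moreover have "\<forall>k>N. pdDinv n S k = 0" by (simp add: pdDinv_eq[OF N])
  ultimately show ?thesis by (auto simp: inP_def)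
qed

lemma pdDinv_add:
  assumes "inP n S" "inP n S'" shows "pdDinv n (S + S') = pdDinv n S + pdDinv n S'"
proof
  fix k
  obtain N N' where N: "\<forall>k>N. S k = 0" "\<forall>k>N'. S' k = 0" using assms by (auto simp: inP_def)
  let ?N = "max N N'"
  have *: "\<forall>k>?N. S k = 0" "\<forall>k>?N. S' k = 0" "\<forall>k>?N. (S + S') k = 0" using N by (auto simp: pd_add_apply)
  show "pdDinv n (S + S') k = (pdDinv n S + pdDinv n S') k"
    unfolding pd_add_apply[of "pdDinv n S"] pdDinv_eq[OF *(1)] pdDinv_eq[OF *(2)] pdDinv_eq[OF *(3)]
    by (simp add: pd_add_apply tau_add inP_gval assms sum.distrib)
qed

lemma pdDinv_scale:
  assumes "inP n S" shows "pdDinv n (pdscale c S) = pdscale c (pdDinv n S)"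
proof
  fix k
  obtain N where N: "\<forall>k>N. S k = 0" using assms by (auto simp: inP_def)
  then have N': "\<forall>k>N. pdscale c S k = 0" by (simp add: pdscale_apply)
  show "pdDinv n (pdscale c S) k = pdscale c (pdDinv n S) k"
    unfolding pdscale_apply[of c "pdDinv n S"] pdDinv_eq[OF N] pdDinv_eq[OF N']
    by (simp add: pdscale_apply tau_scale sp.scale_sum_right)
qed

lemma pdDinv_zero [simp]: "pdDinv n 0 = 0"
  using pdDinv_scale[of n 0 0] by simp

lemma Dsp_sum: "finite A \<Longrightarrow> (\<And>i. i \<in> A \<Longrightarrow> fs (f i)) \<Longrightarrow> Dsp n (sum f A) = (\<Sum>i\<in>A. Dsp n (f i))"
  unfolding Dsp_eq_derX by (rule derX_sum)

text \<open>These are the two contributions to the coefficient of D^(-1-r) in D D^(-1) x; their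
  cancellation leaves only the leading term.\<close>

lemma Dsp_tau: "gval n (PV n) x \<Longrightarrow> Dsp n (tau n r x) + sigma n (tau n (Suc r) x) = 0"
  by (auto simp: tau_def Dsp_scale sigma_scale Dsp_sigma[OF gval_funpow_Dsp] elim!: evenE oddE)

lemma pdD_pdDinv:
  assumes "inP n S" shows "pdD n (pdDinv n S) = S"
proof
  fix k
  obtain N where N: "\<forall>k>N. S k = 0" using assms by (auto simp: inP_def)
  define N' where "N' = max N k"
  have N': "\<forall>j>N'. S j = 0" "k \<le> N'" using N by (auto simp: N'_def)
  have g: "gval n (PV n) (S j)" for j by (rule inP_gval[OF assms])
  have fsT: "fs (tau n r (S j))" for r j using gval_tau[OF g] gval_fs by blast
  have "pdD n (pdDinv n S) k = (\<Sum>j\<in>{k<..N'}. Dsp n (tau n (nat (j - k - 1)) (S j)))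
      + (\<Sum>j\<in>{k-1<..N'}. sigma n (tau n (nat (j - k)) (S j)))"
    unfolding pdD_apply pdDinv_eq[OF N'(1)] by (simp add: Dsp_sum fsT sigma_sum)
  also have "{k-1<..N'} = insert k {k<..N'}" using N' by auto
  also have "(\<Sum>j\<in>{k<..N'}. Dsp n (tau n (nat (j - k - 1)) (S j))) + (\<Sum>j\<in>insert k {k<..N'}. sigma n (tau n (nat (j - k)) (S j)))
    = (\<Sum>j\<in>{k<..N'}. Dsp n (tau n (nat (j - k - 1)) (S j)) + sigma n (tau n (nat (j - k)) (S j))) + sigma n (tau n 0 (S k))"
    by (simp add: sum.distrib)
  also have "(\<Sum>j\<in>{k<..N'}. Dsp n (tau n (nat (j - k - 1)) (S j)) + sigma n (tau n (nat (j - k)) (S j))) = 0"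
  proof (rule sum.neutral, rule ballI)
    fix j assume "j \<in> {k<..N'}"
    then have "nat (j - k) = Suc (nat (j - k - 1))" by auto
    then show "Dsp n (tau n (nat (j - k - 1)) (S j)) + sigma n (tau n (nat (j - k)) (S j)) = 0"
      using Dsp_tau[OF g] by metis
  qed
  finally show "pdD n (pdDinv n S) k = S k" by (simp add: tau_def)
qed

text \<open>A right inverse of an injective map is a left inverse.\<close>

lemma pdDinv_pdD:
  assumes "inP n S" shows "pdDinv n (pdD n S) = S"
proof -
  have "pdD n (pdDinv n (pdD n S) + - S) = pdD n (pdDinv n (pdD n S)) + pdD n (- S)"
    by (rule pdD_add) (use assms in auto)
  also have "\<dots> = 0" using assms by (simp add: pdD_pdDinv pdD_uminus)
  finally have "pdD n (pdDinv n (pdD n S) + - S) = 0" .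
  moreover have "inP n (pdDinv n (pdD n S) + - S)" using assms by (intro inP_add inP_uminus inP_pdDinv inP_pdD)
  ultimately have "pdDinv n (pdD n S) + - S = 0" using pdD_injective by metis
  then show ?thesis by simp
qed

section \<open>Row determinants of Hessenberg matrices\<close>

definition linP :: "nat \<Rightarrow> (pd \<Rightarrow> pd) \<Rightarrow> bool" where
  "linP n f \<longleftrightarrow> (\<forall>S. inP n S \<longrightarrow> inP n (f S)) \<and>
     (\<forall>S S'. inP n S \<longrightarrow> inP n S' \<longrightarrow> f (S + S') = f S + f S') \<and>
     (\<forall>c S. inP n S \<longrightarrow> f (pdscale c S) = pdscale c (f S))"

lemma linPD:
  assumes "linP n f"
  shows "inP n S \<Longrightarrow> inP n (f S)" "inP n S \<Longrightarrow> inP n S' \<Longrightarrow> f (S + S') = f S + f S'"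
    "inP n S \<Longrightarrow> f (pdscale c S) = pdscale c (f S)"
  using assms unfolding linP_def by blast+

lemma linP_zero: "linP n f \<Longrightarrow> f 0 = 0"
  using linPD(3)[of n f 0 0] by simp

lemma linP_diff: "linP n f \<Longrightarrow> inP n S \<Longrightarrow> inP n S' \<Longrightarrow> f (S - S') = f S - f S'"
  using linPD(2)[of n f S "- S'"] linPD(3)[of n f S' "-1"] by simp

lemma linP_comp: "linP n f \<Longrightarrow> linP n h \<Longrightarrow> linP n (\<lambda>S. f (h S))"
  unfolding linP_def by simp

lemma linP_foldr:
  "(\<And>i. i \<in> set xs \<Longrightarrow> linP n (f i)) \<Longrightarrow> linP n (foldr f xs)"
proof (induction xs)
  case Nil
  show ?case by (simp add: linP_def)
next
  case (Cons x xs)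
  then have "linP n (foldr f xs)" "linP n (f x)" by simp_all
  then have "linP n (\<lambda>S. f x (foldr f xs S))" by (rule linP_comp[rotated])
  then show ?case by (simp add: comp_def)
qed

text \<open>The relabelling \<open>g\<close> allows the middle index of \<open>Abig\<close> to be
  skipped. The subdiagonal has to act by scalars \<kappa>, so that it commutes with all
  operators.\<close>

definition hessenberg :: "nat \<Rightarrow> nat \<Rightarrow> (nat \<Rightarrow> nat) \<Rightarrow> (nat \<Rightarrow> complex) \<Rightarrow> (nat \<Rightarrow> nat \<Rightarrow> pd \<Rightarrow> pd) \<Rightarrow> bool" where
  "hessenberg n N g \<kappa> A \<longleftrightarrow> (\<forall>i\<in>{1..N}. \<forall>j\<in>{1..N}. linP n (A (g i) (g j)) \<and>
     (j + 1 < i \<longrightarrow> (\<forall>S. inP n S \<longrightarrow> A (g i) (g j) S = 0)) \<and>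
     (i = j + 1 \<longrightarrow> (\<forall>S. inP n S \<longrightarrow> A (g i) (g j) S = pdscale (\<kappa> j) S)))"

lemma hessenbergD:
  assumes "hessenberg n N g \<kappa> A"
  shows "i \<in> {1..N} \<Longrightarrow> j \<in> {1..N} \<Longrightarrow> linP n (A (g i) (g j))"
    "i \<in> {1..N} \<Longrightarrow> j \<in> {1..N} \<Longrightarrow> j + 1 < i \<Longrightarrow> inP n S \<Longrightarrow> A (g i) (g j) S = 0"
    "1 \<le> j \<Longrightarrow> j < N \<Longrightarrow> inP n S \<Longrightarrow> A (g (j + 1)) (g j) S = pdscale (\<kappa> j) S"
proof -
  show "i \<in> {1..N} \<Longrightarrow> j \<in> {1..N} \<Longrightarrow> linP n (A (g i) (g j))"
    "i \<in> {1..N} \<Longrightarrow> j \<in> {1..N} \<Longrightarrow> j + 1 < i \<Longrightarrow> inP n S \<Longrightarrow> A (g i) (g j) S = 0"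
    using assms unfolding hessenberg_def by blast+
  assume "1 \<le> j" "j < N" "inP n S"
  moreover from this have "j + 1 \<in> {1..N}" "j \<in> {1..N}" by auto
  ultimately show "A (g (j + 1)) (g j) S = pdscale (\<kappa> j) S"
    using assms unfolding hessenberg_def by blast
qed

text \<open>The start value \<open>s\<close> is arbitrary because the last row acts first: peeling
  it off in an induction leaves a smaller determinant with a new start value.\<close>

definition rdet_at :: "nat set \<Rightarrow> nat list \<Rightarrow> (nat \<Rightarrow> nat \<Rightarrow> pd \<Rightarrow> pd) \<Rightarrow> pd \<Rightarrow> pd" where
  "rdet_at S xs A s = (\<Sum>\<sigma>\<in>{\<sigma>. \<sigma> permutes S}. pdscale (of_int (sign \<sigma>)) (foldr (\<lambda>i. A i (\<sigma> i)) xs s))"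

text \<open>Expanding along the last row: column \<open>N + 1\<close> of a Hessenberg matrix survives only through
  the last entry, or in place of column \<open>N\<close>.\<close>

lemma hessenberg_rdet:
  assumes "1 \<le> N" "inj_on g {1..N}" "hessenberg n N g \<kappa> A" "inP n s"
  shows "\<exists>c. (\<forall>j\<in>{1..N}. inP n (c j)) \<and> c N = pdscale (\<Prod>i\<in>{1..<N}. - \<kappa> i) s \<and>
     (\<forall>i\<in>{2..N}. (\<Sum>j\<in>{1..N}. A (g i) (g j) (c j)) = 0) \<and>
     (\<Sum>j\<in>{1..N}. A (g 1) (g j) (c j)) = rdet_at (g ` {1..N}) (map g [1..<N+1]) A s"
  using assms
proof (induction N arbitrary: A s rule: nat_induct_at_least)
  case base
  have "g ` {1..1::nat} = {g 1}" by simp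
  then have "{\<sigma>. \<sigma> permutes g ` {1..1::nat}} = {id}"
    by (simp only: permutes_sing singleton_conv)
  then show ?case using base by (intro exI[of _ "\<lambda>_. s"]) (simp add: sign_id rdet_at_def)
next
  case (Suc N)
  define b where "b = g (Suc N)"
  define S where "S = g ` {1..N}"
  define xs where "xs = map g [1..<N+1]"
  have xsS: "set xs = S" by (auto simp: xs_def S_def)
  \<comment> \<open>Belongs to the permutations that send the last row to column \<open>g N\<close>:
    column \<open>b\<close> then takes the place of column \<open>g N\<close>.\<close>
  define A' where "A' = (\<lambda>i j. if j = g N then A i b else A i j)"
  have inj: "g i = g j \<longleftrightarrow> i = j" if "i \<in> {1..Suc N}" "j \<in> {1..Suc N}" for i j
    using Suc.prems(1) that by (auto simp: inj_on_def)
  have bS: "b \<notin> S"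
  proof
    assume "b \<in> S"
    then obtain i where "i \<in> {1..N}" "g i = g (Suc N)" by (auto simp: b_def S_def)
    then show False using inj[of i "Suc N"] by simp
  qed
  have bi: "g i \<noteq> b" if "i \<in> {1..N}" for i using bS that by (auto simp: S_def)
  have lin: "linP n (A (g i) (g j))" if "i \<in> {1..Suc N}" "j \<in> {1..Suc N}" for i j
    by (rule hessenbergD(1)[OF Suc.prems(2) that])
  have linb: "linP n (A (g i) b)" if "i \<in> {1..Suc N}" for i
    using lin[OF that, of "Suc N"] by (simp add: b_def)
  have N1: "1 \<le> N" by fact
  note zero = hessenbergD(2)[OF Suc.prems(2)] and sub = hessenbergD(3)[OF Suc.prems(2)]
  have lin': "linP n (A' (g i) (g j))" if "i \<in> {1..N}" "j \<in> {1..N}" for i j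
    using that lin linb by (simp add: A'_def)
  have Abb: "A b b = A (g (Suc N)) (g (Suc N))" by (simp add: b_def)
  have linbb: "linP n (A b b)" unfolding Abb by (rule lin) auto
  note s = \<open>inP n s\<close>
  have inj': "inj_on g {1..N}" using Suc.prems(1) by (rule inj_on_subset) auto
  have "{1..N} \<subseteq> {1..Suc N}" by auto
  then have h: "hessenberg n N g \<kappa> A" using Suc.prems(2) unfolding hessenberg_def by (meson subsetD)
  have h': "hessenberg n N g \<kappa> A'" unfolding hessenberg_def
  proof (intro ballI conjI impI allI)
    fix i j assume ij: "i \<in> {1..N}" "j \<in> {1..N}"
    show "linP n (A' (g i) (g j))" by (rule lin'[OF ij])
    fix S assume S: "inP n S"
    show "A' (g i) (g j) S = 0" if "j + 1 < i"
      using that ij S zero[of i j S] inj[of j N] by (auto simp: A'_def)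
    show "A' (g i) (g j) S = pdscale (\<kappa> j) S" if "i = j + 1"
      using that ij S sub[of j S] inj[of j N] by (auto simp: A'_def)
  qed
  \<comment> \<open>Permutations fixing \<open>b\<close>: the diagonal entry of the last row is
    applied to the start value.\<close>
  from Suc.IH[OF inj' h linPD(1)[OF linbb s]]
  obtain c1 where c1: "\<And>j. j \<in> {1..N} \<Longrightarrow> inP n (c1 j)" "c1 N = pdscale (\<Prod>i\<in>{1..<N}. - \<kappa> i) (A b b s)"
     "\<And>i. i \<in> {2..N} \<Longrightarrow> (\<Sum>j\<in>{1..N}. A (g i) (g j) (c1 j)) = 0"
     "(\<Sum>j\<in>{1..N}. A (g 1) (g j) (c1 j)) = rdet_at S xs A (A b b s)"
    unfolding S_def xs_def by blast
  \<comment> \<open>Permutations sending \<open>b\<close> to \<open>g N\<close>: the subdiagonal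
    scalar enters the start value, with the sign of the transposition.\<close>
  from Suc.IH[OF inj' h' inP_scale[OF s, of "- \<kappa> N"]]
  obtain c2 where c2: "\<And>j. j \<in> {1..N} \<Longrightarrow> inP n (c2 j)" "c2 N = pdscale (\<Prod>i\<in>{1..<N}. - \<kappa> i) (pdscale (- \<kappa> N) s)"
     "\<And>i. i \<in> {2..N} \<Longrightarrow> (\<Sum>j\<in>{1..N}. A' (g i) (g j) (c2 j)) = 0"
     "(\<Sum>j\<in>{1..N}. A' (g 1) (g j) (c2 j)) = rdet_at S xs A' (pdscale (- \<kappa> N) s)"
    unfolding S_def xs_def by blast
  \<comment> \<open>The last column of \<open>A'\<close> is column N+1 of \<open>A\<close>, so the
    last entry of \<open>c2\<close> moves to position N+1.\<close>
  define c where "c = (\<lambda>j. if j < N then c1 j + c2 j else if j = N then c1 N else c2 N)"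
  have row: "(\<Sum>j\<in>{1..Suc N}. A (g i) (g j) (c j)) =
     (\<Sum>j\<in>{1..N}. A (g i) (g j) (c1 j)) + (\<Sum>j\<in>{1..N}. A' (g i) (g j) (c2 j))" if i: "i \<in> {1..N}" for i
  proof -
    have split: "{1..N} = insert N {1..<N}" "{1..Suc N} = {1..<N} \<union> {N, Suc N}" using N1 by auto
    have Y: "sum F {1..N} = sum F {1..<N} + F N" "sum F {1..Suc N} = sum F {1..<N} + (F N + F (Suc N))"
      for F :: "nat \<Rightarrow> pd" unfolding split by (simp_all add: add_ac)
    have "(\<Sum>j\<in>{1..<N}. A (g i) (g j) (c j)) = (\<Sum>j\<in>{1..<N}. A (g i) (g j) (c1 j) + A' (g i) (g j) (c2 j))"
    proof (rule sum.cong[OF refl])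
      fix j assume j: "j \<in> {1..<N}"
      then have "g j \<noteq> g N" using inj[of j N] by auto
      then show "A (g i) (g j) (c j) = A (g i) (g j) (c1 j) + A' (g i) (g j) (c2 j)"
        using j i linPD(2)[OF lin[of i j] c1(1)[of j] c2(1)[of j]] by (simp add: c_def A'_def)
    qed
    then have "(\<Sum>j\<in>{1..<N}. A (g i) (g j) (c j)) =
       (\<Sum>j\<in>{1..<N}. A (g i) (g j) (c1 j)) + (\<Sum>j\<in>{1..<N}. A' (g i) (g j) (c2 j))"
      by (simp only: sum.distrib)
    then show ?thesis unfolding Y
      by (simp only: add_ac) (simp add: c_def A'_def b_def)
  qed
  have last: "(\<Sum>j\<in>{1..Suc N}. A b (g j) (c j)) = 0"
  proof -
    have "{1..Suc N} = {1..<N} \<union> {N, Suc N}" using N1 by auto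
    then have "(\<Sum>j\<in>{1..Suc N}. A b (g j) (c j)) = (\<Sum>j\<in>{1..<N}. A b (g j) (c j)) + (A b (g N) (c1 N) + A b b (c2 N))"
      by (simp add: c_def b_def)
    also have "(\<Sum>j\<in>{1..<N}. A b (g j) (c j)) = 0"
      using c1(1) c2(1) zero[of "Suc N"] by (intro sum.neutral) (auto simp: c_def b_def)
    also have "A b (g N) (c1 N) = pdscale (\<kappa> N) (c1 N)"
      using sub[of N "c1 N"] N1 c1(1)[of N] by (simp add: b_def)
    also have "A b b (c2 N) = pdscale (\<Prod>i\<in>{1..<N}. - \<kappa> i) (pdscale (- \<kappa> N) (A b b s))"
      unfolding c2(2) using s by (simp only: linPD(3)[OF linbb] inP_scale)
    \<comment> \<open>Both terms are the product of the -\<kappa>_i for i < N times \<kappa>_N times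
      \<open>A b b s\<close>, with opposite signs.\<close>
    finally show ?thesis unfolding c1(2) by (simp add: mult.commute)
  qed
  have "(\<Sum>\<sigma>\<in>{\<sigma>. \<sigma> permutes insert b S}. pdscale (of_int (sign \<sigma>)) (foldr (\<lambda>i. A i (\<sigma> i)) (xs @ [b]) s)) =
     (\<Sum>x\<in>insert b S. \<Sum>q\<in>{q. q permutes S}. pdscale (of_int (sign (transpose b x \<circ> q)))
        (foldr (\<lambda>i. A i ((transpose b x \<circ> q) i)) xs (A b ((transpose b x \<circ> q) b) s)))"
    by (subst sum_over_permutations_insert) (use bS in \<open>simp_all add: S_def\<close>)
  also have "\<dots> = (\<Sum>x\<in>insert b S. if x = b then (\<Sum>j\<in>{1..N}. A (g 1) (g j) (c1 j))
      else if x = g N then (\<Sum>j\<in>{1..N}. A' (g 1) (g j) (c2 j)) else 0)"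
  proof (rule sum.cong[OF refl])
    fix x assume x: "x \<in> insert b S"
    have qb: "q b = b" if "q permutes S" for q using that bS by (auto simp: permutes_not_in)
    have tb: "(transpose b x \<circ> q) b = x" if "q permutes S" for q using qb[OF that] by simp
    have qin: "q (g i) \<in> S" if "q permutes S" "i \<in> {1..N}" for q i
      using permutes_in_image[OF that(1), of "g i"] that(2) by (auto simp: S_def)
    consider "x = b" | "x \<noteq> b" "x = g N" | i where "i \<in> {1..<N}" "x = g i"
    proof (cases "x = b")
      case False
      then obtain i where "i \<in> {1..N}" "x = g i" using x by (auto simp: S_def)
      then show thesis using False that(2) that(3)[of i] by (cases "i = N") auto
    qed (use that in blast)
    then show "(\<Sum>q\<in>{q. q permutes S}. pdscale (of_int (sign (transpose b x \<circ> q)))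
        (foldr (\<lambda>i. A i ((transpose b x \<circ> q) i)) xs (A b ((transpose b x \<circ> q) b) s))) =
       (if x = b then (\<Sum>j\<in>{1..N}. A (g 1) (g j) (c1 j))
      else if x = g N then (\<Sum>j\<in>{1..N}. A' (g 1) (g j) (c2 j)) else 0)"
    proof cases
      case 1
      have "foldr (\<lambda>i. A i ((transpose b x \<circ> q) i)) xs (A b ((transpose b x \<circ> q) b) s)
        = foldr (\<lambda>i. A i (q i)) xs (A b b s)" if "q permutes S" for q
        using tb[OF that] 1 by simp
      then show ?thesis using 1 c1(4) by (simp add: rdet_at_def cong: sum.cong_simp)
    next
      case 2
      have "pdscale (of_int (sign (transpose b x \<circ> q))) (foldr (\<lambda>i. A i ((transpose b x \<circ> q) i)) xs (A b ((transpose b x \<circ> q) b) s))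
        = pdscale (of_int (sign q)) (foldr (\<lambda>i. A' i (q i)) xs (pdscale (- \<kappa> N) s))" if q: "q permutes S" for q
      proof -
        have Ab: "A b x s = pdscale (\<kappa> N) s" using sub[of N s] N1 s 2 by (simp add: b_def)
        have f: "foldr (\<lambda>i. A i ((transpose b x \<circ> q) i)) xs z = foldr (\<lambda>i. A' i (q i)) xs z" for z
        proof (rule foldr_cong[OF refl refl])
          fix a y assume "y \<in> set xs"
          then obtain i where i: "i \<in> {1..N}" "y = g i" by (auto simp: xsS S_def)
          have "q y \<noteq> b" using qin[OF q i(1)] bS i(2) by auto
          then show "A y ((transpose b x \<circ> q) y) a = A' y (q y) a"
            using 2 by (auto simp: A'_def transpose_def)
        qed
        have l: "linP n (foldr (\<lambda>i. A' i (q i)) xs)"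
        proof (rule linP_foldr)
          fix y assume "y \<in> set xs"
          then obtain i where i: "i \<in> {1..N}" "y = g i" by (auto simp: xsS S_def)
          then obtain j where "j \<in> {1..N}" "q y = g j" using qin[OF q i(1)] by (auto simp: S_def)
          then show "linP n (A' y (q y))" using lin' i by simp
        qed
        have "permutation q" using q permutation_permutes by (metis S_def finite_atLeastAtMost finite_imageI)
        then have "sign (transpose b x \<circ> q) = - sign q"
          using 2 by (simp add: sign_compose sign_swap_id permutation_swap_id)
        then show ?thesis unfolding f tb[OF q] Ab linPD(3)[OF l s] by simp
      qed
      then show ?thesis using 2 c2(4) by (simp add: rdet_at_def cong: sum.cong_simp)
    next
      case 3
      have "foldr (\<lambda>i. A i ((transpose b x \<circ> q) i)) xs (A b ((transpose b x \<circ> q) b) s) = 0" if q: "q permutes S" for q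
      proof -
        have "A b x s = 0" using zero[of "Suc N" i s] 3 s by (simp add: b_def)
        moreover have "linP n (foldr (\<lambda>i. A i ((transpose b x \<circ> q) i)) xs)"
        proof (rule linP_foldr)
          fix y assume "y \<in> set xs"
          then obtain k where k: "k \<in> {1..N}" "y = g k" by (auto simp: xsS S_def)
          have "(transpose b x \<circ> q) y \<in> insert b S" using qin[OF q k(1)] x k(2) by (auto simp: transpose_def)
          moreover have "insert b S = g ` {1..Suc N}" by (simp add: S_def b_def atLeastAtMostSuc_conv)
          ultimately obtain j where "j \<in> {1..Suc N}" "(transpose b x \<circ> q) y = g j" by blast
          then show "linP n (A y ((transpose b x \<circ> q) y))" using lin[of k j] k by simp
        qed
        ultimately show ?thesis using tb[OF q] linP_zero by simp
      qed
      moreover have "x \<noteq> b" "x \<noteq> g N" using 3 bi[of i] inj[of i N] by auto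
      ultimately show ?thesis by simp
    qed
  qed
  also have "\<dots> = (\<Sum>j\<in>{1..N}. A (g 1) (g j) (c1 j)) + (\<Sum>j\<in>{1..N}. A' (g 1) (g j) (c2 j))"
  proof -
    have "g N \<in> S" "finite S" "g N \<noteq> b" using N1 bi by (auto simp: S_def)
    moreover have "(\<Sum>x\<in>S. if x = b then (\<Sum>j\<in>{1..N}. A (g 1) (g j) (c1 j))
      else if x = g N then (\<Sum>j\<in>{1..N}. A' (g 1) (g j) (c2 j)) else 0) =
      (\<Sum>x\<in>S. if x = g N then (\<Sum>j\<in>{1..N}. A' (g 1) (g j) (c2 j)) else 0)"
      using bS by (intro sum.cong) auto
    ultimately show ?thesis using bS by simp
  qed
  also have "\<dots> = (\<Sum>j\<in>{1..Suc N}. A (g 1) (g j) (c j))" using row[of 1] N1 by simp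
  finally have det: "rdet_at (g ` {1..Suc N}) (map g [1..<Suc N+1]) A s
     = (\<Sum>j\<in>{1..Suc N}. A (g 1) (g j) (c j))"
    using N1 by (simp add: rdet_at_def S_def b_def xs_def atLeastAtMostSuc_conv)
  show ?case
  proof (intro exI[of _ c] conjI ballI)
    show "inP n (c j)" if "j \<in> {1..Suc N}" for j
      using that c1(1) c2(1) N1 by (auto simp: c_def)
    show "c (Suc N) = pdscale (\<Prod>i\<in>{1..<Suc N}. - \<kappa> i) s"
      using N1 by (simp add: c_def c2(2) prod.atLeastLessThan_Suc)
    show "(\<Sum>j\<in>{1..Suc N}. A (g i) (g j) (c j)) = 0" if "i \<in> {2..Suc N}" for i
    proof (cases "i = Suc N")
      case True
      then show ?thesis using last by (simp add: b_def)
    next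
      case False
      then show ?thesis using that row[of i] c1(3)[of i] c2(3)[of i] by simp
    qed
  qed (use det in simp)
qed

section \<open>The entries as operators\<close>

definition order1 :: "pd \<Rightarrow> bool" where
  "order1 A \<longleftrightarrow> (\<forall>k. k \<noteq> 0 \<and> k \<noteq> 1 \<longrightarrow> A k = 0) \<and> (\<forall>k. fs (A k))"

lemma order1_add: "order1 A \<Longrightarrow> order1 B \<Longrightarrow> order1 (A + B)"
  and order1_scale: "order1 A \<Longrightarrow> order1 (pdscale c A)"
  and order1_zero: "order1 0"
  and order1_const: "fs x \<Longrightarrow> order1 (pdconst x)"
  and order1_D: "order1 pdDop"
  by (auto simp: order1_def pd_add_apply pdscale_apply pd_zero_apply pdconst_def pdDop_def)

lemma pdmul_order1:
  assumes "order1 A"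
  shows "pdmul n A S = (\<lambda>k. spmul n (A 0) (S k) + spmul n (A 1) (pdD n S k))"
proof (intro ext)
  fix k M
  let ?I = "{i. A i \<noteq> 0 \<and> pdDpow n i S k \<noteq> 0}"
  have "pdmul n A S k M = (\<Sum>i\<in>?I. spmul n (A i) (pdDpow n i S k) M)"
    by (simp add: pdmul_def)
  also have "\<dots> = (\<Sum>i\<in>{0,1}. spmul n (A i) (pdDpow n i S k) M)"
    by (rule sum.mono_neutral_left) (use assms in \<open>auto simp: order1_def zero_fun_apply\<close>)
  finally show "pdmul n A S k M = (spmul n (A 0) (S k) + spmul n (A 1) (pdD n S k)) M"
    by (simp add: pdDpow_def plus_fun_apply)
qed

lemma pdmul_add:
  assumes "order1 A" "order1 B" "inP n S" shows "pdmul n (A + B) S = pdmul n A S + pdmul n B S"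
proof -
  have "fs (pdD n S k)" "fs (S k)" "fs (A k)" "fs (B k)" for k
    using assms inP_fs[OF inP_pdD[OF assms(3)]] by (auto simp: order1_def)
  then show ?thesis unfolding pdmul_order1[OF assms(1)] pdmul_order1[OF assms(2)] pdmul_order1[OF order1_add[OF assms(1,2)]]
    using assms(3) by (auto simp: fun_eq_iff[where 'a=int] pd_add_apply spmul_add_left)
qed

lemma pdmul_scale: "order1 A \<Longrightarrow> pdmul n (pdscale c A) S = pdscale c (pdmul n A S)"
  by (rule ext) (simp add: pdmul_order1 order1_scale pdscale_apply spmul_scale_left sp.scale_right_distrib)

lemma order1_diff: "order1 A \<Longrightarrow> order1 B \<Longrightarrow> order1 (A - B)"
  using order1_add[of A "pdscale (-1) B"] order1_scale[of B "-1"] by simp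

lemma pdmul_diff: "order1 A \<Longrightarrow> order1 B \<Longrightarrow> inP n S \<Longrightarrow> pdmul n (A - B) S = pdmul n A S - pdmul n B S"
  using pdmul_add[of A "pdscale (-1) B" n S] order1_scale[of B "-1"] pdmul_scale[of B n "-1" S] by simp

lemma pdmul_const: "fs x \<Longrightarrow> pdmul n (pdconst x) S = (\<lambda>k. spmul n x (S k))"
  by (simp add: pdmul_order1 order1_const) (simp add: pdconst_def)

lemma pdmul_D: "inP n S \<Longrightarrow> pdmul n pdDop S = pdD n S"
proof -
  assume "inP n S"
  then have "fs (pdD n S k)" for k using inP_fs inP_pdD by blast
  then show ?thesis by (simp add: pdmul_order1[OF order1_D]) (simp add: pdDop_def spmul_spconst)
qed

lemma pdmul_zero_left [simp]: "pdmul n 0 S = 0"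
  by (auto simp: pdmul_order1 order1_zero pd_zero_apply fun_eq_iff[where 'a=int])

lemma pdmul_Dinv: "inP n S \<Longrightarrow> pdmul n pdDinvop S = pdDinv n S"
proof (intro ext)
  assume S: "inP n S"
  fix k M
  let ?I = "{i. pdDinvop i \<noteq> 0 \<and> pdDpow n i S k \<noteq> 0}"
  have "fs (pdDinv n S k)" using S inP_fs inP_pdDinv by blast
  have "pdmul n pdDinvop S k M = (\<Sum>i\<in>?I. spmul n (pdDinvop i) (pdDpow n i S k) M)"
    by (simp add: pdmul_def)
  also have "\<dots> = (\<Sum>i\<in>{-1}. spmul n (pdDinvop i) (pdDpow n i S k) M)"
  proof (rule sum.mono_neutral_left)
    show "\<forall>i\<in>{-1} - ?I. spmul n (pdDinvop i) (pdDpow n i S k) M = 0"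
    proof
      fix i :: int assume "i \<in> {-1} - ?I"
      then have "pdDinvop i = 0 \<or> pdDpow n i S k = 0" by auto
      then have "spmul n (pdDinvop i) (pdDpow n i S k) = 0" by (elim disjE) simp_all
      then show "spmul n (pdDinvop i) (pdDpow n i S k) M = 0" by (simp only: zero_fun_apply)
    qed
  qed (auto simp: pdDinvop_def split: if_splits)
  finally show "pdmul n pdDinvop S k M = pdDinv n S k M"
    using \<open>fs (pdDinv n S k)\<close> by (simp add: pdDpow_def pdDinvop_def spmul_spconst)
qed

definition lmulP :: "nat \<Rightarrow> sp \<Rightarrow> pd \<Rightarrow> pd" where
  "lmulP n x S = (\<lambda>k. spmul n x (S k))"

lemma linP_lmulP: "gval n (PV n) x \<Longrightarrow> linP n (lmulP n x)"
  unfolding linP_def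
proof (intro conjI allI impI)
  fix S S' :: pd and c assume x: "gval n (PV n) x" and S: "inP n S"
  obtain N where "\<forall>k>N. S k = 0" using S by (auto simp: inP_def)
  then have "\<forall>k>N. lmulP n x S k = 0" by (simp add: lmulP_def)
  moreover have "gval n (PV n) (lmulP n x S k)" for k
    using x inP_gval[OF S] by (simp add: lmulP_def)
  ultimately show "inP n (lmulP n x S)" unfolding inP_def by blast
  show "lmulP n x (pdscale c S) = pdscale c (lmulP n x S)"
    by (rule ext) (simp add: lmulP_def pdscale_apply spmul_scale_right)
  assume S': "inP n S'"
  show "lmulP n x (S + S') = lmulP n x S + lmulP n x S'"
    using S S' x by (intro ext[where 'a=int]) (simp add: lmulP_def pd_add_apply spmul_add_right)
qed

lemma linP_pdD: "linP n (pdD n)"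
  by (simp add: linP_def pdD_add pdD_scale)

lemma linP_pdDinv: "linP n (pdDinv n)"
  by (simp add: linP_def pdDinv_add pdDinv_scale)

lemma linP_add: "linP n f \<Longrightarrow> linP n h \<Longrightarrow> linP n (\<lambda>S. f S + h S)"
  unfolding linP_def by (simp add: algebra_simps pd.scale_right_distrib)

lemma linP_scale: "linP n f \<Longrightarrow> linP n (\<lambda>S. pdscale c (f S))"
  unfolding linP_def by (simp add: algebra_simps pd.scale_right_distrib)

lemma linP_zero_fun: "linP n (\<lambda>S. 0)"
  unfolding linP_def by simp

lemma linP_id: "linP n (\<lambda>S. S)"
  unfolding linP_def by simp

lemma linP_diff_fun: "linP n f \<Longrightarrow> linP n h \<Longrightarrow> linP n (\<lambda>S. f S - h S)"
  using linP_add[of n f "\<lambda>S. pdscale (-1) (h S)"] linP_scale[of n h "-1"] by simp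

definition Mop :: "nat \<Rightarrow> nat \<Rightarrow> nat \<Rightarrow> pd \<Rightarrow> pd" where
  "Mop n i j S = (if i \<le> j then (if i = j then pdD n S else 0) + lmulP n (Ebar n j i) S
     else pdscale (- fmat n i j) S)"

definition Nop :: "nat \<Rightarrow> nat \<Rightarrow> nat \<Rightarrow> pd \<Rightarrow> pd" where
  "Nop n i j S = Mop n i j S - (if j = 2*n then Mop n i (2*n+1) S else 0)"

definition Aop :: "nat \<Rightarrow> nat \<Rightarrow> nat \<Rightarrow> pd \<Rightarrow> pd" where
  "Aop n i j S = Nop n i j S - (if i = 2*n+1 then Nop n (2*n) j S else 0)"

lemma order1_Mmat: "order1 (Mmat n i j)"
  unfolding Mmat_def by (simp add: order1_add order1_D order1_zero order1_const gval_fs[OF gval_Ebar])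

lemma order1_Nmat: "order1 (Nmat n i j)"
  by (simp add: Nmat_def order1_Mmat order1_diff)

lemma pdmul_Mmat:
  assumes "inP n S" shows "pdmul n (Mmat n i j) S = Mop n i j S"
proof (cases "i \<le> j")
  case True
  have "order1 (if i = j then pdDop else pdzero)" by (simp add: order1_D order1_zero)
  then have "pdmul n (Mmat n i j) S = pdmul n (if i = j then pdDop else pdzero) S + pdmul n (pdconst (Ebar n j i)) S"
    using True assms by (simp add: Mmat_def pdmul_add order1_const gval_fs[OF gval_Ebar] del: pdzero_eq)
  then show ?thesis using True assms
    by (auto simp: Mop_def pdmul_D pdmul_const gval_fs[OF gval_Ebar] lmulP_def)
next
  case False
  then show ?thesis using assms by (auto simp: Mop_def Mmat_def pdmul_const spmul_spconst pdscale_def)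
qed

lemma pdmul_Nmat: "inP n S \<Longrightarrow> pdmul n (Nmat n i j) S = Nop n i j S"
  by (simp add: Nmat_def Nop_def pdmul_diff order1_Mmat pdmul_Mmat)

lemma pdmul_Atil: "inP n S \<Longrightarrow> pdmul n (Atil n i j) S = Aop n i j S"
  by (simp add: Atil_def Aop_def pdmul_diff order1_Nmat pdmul_Nmat)

lemma gval_Ebar_PV:
  assumes "i \<le> j" "i \<in> Iset n" "j \<in> Iset n" shows "gval n (PV n) (Ebar n j i)"
proof -
  have "gval n (PV n) (spscale (coord n k (Fmat n j i)) (spvar (0, k)))" if k: "k \<in> basis n" for k
  proof (cases "Fmat n j i (fst k) (snd k) = 0")
    case False
    then have "(fst k = j \<and> snd k = i) \<or> (fst k = pr n i \<and> snd k = pr n j)"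
      by (auto simp: Fmat_def split: if_splits)
    moreover have "ibar n i \<le> ibar n j" using assms by (auto simp: ibar_def)
    ultimately have "ibar n (snd k) \<le> ibar n (fst k)" using assms ibar_le[of j n] by (auto simp: ibar_pr)
    then show ?thesis using k by (intro gval_scale gval_spvar) (simp add: PV_def)
  qed (simp add: coord_def)
  then show ?thesis unfolding Ebar_def barX_eq by (intro gval_scale[OF gval_sum])
qed

lemma linP_Mop: "i \<in> Iset n \<Longrightarrow> j \<in> Iset n \<Longrightarrow> linP n (Mop n i j)"
proof -
  assume ij: "i \<in> Iset n" "j \<in> Iset n"
  consider "i = j" | "i < j" | "i > j" by linarith
  then show ?thesis
  proof cases
    case 1
    have "Mop n i j = (\<lambda>S. pdD n S + lmulP n (Ebar n j i) S)" using 1 by (auto simp: Mop_def)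
    then show ?thesis using 1 ij by (auto intro!: linP_add linP_pdD linP_lmulP gval_Ebar_PV)
  next
    case 2
    have "Mop n i j = lmulP n (Ebar n j i)" using 2 by (auto simp: Mop_def)
    then show ?thesis using 2 ij by (auto intro!: linP_lmulP gval_Ebar_PV)
  next
    case 3
    have "Mop n i j = (\<lambda>S. pdscale (- fmat n i j) S)" using 3 by (auto simp: Mop_def)
    then show ?thesis using linP_scale[OF linP_id, of n "- fmat n i j"] by (simp only:)
  qed
qed

lemma linP_if: "linP n f \<Longrightarrow> linP n (\<lambda>S. if b then f S else 0)"
  by (cases b) (simp_all add: linP_zero_fun)

lemma linP_Nop: "1 \<le> n \<Longrightarrow> i \<in> Iset n \<Longrightarrow> j \<in> Iset n \<Longrightarrow> linP n (Nop n i j)"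
  unfolding Nop_def[abs_def] by (intro linP_diff_fun linP_if linP_Mop) (auto simp: Iset_def)

lemma linP_Aop: "1 \<le> n \<Longrightarrow> i \<in> Iset n \<Longrightarrow> j \<in> Iset n \<Longrightarrow> linP n (Aop n i j)"
  unfolding Aop_def[abs_def] by (intro linP_diff_fun linP_if linP_Nop) (auto simp: Iset_def)

lemma linP_sum: "finite A \<Longrightarrow> linP n f \<Longrightarrow> (\<And>i. i \<in> A \<Longrightarrow> inP n (S i)) \<Longrightarrow> f (sum S A) = (\<Sum>i\<in>A. f (S i))"
  by (induction A rule: finite_induct) (auto simp: linP_zero linPD(2) inP_sum)

text \<open>The map \<theta> sends the matrix units at (2n+1, 2n) and (2n, 2n+1) to their negatives,
  and it interchanges the two middle diagonal units up to sign.\<close>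

lemma Ebar_middle:
  assumes "1 \<le> n"
  shows "Ebar n (2*n+1) (2*n) = 0" "Ebar n (2*n) (2*n+1) = 0" "Ebar n (2*n+1) (2*n+1) = - Ebar n (2*n) (2*n)"
proof -
  have p: "pr n (2*n) = 2*n+1" "pr n (2*n+1) = 2*n" using assms by (auto simp: pr_def)
  have t: "thsign n (2*n+1) (2*n) = -1" "thsign n (2*n) (2*n+1) = -1" "thsign n (2*n) (2*n) = -1" "thsign n (2*n+1) (2*n+1) = -1"
    using assms by (auto simp: thsign_def par_def dlt_def)
  have z: "barX n (\<lambda>a b. 0) = 0" by (simp add: barX_eq coord_def cong: if_cong)
  have "Fmat n (2*n+1) (2*n) = (\<lambda>a b. 0)" "Fmat n (2*n) (2*n+1) = (\<lambda>a b. 0)"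
    unfolding Fmat_def p t by (auto simp: fun_eq_iff)
  then show "Ebar n (2*n+1) (2*n) = 0" "Ebar n (2*n) (2*n+1) = 0" by (simp_all only: Ebar_def z sp.scale_zero_right)
  have "Fmat n (2*n+1) (2*n+1) = (\<lambda>a b. - Fmat n (2*n) (2*n) a b)"
    unfolding Fmat_def p t by (auto simp: fun_eq_iff)
  moreover have "barX n (\<lambda>a b. - X a b) = - barX n X" for X
    by (simp add: barX_eq coord_def sum_negf[symmetric] if_distrib[of "\<lambda>z. spscale z _"]) (intro sum.cong, auto)
  moreover have "par n (2*n+1) = par n (2*n)" using assms by (simp add: par_def)
  ultimately show "Ebar n (2*n+1) (2*n+1) = - Ebar n (2*n) (2*n)" by (simp only: Ebar_def sp.scale_minus_right)
qed

lemma Mop_lower_zero: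
  "1 \<le> n \<Longrightarrow> i \<in> Iset n \<Longrightarrow> j \<in> Iset n \<Longrightarrow> j + 1 < i \<Longrightarrow> (i, j) \<noteq> (2*n+1, 2*n-1) \<Longrightarrow> (i, j) \<noteq> (2*n+2, 2*n) \<Longrightarrow> Mop n i j S = 0"
  by (auto simp: Mop_def fmat_entry)

lemma Mop_sub:
  assumes "1 \<le> n"
  shows "1 \<le> j \<Longrightarrow> j < 2*n \<Longrightarrow> Mop n (j+1) j S = - S"
    "2*n < j \<Longrightarrow> j < 4*n \<Longrightarrow> Mop n (j+1) j S = pdscale (- thsign n (4*n+1-j) (4*n-j)) S"
    "Mop n (2*n+1) (2*n) S = 0" "Mop n (2*n+1) (2*n-1) S = - S"
    "Mop n (2*n+2) (2*n) S = S" "Mop n (2*n+2) (2*n+1) S = S"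
proof -
  have t: "thsign n (2*n) (2*n-1) = -1" using assms by (auto simp: thsign_def par_def dlt_def)
  have "fmat n (2*n+2) (2*n+1) = -1" using assms t
    by (subst fmat_entry) (auto simp: Iset_def)
  moreover have "fmat n (2*n+2) (2*n) = -1" "fmat n (2*n+1) (2*n) = 0" "fmat n (2*n+1) (2*n-1) = 1"
    using assms by (subst fmat_entry; auto simp: Iset_def)+
  ultimately show "Mop n (2*n+1) (2*n) S = 0" "Mop n (2*n+1) (2*n-1) S = - S"
    "Mop n (2*n+2) (2*n) S = S" "Mop n (2*n+2) (2*n+1) S = S"
    using assms by (auto simp: Mop_def)
  show "1 \<le> j \<Longrightarrow> j < 2*n \<Longrightarrow> Mop n (j+1) j S = - S"
    using assms by (auto simp: Mop_def fmat_entry Iset_def)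
  show "2*n < j \<Longrightarrow> j < 4*n \<Longrightarrow> Mop n (j+1) j S = pdscale (- thsign n (4*n+1-j) (4*n-j)) S"
    using assms by (auto simp: Mop_def fmat_entry Iset_def)
qed

section \<open>Gauge covariance\<close>

text \<open>A \<open>\<chi>\<close>-valued series \<open>u\<close> is a function with \<open>u k m\<close> the coefficient of \<open>D^k\<close> and \<open>\<chi>^m\<close>.\<close>

type_synonym qd = "int \<Rightarrow> nat \<Rightarrow> sp"

definition validQ :: "nat \<Rightarrow> qd \<Rightarrow> bool" where
  "validQ n u \<longleftrightarrow> (\<forall>k m. gval n (BV n) (u k m))"

definition eps :: "pd \<Rightarrow> qd" where
  "eps s k m = (if m = 0 then s k else 0)"

lemma validQ_gval: "validQ n u \<Longrightarrow> gval n (BV n) (u k m)"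
  by (simp add: validQ_def)

lemma validQ_fs: "validQ n u \<Longrightarrow> fs (u k m)"
  using validQ_gval gval_fs by blast

lemma validQ_eps: "inP n s \<Longrightarrow> validQ n (eps s)"
  by (simp add: validQ_def eps_def inP_gval_BV)

locale unipotent =
  fixes n :: nat and a :: "nat \<times> nat"
  assumes n1: "1 \<le> n" and a_basis: "a \<in> basis n" and a_pos: "ibar n (fst a) < ibar n (snd a)"
begin

abbreviation p :: nat where "p \<equiv> bpar n a"
abbreviation A :: mat where "A \<equiv> Fk n a"

definition dlta :: "pd \<Rightarrow> qd" where
  "dlta s k m = brk n a (s k) m"

text \<open>The actions of \<open>D\<close> and of left multiplication that make \<open>dlta\<close> an even derivation.\<close>

definition Tq :: "qd \<Rightarrow> qd" where
  "Tq u k m = spscale ((-1) ^ (p + m)) (Dsp n (u k m) - (if m = 0 then 0 else u k (m - 1)) + sigma n (u (k - 1) m))"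

definition Eq :: "nat \<Rightarrow> nat \<Rightarrow> qd \<Rightarrow> qd" where
  "Eq i j u k m = spscale ((-1) ^ ((p + m) * (par n i + par n j + 1))) (spmul n (Ebar n j i) (u k m))"

text \<open>Unreduced counterpart of \<open>Mq\<close>, with E also below the diagonal, as
  \<open>Lop\<close> is for \<open>Mop\<close>. The commutator identity is proved exactly for these
  two and then transferred modulo the ideal.\<close>

definition Lq :: "nat \<Rightarrow> nat \<Rightarrow> qd \<Rightarrow> qd" where
  "Lq i j u k m = (if i = j then Tq u k m else 0) + Eq i j u k m"

definition Mq :: "nat \<Rightarrow> nat \<Rightarrow> qd \<Rightarrow> qd" where
  "Mq i j u k m = (if i \<le> j then Lq i j u k m else spscale (- fmat n i j) (u k m))"

definition Lop :: "nat \<Rightarrow> nat \<Rightarrow> pd \<Rightarrow> pd" where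
  "Lop i j s k = (if i = j then pdD n s k else 0) + spmul n (Ebar n j i) (s k)"

lemma a_Iset: "fst a \<in> Iset n" "snd a \<in> Iset n"
  using a_basis by (auto simp: basis_def)

lemma A_pos: "x \<in> Iset n \<Longrightarrow> y \<in> Iset n \<Longrightarrow> A x y \<noteq> 0 \<Longrightarrow> ibar n x < ibar n y"
  using Fk_pos_entry[OF a_basis a_pos] by blast

lemma A_par: "x \<in> Iset n \<Longrightarrow> y \<in> Iset n \<Longrightarrow> A x y \<noteq> 0 \<Longrightarrow> (par n x + par n y) mod 2 = p mod 2"
  using mhom_Fk[of n a] unfolding mhom_def by blast

lemma Ebar_mult_cong:
  assumes "i \<in> Iset n" "j \<in> Iset n" "j < i" "gval n (BV n) x"
  shows "spmul n (Ebar n j i) x + spscale (fmat n i j) x \<in> Jset n"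
proof -
  have "spmul n (Ebar n j i + spconst (fmat n i j)) x \<in> Jset n"
    using Ebar_cong_fmat[OF n1 assms(1-3)] assms(4) by (rule Jset_linhom_mult)
  then show ?thesis using assms(4) by (simp add: spmul_add_left gval_fs[OF gval_Ebar] spmul_spconst)
qed

lemma Mq_cong_Lq:
  assumes "i \<in> Iset n" "j \<in> Iset n" "validQ n u"
  shows "Mq i j u k m - Lq i j u k m \<in> Jset n"
proof (cases "i \<le> j")
  case False
  note c = Ebar_mult_cong[OF assms(1,2) _ validQ_gval[OF assms(3)], of k m]
  let ?s = "(-1) ^ ((p + m) * (par n i + par n j + 1)) :: complex"
  have "Mq i j u k m - Lq i j u k m = - (spscale (fmat n i j) (u k m) + spscale ?s (spmul n (Ebar n j i) (u k m)))"
    using False by (simp add: Mq_def Lq_def Eq_def)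
  also have "\<dots> = spscale (- ?s) (spmul n (Ebar n j i) (u k m) + spscale (fmat n i j) (u k m))"
  proof (cases "fmat n i j = 0")
    case False
    \<comment> \<open>\<open>Eq\<close> carries a sign that the scalar -f_ij does not; where f_ij is
      nonzero the row and column parities differ, so the sign is 1.\<close>
    then have "?s = 1" using fmat_odd[OF n1 assms(1,2)] by (simp add: minus_one_power_iff)
    then show ?thesis by simp
  qed simp
  also have "\<dots> \<in> Jset n" using c False by (intro Jset_scale) simp
  finally show ?thesis .
qed (simp add: Mq_def)

lemma Mop_cong_Lop:
  assumes "i \<in> Iset n" "j \<in> Iset n" "inP n s"
  shows "Mop n i j s k - Lop i j s k \<in> Jset n"
proof (cases "i \<le> j")
  case True
  then show ?thesis by (simp add: Mop_def Lop_def lmulP_def pd_add_apply pd_zero_apply)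
next
  case False
  have "Mop n i j s k - Lop i j s k = - (spmul n (Ebar n j i) (s k) + spscale (fmat n i j) (s k))"
    using False by (simp add: Mop_def Lop_def pdscale_apply pd_uminus_apply)
  moreover have "spmul n (Ebar n j i) (s k) + spscale (fmat n i j) (s k) \<in> Jset n"
    using Ebar_mult_cong[OF assms(1,2) _ inP_gval_BV[OF assms(3)], of k] False by simp
  ultimately show ?thesis by (simp only: Jset_uminus)
qed

lemma dlta_pdD:
  assumes "inP n s" shows "brk n a (pdD n s k) m = Tq (dlta s) k m"
proof -
  have g: "gval n (BV n) (s j)" for j by (rule inP_gval_BV[OF assms])
  have "brk n a (pdD n s k) m = brk n a (Dsp n (s k)) m + brk n a (sigma n (s (k - 1))) m"
    unfolding pdD_apply using assms by (intro brk_add) auto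
  then show ?thesis unfolding brk_Dsp[OF g] brk_sigma[OF g] Tq_def dlta_def
    by (simp add: sp.scale_right_distrib)
qed

lemma dlta_Ebar_mult:
  assumes "inP n s"
  shows "brk n a (spmul n (Ebar n j i) (s k)) m = spmul n (brk n a (Ebar n j i) m) (s k) + Eq i j (dlta s) k m"
  unfolding brk_spmul_linhom[OF linhom_Ebar inP_gval[OF assms]] Eq_def dlta_def ..

lemma dlta_Lop:
  assumes "inP n s"
  shows "brk n a (Lop i j s k) m = Lq i j (dlta s) k m + spmul n (brk n a (Ebar n j i) m) (s k)"
proof -
  have "fs (pdD n s k)" using assms inP_fs[OF inP_pdD] by blast
  moreover have "fs (spmul n (Ebar n j i) (s k))" using assms by (intro fs_spmul gval_fs[OF gval_Ebar] inP_fs)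
  ultimately have "brk n a (Lop i j s k) m = (if i = j then brk n a (pdD n s k) m else 0)
      + brk n a (spmul n (Ebar n j i) (s k)) m"
    unfolding Lop_def by (simp add: brk_add)
  then show ?thesis unfolding dlta_pdD[OF assms] dlta_Ebar_mult[OF assms] Lq_def by (simp add: add_ac)
qed

text \<open>The matrix identity \<open>\<delta>L = [L, \<epsilon>A]\<close> in terms of operators.\<close>

lemma brk_Ebar_commutator:
  assumes ij: "i \<in> Iset n" "j \<in> Iset n" and s: "inP n s"
  shows "spmul n (brk n a (Ebar n j i) m) (s k) =
    (\<Sum>l\<in>Iset n. spscale (A l j) (Lq i l (eps s) k m))
    - spscale ((-1) ^ p) (\<Sum>l\<in>Iset n. spscale (A i l) (eps (Lop l j s) k m))"
proof -
  have fss: "fs (s k)" using s by simp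
  have fsE: "fs (Ebar n x y)" for x y by (rule gval_fs[OF gval_Ebar])
  consider "m = 0" | "m = 1" | "m > 1" by linarith
  then show ?thesis
  proof cases
    case 1
    have L: "Lq i l (eps s) k 0 = (if l = i then spscale ((-1) ^ p) (pdD n s k) else 0)
       + spscale ((-1) ^ (p * (par n i + par n l + 1))) (spmul n (Ebar n l i) (s k))" for l
      by (auto simp: Lq_def Tq_def Eq_def eps_def pdD_apply)
    have sg: "spscale (A l j * (-1) ^ (p * (par n i + par n l + 1))) x = spscale ((-1) ^ (p * (par n i + par n j)) * A l j) x"
      if "l \<in> Iset n" for l x
    proof (cases "A l j = 0")
      case False
      have "(par n l + par n j) mod 2 = p mod 2" by (rule A_par[OF that ij(2) False])
      then have "even (par n l + par n j) = even p" by (metis even_iff_mod_2_eq_zero)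
      then have "(-1) ^ (p * (par n i + par n l + 1)) = ((-1) ^ (p * (par n i + par n j)) :: complex)"
        by (auto simp: minus_one_power_iff)
      then show ?thesis by (simp add: mult.commute)
    qed simp
    \<comment> \<open>In \<open>S1\<close> and \<open>S2\<close> the D-part sits only at the entry
      of A at (i, j); since A is constant, the factor (-1)^p makes the two cancel.\<close>
    have S1: "(\<Sum>l\<in>Iset n. spscale (A l j) (Lq i l (eps s) k 0)) = spscale (A i j * (-1) ^ p) (pdD n s k)
      + (\<Sum>l\<in>Iset n. spscale ((-1) ^ (p * (par n i + par n j)) * A l j) (spmul n (Ebar n l i) (s k)))"
    proof -
      have "(\<Sum>l\<in>Iset n. spscale (A l j) (Lq i l (eps s) k 0)) =
        (\<Sum>l\<in>Iset n. (if l = i then spscale (A i j * (-1) ^ p) (pdD n s k) else 0)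
         + spscale ((-1) ^ (p * (par n i + par n j)) * A l j) (spmul n (Ebar n l i) (s k)))"
        by (rule sum.cong[OF refl]) (simp add: L sp.scale_right_distrib sg[symmetric])
      then show ?thesis using ij by (simp add: sum.distrib)
    qed
    have S2: "(\<Sum>l\<in>Iset n. spscale (A i l) (eps (Lop l j s) k 0)) = spscale (A i j) (pdD n s k)
      + (\<Sum>l\<in>Iset n. spscale (A i l) (spmul n (Ebar n j l) (s k)))"
    proof -
      have "(\<Sum>l\<in>Iset n. spscale (A i l) (eps (Lop l j s) k 0)) =
        (\<Sum>l\<in>Iset n. (if l = j then spscale (A i j) (pdD n s k) else 0) + spscale (A i l) (spmul n (Ebar n j l) (s k)))"
        by (rule sum.cong[OF refl]) (simp add: eps_def Lop_def sp.scale_right_distrib)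
      then show ?thesis using ij by (simp add: sum.distrib)
    qed
    have "spmul n (brk n a (Ebar n j i) 0) (s k) =
      (\<Sum>l\<in>Iset n. spscale ((-1) ^ (p * (par n i + par n j)) * A l j) (spmul n (Ebar n l i) (s k)))
      - (\<Sum>l\<in>Iset n. spscale ((-1) ^ p * A i l) (spmul n (Ebar n j l) (s k)))"
      unfolding brk_Ebar(1)[OF ij a_Iset]
      using fss fsE by (subst spmul_diff_left) (auto simp: spmul_sum_left spmul_scale_left)
    then show ?thesis unfolding 1 S1 S2
      by (simp add: sp.scale_right_distrib sp.scale_sum_right mult.commute)
  next
    case 2
    \<comment> \<open>At chi-degree 1 only the shift term of \<open>Tq\<close> survives; it
      reproduces the chi-term of the bracket.\<close>
    have L: "spscale (A l j) (Lq i l (eps s) k 1) = (if l = i then spscale ((-1) ^ p * A i j) (s k) else 0)" for l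
      by (auto simp: Lq_def Tq_def Eq_def eps_def mult.commute)
    have "spmul n (brk n a (Ebar n j i) 1) (s k) = spscale ((-1) ^ p * A i j) (s k)"
      unfolding brk_Ebar(2)[OF ij a_Iset] by (rule spmul_spconst[OF fss])
    then show ?thesis unfolding 2 using ij by (simp only: L) (simp add: eps_def)
  next
    case 3
    have "Lq i l (eps s) k m = 0" for l
      using 3 by (auto simp: Lq_def Tq_def Eq_def eps_def)
    then show ?thesis using 3 brk_Ebar(3)[OF ij a_Iset 3] by (simp add: eps_def)
  qed
qed

text \<open>The constraint is preserved: bracketing with \<open>a\<close> widens the gap in
  \<open>ibar\<close> to at least two, where f vanishes and E itself lies in the ideal. A constant
  chi-term would need an entry of A below the diagonal. At (2n+1, 2n) the element E is zero.\<close>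

lemma brk_Ebar_lower:
  assumes "i \<in> Iset n" "j \<in> Iset n" "j < i" "gval n (BV n) x"
  shows "spmul n (brk n a (Ebar n j i) m) x \<in> Jset n"
proof (cases "ibar n j = ibar n i")
  case True
  then have "j = 2*n" "i = 2*n+1" using assms by (auto simp: ibar_def split: if_splits)
  then show ?thesis using Ebar_middle[OF n1] by simp
next
  case False
  then have ib: "ibar n j < ibar n i" using assms(3) by (auto simp: ibar_def split: if_splits)
  have fsx: "fs x" using assms(4) by simp
  have fsE: "fs (Ebar n x y)" for x y by (rule gval_fs[OF gval_Ebar])
  have E: "spmul n (Ebar n u v) x \<in> Jset n" if "u \<in> Iset n" "v \<in> Iset n" "ibar n u + 1 < ibar n v" for u v
  proof -
    have "u < v" using that(3) by (auto simp: ibar_def split: if_splits)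
    moreover have "fmat n v u = 0" using fmat_ibar[OF n1 that(2,1)] that(3) by auto
    ultimately show ?thesis using Ebar_mult_cong[OF that(2,1) _ assms(4)] by simp
  qed
  consider "m = 0" | "m = 1" | "m > 1" by linarith
  then show ?thesis
  proof cases
    case 1
    have "spscale c (spmul n (Ebar n l i) x) \<in> Jset n" if "l \<in> Iset n" "A l j \<noteq> 0" for l c
      using A_pos[OF that(1) assms(2) that(2)] ib that assms by (intro Jset_scale E) auto
    moreover have "spscale c (spmul n (Ebar n j l) x) \<in> Jset n" if "l \<in> Iset n" "A i l \<noteq> 0" for l c
      using A_pos[OF assms(1) that] ib that assms by (intro Jset_scale E) auto
    moreover have "spmul n (brk n a (Ebar n j i) 0) x =
      (\<Sum>l\<in>Iset n. spscale ((-1) ^ (p * (par n i + par n j)) * A l j) (spmul n (Ebar n l i) x))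
      - (\<Sum>l\<in>Iset n. spscale ((-1) ^ p * A i l) (spmul n (Ebar n j l) x))"
      unfolding brk_Ebar(1)[OF assms(1,2) a_Iset]
      using fsx fsE by (subst spmul_diff_left) (auto simp: spmul_sum_left spmul_scale_left)
    ultimately show ?thesis unfolding 1
      by (simp only:) (intro Jset_diff Jset_sum, metis mult_zero_right sp.scale_zero_left Jset_zero, metis mult_zero_right sp.scale_zero_left Jset_zero)
  next
    case 2
    have "A i j = 0" using A_pos[OF assms(1,2)] ib by force
    then show ?thesis unfolding 2 brk_Ebar(2)[OF assms(1,2) a_Iset] by (simp add: spmul_spconst[OF fsx])
  next
    case 3
    then show ?thesis using brk_Ebar(3)[OF assms(1,2) a_Iset 3] by simp
  qed
qed

text \<open>The commutator identity is exact for the unreduced matrix; \<open>1\<close>,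
  \<open>2\<close>, \<open>3\<close> replace \<open>Lq\<close> and \<open>Lop\<close> by
  \<open>Mq\<close> and \<open>Mop\<close>. Here \<open>1\<close> also uses that the variation of an
  entry below the diagonal lies in the ideal.\<close>

lemma covariance:
  assumes ij: "i \<in> Iset n" "j \<in> Iset n" and s: "inP n s"
  shows "brk n a (Mop n i j s k) m - (Mq i j (dlta s) k m + (\<Sum>l\<in>Iset n. spscale (A l j) (Mq i l (eps s) k m))
     - spscale ((-1) ^ p) (\<Sum>l\<in>Iset n. spscale (A i l) (eps (Mop n l j s) k m))) \<in> Jset n"
proof -
  have 1: "brk n a (Mop n i j s k) m - Mq i j (dlta s) k m - spmul n (brk n a (Ebar n j i) m) (s k) \<in> Jset n"
  proof (cases "i \<le> j")
    case True
    have "Mop n i j s k = Lop i j s k" using True by (simp add: Mop_def Lop_def lmulP_def pd_add_apply pd_zero_apply)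
    then show ?thesis using True by (simp add: dlta_Lop[OF s] Mq_def)
  next
    case False
    then have "brk n a (Mop n i j s k) m = Mq i j (dlta s) k m"
      by (simp add: Mop_def Mq_def pdscale_apply pd_uminus_apply brk_scale dlta_def)
    then show ?thesis using brk_Ebar_lower[OF ij _ inP_gval_BV[OF s]] False by simp
  qed
  have 2: "(\<Sum>l\<in>Iset n. spscale (A l j) (Mq i l (eps s) k m)) - (\<Sum>l\<in>Iset n. spscale (A l j) (Lq i l (eps s) k m)) \<in> Jset n"
    unfolding sum_subtractf[symmetric] sp.scale_right_diff_distrib[symmetric]
    by (intro Jset_sum Jset_scale Mq_cong_Lq ij validQ_eps s)
  have 3: "(\<Sum>l\<in>Iset n. spscale (A i l) (eps (Mop n l j s) k m)) - (\<Sum>l\<in>Iset n. spscale (A i l) (eps (Lop l j s) k m)) \<in> Jset n"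
    unfolding sum_subtractf[symmetric] sp.scale_right_diff_distrib[symmetric]
    using Mop_cong_Lop[OF _ ij(2) s] by (intro Jset_sum Jset_scale) (auto simp: eps_def)
  have "brk n a (Mop n i j s k) m - (Mq i j (dlta s) k m + (\<Sum>l\<in>Iset n. spscale (A l j) (Mq i l (eps s) k m))
     - spscale ((-1) ^ p) (\<Sum>l\<in>Iset n. spscale (A i l) (eps (Mop n l j s) k m))) =
    (brk n a (Mop n i j s k) m - Mq i j (dlta s) k m - spmul n (brk n a (Ebar n j i) m) (s k))
    - ((\<Sum>l\<in>Iset n. spscale (A l j) (Mq i l (eps s) k m)) - (\<Sum>l\<in>Iset n. spscale (A l j) (Lq i l (eps s) k m)))
    + spscale ((-1) ^ p) ((\<Sum>l\<in>Iset n. spscale (A i l) (eps (Mop n l j s) k m)) - (\<Sum>l\<in>Iset n. spscale (A i l) (eps (Lop l j s) k m)))"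
    unfolding brk_Ebar_commutator[OF ij s] sp.scale_right_diff_distrib by (simp add: algebra_simps)
  also have "\<dots> \<in> Jset n" by (intro Jset_add Jset_diff Jset_scale 1 2 3)
  finally show ?thesis .
qed

lemma Tq_add: "validQ n u \<Longrightarrow> validQ n v \<Longrightarrow> Tq (\<lambda>k m. u k m + v k m) k m = Tq u k m + Tq v k m"
  by (auto simp: Tq_def Dsp_add sigma_add validQ_fs sp.scale_right_distrib[symmetric])

lemma Mq_add: "validQ n u \<Longrightarrow> validQ n v \<Longrightarrow> Mq i j (\<lambda>k m. u k m + v k m) k m = Mq i j u k m + Mq i j v k m"
  by (auto simp: Mq_def Lq_def Eq_def Tq_add spmul_add_right gval_fs[OF gval_Ebar] validQ_fs sp.scale_right_distrib)

lemma Mq_scale: "Mq i j (\<lambda>k m. spscale c (u k m)) k m = spscale c (Mq i j u k m)"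
  by (auto simp: Mq_def Lq_def Eq_def Tq_def spmul_scale_right Dsp_scale sigma_scale
     sp.scale_right_distrib sp.scale_right_diff_distrib mult.commute)

lemma validQ_add: "validQ n u \<Longrightarrow> validQ n v \<Longrightarrow> validQ n (\<lambda>k m. u k m + v k m)"
  and validQ_scale: "validQ n u \<Longrightarrow> validQ n (\<lambda>k m. spscale c (u k m))"
  by (simp_all add: validQ_def)

lemma validQ_sum: "(\<And>l. l \<in> B \<Longrightarrow> validQ n (u l)) \<Longrightarrow> validQ n (\<lambda>k m. \<Sum>l\<in>B. u l k m)"
  by (auto simp: validQ_def intro!: gval_sum)

lemma Mq_zero: "Mq i j (\<lambda>k m. 0) k m = 0"
  using Mq_scale[of i j 0 "\<lambda>k m. 0" k m] by simp

lemma Mq_sum: "finite B \<Longrightarrow> (\<And>l. l \<in> B \<Longrightarrow> validQ n (u l)) \<Longrightarrow>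
   Mq i j (\<lambda>k m. \<Sum>l\<in>B. u l k m) k m = (\<Sum>l\<in>B. Mq i j (u l) k m)"
proof (induction B rule: finite_induct)
  case (insert x F)
  then show ?case using Mq_add[of "u x" "\<lambda>k m. \<Sum>l\<in>F. u l k m"] validQ_sum[of F u] by simp
qed (simp add: Mq_zero)

lemma validQ_dlta: "inP n s \<Longrightarrow> validQ n (dlta s)"
  by (simp add: validQ_def dlta_def inP_gval_BV)

definition uvec :: "(nat \<Rightarrow> pd) \<Rightarrow> nat \<Rightarrow> qd" where
  "uvec c j k m = dlta (c j) k m + (\<Sum>l\<in>Iset n. spscale (A j l) (eps (c l) k m))"

definition rvec :: "(nat \<Rightarrow> pd) \<Rightarrow> nat \<Rightarrow> pd" where
  "rvec c i = (\<Sum>j\<in>Iset n. Mop n i j (c j))"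

lemma validQ_uvec: "(\<And>j. j \<in> Iset n \<Longrightarrow> inP n (c j)) \<Longrightarrow> j \<in> Iset n \<Longrightarrow> validQ n (uvec c j)"
  unfolding uvec_def[abs_def] by (intro validQ_add validQ_sum validQ_scale validQ_dlta validQ_eps) auto

lemma inP_Mop: "i \<in> Iset n \<Longrightarrow> j \<in> Iset n \<Longrightarrow> inP n s \<Longrightarrow> inP n (Mop n i j s)"
  using linPD(1)[OF linP_Mop] by blast

lemma sum_pd_apply: "(\<Sum>j\<in>B. f j :: pd) k = (\<Sum>j\<in>B. f j k)"
  by (rule sum_fun_apply)

text \<open>After summing \<open>covariance\<close> over the columns, the terms
  \<open>Mq i l (eps (c j))\<close> regroup as M applied to A c, the remaining ones as A applied to
  M c.\<close>

lemma covariance_vec: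
  assumes i: "i \<in> Iset n" and c: "\<And>j. j \<in> Iset n \<Longrightarrow> inP n (c j)"
  shows "(\<Sum>j\<in>Iset n. Mq i j (uvec c j) k m)
    - (brk n a (rvec c i k) m + spscale ((-1) ^ p) (\<Sum>l\<in>Iset n. spscale (A i l) (eps (rvec c l) k m))) \<in> Jset n"
proof -
  have 1: "(\<Sum>j\<in>Iset n. Mq i j (uvec c j) k m) = (\<Sum>j\<in>Iset n. Mq i j (dlta (c j)) k m)
      + (\<Sum>j\<in>Iset n. \<Sum>l\<in>Iset n. spscale (A l j) (Mq i l (eps (c j)) k m))"
  proof -
    have "Mq i j (uvec c j) k m = Mq i j (dlta (c j)) k m + (\<Sum>l\<in>Iset n. spscale (A j l) (Mq i j (eps (c l)) k m))"
      if j: "j \<in> Iset n" for j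
      unfolding uvec_def[abs_def] using c j
      by (simp add: Mq_add validQ_dlta validQ_sum validQ_scale validQ_eps Mq_sum Mq_scale)
    then have "(\<Sum>j\<in>Iset n. Mq i j (uvec c j) k m) = (\<Sum>j\<in>Iset n. Mq i j (dlta (c j)) k m)
      + (\<Sum>j\<in>Iset n. \<Sum>l\<in>Iset n. spscale (A j l) (Mq i j (eps (c l)) k m))"
      by (simp add: sum.distrib)
    also have "(\<Sum>j\<in>Iset n. \<Sum>l\<in>Iset n. spscale (A j l) (Mq i j (eps (c l)) k m)) =
       (\<Sum>j\<in>Iset n. \<Sum>l\<in>Iset n. spscale (A l j) (Mq i l (eps (c j)) k m))"
      by (rule sum.swap)
    finally show ?thesis .
  qed
  have 2: "brk n a (rvec c i k) m = (\<Sum>j\<in>Iset n. brk n a (Mop n i j (c j) k) m)"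
    unfolding rvec_def sum_pd_apply using i c by (intro brk_sum) (auto intro!: inP_fs inP_Mop)
  have 3: "(\<Sum>l\<in>Iset n. spscale (A i l) (eps (rvec c l) k m)) =
     (\<Sum>j\<in>Iset n. \<Sum>l\<in>Iset n. spscale (A i l) (eps (Mop n l j (c j)) k m))"
  proof -
    have "eps (rvec c l) k m = (\<Sum>j\<in>Iset n. eps (Mop n l j (c j)) k m)" for l
      by (simp add: eps_def rvec_def sum_pd_apply)
    then show ?thesis by (simp add: sp.scale_sum_right) (rule sum.swap)
  qed
  let ?X = "\<lambda>j. brk n a (Mop n i j (c j) k) m - (Mq i j (dlta (c j)) k m + (\<Sum>l\<in>Iset n. spscale (A l j) (Mq i l (eps (c j)) k m))
     - spscale ((-1) ^ p) (\<Sum>l\<in>Iset n. spscale (A i l) (eps (Mop n l j (c j)) k m)))"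
  have "(\<Sum>j\<in>Iset n. - ?X j) \<in> Jset n"
    by (intro Jset_sum Jset_uminus covariance i c)
  also have "(\<Sum>j\<in>Iset n. - ?X j) = (\<Sum>j\<in>Iset n. Mq i j (uvec c j) k m)
    - (brk n a (rvec c i k) m + spscale ((-1) ^ p) (\<Sum>l\<in>Iset n. spscale (A i l) (eps (rvec c l) k m)))"
    unfolding 1 2 3 by (simp add: sum_subtractf sum.distrib sp.scale_sum_right)
  finally show ?thesis .
qed

end

lemma Iset_eq: "Iset n = {1..4*n}"
  by (simp add: Iset_def)

section \<open>Back substitution modulo the ideal\<close>

context unipotent begin

text \<open>The coefficient of D^k after applying an entry involves only the coefficients of D^k and
  D^(k-1), so membership in the ideal can be tracked on such a set of exponents: all of them for the
  full determinant, the nonpositive ones for the truncated one.\<close>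

definition downset :: "int set \<Rightarrow> bool" where
  "downset B \<longleftrightarrow> (\<forall>k\<in>B. k - 1 \<in> B)"

definition JB :: "int set \<Rightarrow> qd \<Rightarrow> bool" where
  "JB B u \<longleftrightarrow> (\<forall>k\<in>B. \<forall>m. u k m \<in> Jset n)"

lemma JB_Mq:
  assumes "downset B" "JB B u" shows "JB B (Mq i j u)"
proof -
  have "Tq u k m \<in> Jset n" if "k \<in> B" for k m
    using assms that unfolding Tq_def JB_def downset_def
    by (intro Jset_scale Jset_add Jset_diff Jset_Dsp Jset_sigma[OF n1]) auto
  moreover have "Eq i j u k m \<in> Jset n" if "k \<in> B" for k m
    using assms that unfolding Eq_def JB_def by (intro Jset_scale Jset_mul gval_Ebar) auto
  ultimately show ?thesis
    using assms unfolding JB_def Mq_def Lq_def by (auto intro!: Jset_uminus Jset_scale intro: Jset_add)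
qed

lemma Mq_lower_zero:
  "i \<in> Iset n \<Longrightarrow> j \<in> Iset n \<Longrightarrow> j + 1 < i \<Longrightarrow> (i, j) \<noteq> (2*n+1, 2*n-1) \<Longrightarrow> (i, j) \<noteq> (2*n+2, 2*n) \<Longrightarrow> Mq i j u k m = 0"
  using n1 by (auto simp: Mq_def fmat_entry)

lemma fmat_sub: "j \<in> {1..<4*n} \<Longrightarrow> j \<noteq> 2*n \<Longrightarrow> fmat n (j+1) j \<noteq> 0"
  using n1 thsign_cases[of n "4*n+1-j" "4*n-j"] by (subst fmat_entry) (auto simp: Iset_def)

text \<open>Back substitution: row \<open>j + 1\<close> determines \<open>u j\<close> from the later entries.\<close>

lemma back_substitution:
  assumes B: "downset B" and j: "j \<in> {1..<4*n}" "j \<noteq> 2*n" "j \<noteq> 2*n+1"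
    and row: "\<And>k m. k \<in> B \<Longrightarrow> (\<Sum>l\<in>Iset n. Mq (j+1) l (u l) k m) \<in> Jset n"
    and later: "\<And>l. l \<in> {j+1..4*n} \<Longrightarrow> JB B (u l)"
  shows "JB B (u j)"
  unfolding JB_def
proof (intro ballI allI)
  fix k m assume k: "k \<in> B"
  have I: "Iset n = insert j ({1..<j} \<union> {j+1..4*n})" using j by (auto simp: Iset_def)
  have low: "Mq (j+1) l (u l) k m = 0" if "l \<in> {1..<j}" for l
    using that j by (intro Mq_lower_zero) (auto simp: Iset_def)
  have high: "(\<Sum>l\<in>{j+1..4*n}. Mq (j+1) l (u l) k m) \<in> Jset n"
    using JB_Mq[OF B later] k unfolding JB_def by (intro Jset_sum) auto
  have "(\<Sum>l\<in>Iset n. Mq (j+1) l (u l) k m) = Mq (j+1) j (u j) k m + (\<Sum>l\<in>{j+1..4*n}. Mq (j+1) l (u l) k m)"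
    unfolding I using sum.neutral[of "{1..<j}" "\<lambda>l. Mq (j+1) l (u l) k m"] low
    by (subst sum.insert, simp, simp, subst sum.union_disjoint) auto
  then have "Mq (j+1) j (u j) k m = (\<Sum>l\<in>Iset n. Mq (j+1) l (u l) k m) - (\<Sum>l\<in>{j+1..4*n}. Mq (j+1) l (u l) k m)"
    by simp
  also have "\<dots> \<in> Jset n" by (intro Jset_diff row k high)
  finally have "spscale (- fmat n (j+1) j) (u j k m) \<in> Jset n" by (simp add: Mq_def)
  then show "u j k m \<in> Jset n" using fmat_sub[OF j(1,2)] by (metis Jset_scale_iff neg_equal_0_iff_equal)
qed

text \<open>The condition on \<open>b\<close> and \<open>a'\<close> keeps the unknowns 2n and 2n+1
  out of the range: row 2n+1 has no subdiagonal entry, and row 2n+2 involves both of them.\<close>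

lemma back_substitution_range:
  assumes B: "downset B" and b: "b \<le> 4*n" "b \<le> 2*n \<or> 2*n+2 \<le> a'" and a': "1 \<le> a'"
    and row: "\<And>j k m. j \<in> {a'..<b} \<Longrightarrow> k \<in> B \<Longrightarrow> (\<Sum>l\<in>Iset n. Mq (j+1) l (u l) k m) \<in> Jset n"
    and later: "\<And>l. l \<in> {b..4*n} \<Longrightarrow> JB B (u l)"
  shows "l \<in> {a'..4*n} \<Longrightarrow> JB B (u l)"
proof -
  have "\<forall>l\<in>{b - d..4*n}. a' \<le> l \<longrightarrow> JB B (u l)" for d
  proof (induction d)
    case 0
    then show ?case using later by auto
  next
    case (Suc d)
    show ?case
    proof (intro ballI impI)
      fix l assume l: "l \<in> {b - Suc d..4*n}" "a' \<le> l"
      show "JB B (u l)"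
      proof (cases "l \<in> {b - d..4*n}")
        case True
        then show ?thesis using Suc l by blast
      next
        case False
        then have lb: "l = b - Suc d" "b - Suc d < b - d" using l by auto
        show ?thesis
        proof (rule back_substitution[OF B])
          show "l \<in> {1..<4*n}" "l \<noteq> 2*n" "l \<noteq> 2*n+1" using lb l a' b by auto
          show "(\<Sum>m\<in>Iset n. Mq (l+1) m (u m) k q) \<in> Jset n" if "k \<in> B" for k q
            using lb l that by (intro row) auto
          show "JB B (u m)" if "m \<in> {l+1..4*n}" for m
            using Suc that lb l by auto
        qed
      qed
    qed
  qed
  from this[of b] show "l \<in> {a'..4*n} \<Longrightarrow> JB B (u l)" by auto
qed

text \<open>As for \<open>pdD_injective\<close>, descending from the bound. The induction treats all
  powers of chi at once, since \<open>Tq\<close> also involves the coefficient of chi^(m-1) at the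
  same power of D.\<close>

lemma Tq_injective_mod:
  assumes "\<And>k m. Tq w k m \<in> Jset n" and bd: "\<And>k m. N < k \<Longrightarrow> w k m = 0"
  shows "w k m \<in> Jset n"
proof -
  have *: "\<forall>m. w (N - int d) m \<in> Jset n" for d
  proof (induction d rule: less_induct)
    case (less d)
    have up: "w (N - int d + 1) m \<in> Jset n" for m
    proof (cases d)
      case (Suc e)
      then show ?thesis using less[of e] by (simp add: algebra_simps)
    qed (use bd in simp)
    show ?case
    proof
      fix m
      let ?k = "N - int d + 1"
      let ?X = "Dsp n (w ?k m) - (if m = 0 then 0 else w ?k (m - 1))"
      have "spscale ((-1) ^ (p + m)) (?X + sigma n (w (N - int d) m)) \<in> Jset n"
        using assms(1)[of ?k m] by (simp add: Tq_def)
      then have "?X + sigma n (w (N - int d) m) \<in> Jset n"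
        by (subst (asm) Jset_scale_iff) auto
      moreover have "?X \<in> Jset n" using up by (auto intro!: Jset_diff Jset_Dsp)
      ultimately have "(?X + sigma n (w (N - int d) m)) - ?X \<in> Jset n" by (rule Jset_diff)
      then have "sigma n (w (N - int d) m) \<in> Jset n" by simp
      then show "w (N - int d) m \<in> Jset n" using Jset_sigma[OF n1] sigma_sigma by metis
    qed
  qed
  show ?thesis
  proof (cases "N < k")
    case False
    then show ?thesis using *[of "nat (N - k)"] by simp
  qed (use bd in simp)
qed

text \<open>Modulo later unknowns, row 2n+2 says that the sum of the two middle unknowns vanishes.
  Subtracting row 2n from row 2n+1 eliminates the unknown 2n-1; as the middle diagonal entries are D
  + E and D - E, what remains is D of the difference minus E times the sum. So the difference
  vanishes too, and 2 is invertible.\<close>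

lemma middle_rows:
  assumes row: "\<And>i k m. i \<in> {2*n, 2*n+1, 2*n+2} \<Longrightarrow> (\<Sum>l\<in>Iset n. Mq i l (u l) k m) \<in> Jset n"
    and later: "\<And>l. l \<in> {2*n+2..4*n} \<Longrightarrow> JB UNIV (u l)"
    and valid: "\<And>l. l \<in> Iset n \<Longrightarrow> validQ n (u l)"
    and bd: "\<And>k m. N < k \<Longrightarrow> u (2*n) k m = 0 \<and> u (2*n+1) k m = 0"
  shows "JB UNIV (u (2*n))" "JB UNIV (u (2*n+1))"
proof -
  let ?H = "\<lambda>i k m. \<Sum>l\<in>{2*n+2..4*n}. Mq i l (u l) k m"
  have H: "?H i k m \<in> Jset n" for i k m
    using JB_Mq[OF _ later] unfolding JB_def downset_def by (intro Jset_sum) auto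
  have I: "Iset n = {1..<2*n-1} \<union> ({2*n-1, 2*n, 2*n+1} \<union> {2*n+2..4*n})"
    using n1 by (auto simp: Iset_def)
  have S: "(\<Sum>l\<in>Iset n. F l) = (\<Sum>l\<in>{1..<2*n-1}. F l) + (F (2*n-1) + F (2*n) + F (2*n+1)) + (\<Sum>l\<in>{2*n+2..4*n}. F l)"
    for F :: "nat \<Rightarrow> sp"
  proof -
    have "2*n-1 \<noteq> 2*n" using n1 by simp
    then have "sum F {2*n-1, 2*n, 2*n+1} = F (2*n-1) + F (2*n) + F (2*n+1)" by (simp add: add_ac)
    moreover have "sum F (Iset n) = sum F {1..<2*n-1} + (sum F {2*n-1, 2*n, 2*n+1} + sum F {2*n+2..4*n})"
      unfolding I by (subst sum.union_disjoint, simp, simp, force, subst sum.union_disjoint) auto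
    ultimately show ?thesis by (simp add: add_ac)
  qed
  have low: "(\<Sum>l\<in>{1..<2*n-1}. Mq i l (u l) k m) = 0" if "i \<in> {2*n, 2*n+1, 2*n+2}" for i k m
  proof (intro sum.neutral ballI Mq_lower_zero)
    fix l assume "l \<in> {1..<2*n-1}"
    then show "i \<in> Iset n" "l \<in> Iset n" "l + 1 < i" "(i, l) \<noteq> (2*n+1, 2*n-1)" "(i, l) \<noteq> (2*n+2, 2*n)"
      using that n1 by (auto simp: Iset_def)
  qed
  have t: "thsign n (2*n) (2*n-1) = -1" using n1 by (auto simp: thsign_def par_def dlt_def)
  have f1: "fmat n (2*n+2) (2*n+1) = -1" using n1 t by (subst fmat_entry) (auto simp: Iset_def)
  have f2: "fmat n (2*n+2) (2*n) = -1" "fmat n (2*n+1) (2*n) = 0" "fmat n (2*n+1) (2*n-1) = 1"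
    "fmat n (2*n+2) (2*n-1) = 0" "fmat n (2*n) (2*n-1) = 1"
    using n1 by (subst fmat_entry; auto simp: Iset_def)+
  have nle: "\<not> 2*n+2 \<le> 2*n-1" "\<not> 2*n+1 \<le> 2*n-1" "\<not> 2*n \<le> 2*n-1" using n1 by auto
  have e2: "u (2*n) k m + u (2*n+1) k m \<in> Jset n" for k m
  proof -
    have "Mq (2*n+2) (2*n-1) (u (2*n-1)) k m = 0" "Mq (2*n+2) (2*n) (u (2*n)) k m = u (2*n) k m"
      "Mq (2*n+2) (2*n+1) (u (2*n+1)) k m = u (2*n+1) k m"
      using f1 f2 nle by (simp_all add: Mq_def)
    then have "u (2*n) k m + u (2*n+1) k m = (\<Sum>l\<in>Iset n. Mq (2*n+2) l (u l) k m) - ?H (2*n+2) k m"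
      unfolding S using low by simp
    also have "\<dots> \<in> Jset n" by (intro Jset_diff row H) simp
    finally show ?thesis .
  qed
  define E where "E = Ebar n (2*n) (2*n)"
  have fsE: "fs E" unfolding E_def by (rule gval_fs[OF gval_Ebar])
  define w where "w = (\<lambda>k m. u (2*n+1) k m - u (2*n) k m)"
  have v: "validQ n (u (2*n))" "validQ n (u (2*n+1))" using n1 by (auto simp: Iset_def intro!: valid)
  note fsu = validQ_fs[OF v(1)] validQ_fs[OF v(2)]
  have T: "Tq w k m \<in> Jset n" for k m
  proof -
    let ?s = "(-1) ^ (p + m) :: complex"
    have pp: "par n (2*n) = 0" "par n (2*n+1) = 0" using n1 by (auto simp: par_def)
    have Tw: "Tq w k m = Tq (u (2*n+1)) k m - Tq (u (2*n)) k m"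
      unfolding w_def Tq_def using fsu
      by (simp add: Dsp_diff sigma_diff sp.scale_right_diff_distrib sp.scale_right_distrib)
    have a1: "Mq (2*n+1) (2*n-1) (u (2*n-1)) k m = - u (2*n-1) k m" "Mq (2*n+1) (2*n) (u (2*n)) k m = 0"
      "Mq (2*n+1) (2*n+1) (u (2*n+1)) k m = Tq (u (2*n+1)) k m - spscale ?s (spmul n E (u (2*n+1) k m))"
      using f2 nle Ebar_middle(3)[OF n1] pp by (simp_all add: Mq_def Lq_def Eq_def E_def)
    have a2: "Mq (2*n) (2*n-1) (u (2*n-1)) k m = - u (2*n-1) k m"
      "Mq (2*n) (2*n) (u (2*n)) k m = Tq (u (2*n)) k m + spscale ?s (spmul n E (u (2*n) k m))"
      "Mq (2*n) (2*n+1) (u (2*n+1)) k m = 0"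
      using f2 nle Ebar_middle(1)[OF n1] pp by (simp_all add: Mq_def Lq_def Eq_def E_def)
    have r1: "(\<Sum>l\<in>Iset n. Mq (2*n+1) l (u l) k m) = - u (2*n-1) k m + (Tq (u (2*n+1)) k m - spscale ?s (spmul n E (u (2*n+1) k m))) + ?H (2*n+1) k m"
      unfolding S low[of "2*n+1", simplified] a1 using low by simp
    have r2: "(\<Sum>l\<in>Iset n. Mq (2*n) l (u l) k m) = - u (2*n-1) k m + (Tq (u (2*n)) k m + spscale ?s (spmul n E (u (2*n) k m))) + ?H (2*n) k m"
      unfolding S a2 using low by simp
    have "Tq w k m = ((\<Sum>l\<in>Iset n. Mq (2*n+1) l (u l) k m) - ?H (2*n+1) k m) - ((\<Sum>l\<in>Iset n. Mq (2*n) l (u l) k m) - ?H (2*n) k m)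
        + spscale ?s (spmul n E (u (2*n) k m + u (2*n+1) k m))"
      unfolding r1 r2 Tw using fsE fsu by (simp add: spmul_add_right sp.scale_right_distrib algebra_simps)
    also have "\<dots> \<in> Jset n"
    proof (intro Jset_add[OF Jset_diff] Jset_diff row H)
      have "spmul n E (u (2*n) k m + u (2*n+1) k m) \<in> Jset n"
        by (rule Jset_mul[OF e2]) (simp add: E_def)
      then show "spscale ?s (spmul n E (u (2*n) k m + u (2*n+1) k m)) \<in> Jset n" by (rule Jset_scale)
    qed auto
    finally show ?thesis .
  qed
  have wJ: "w k m \<in> Jset n" for k m
    by (rule Tq_injective_mod[OF T, of N]) (use bd in \<open>simp add: w_def\<close>)
  have "spscale 2 (u (2*n+1) k m) = (u (2*n) k m + u (2*n+1) k m) + w k m" for k m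
    using sp.scale_left_distrib[of 1 1 "u (2*n+1) k m"] by (simp add: w_def)
  then have "spscale 2 (u (2*n+1) k m) \<in> Jset n" for k m using Jset_add[OF e2 wJ] by metis
  then have u1: "u (2*n+1) k m \<in> Jset n" for k m by (simp add: Jset_scale_iff)
  then show "JB UNIV (u (2*n+1))" by (simp add: JB_def)
  have "u (2*n) k m = (u (2*n) k m + u (2*n+1) k m) - u (2*n+1) k m" for k m by simp
  then show "JB UNIV (u (2*n))" unfolding JB_def using Jset_diff[OF e2 u1] by metis
qed

text \<open>Index 1 has the smallest \<open>ibar\<close>. Consequently A annihilates every vector
  (R, 0, ..., 0).\<close>

lemma A_first_column: "i \<in> Iset n \<Longrightarrow> A i 1 = 0"
proof (rule ccontr)
  assume "i \<in> Iset n" "A i 1 \<noteq> 0"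
  then have "ibar n i < ibar n 1" using n1 by (intro A_pos) (auto simp: Iset_def)
  then show False using \<open>i \<in> Iset n\<close> n1 by (auto simp: ibar_def Iset_def split: if_splits)
qed

lemma uvec_bounded:
  assumes "\<And>j. j \<in> Iset n \<Longrightarrow> inP n (c j)" "j \<in> Iset n"
  shows "\<exists>N. \<forall>k>N. \<forall>m. uvec c j k m = 0"
proof -
  have "\<forall>l\<in>Iset n. \<exists>N. \<forall>k>N. c l k = 0" using assms(1) by (auto simp: inP_def)
  then obtain N where N: "\<And>l k. l \<in> Iset n \<Longrightarrow> k > N l \<Longrightarrow> c l k = 0" by metis
  define K where "K = Max (N ` Iset n)"
  have K: "N l \<le> K" if "l \<in> Iset n" for l using that by (simp add: K_def)
  have z: "c l k = 0" if "l \<in> Iset n" "k > K" for l k using N[OF that(1)] K[OF that(1)] that(2) by auto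
  show ?thesis
  proof (intro exI[of _ K] allI impI)
    fix k m assume "K < k"
    then show "uvec c j k m = 0" using z assms(2) by (auto simp: uvec_def dlta_def eps_def intro!: sum.neutral)
  qed
qed

lemma gauge_invariant_solution:
  assumes c: "\<And>j. j \<in> Iset n \<Longrightarrow> inP n (c j)"
    and r: "\<And>i. i \<in> {2..4*n} \<Longrightarrow> rvec c i = 0"
    and last: "\<And>k m. brk n a (c (4*n) k) m = 0"
  shows "brk n a (rvec c 1 k) m \<in> Jset n"
proof -
  let ?u = "uvec c"
  have tail: "(\<Sum>l\<in>Iset n. spscale (A i l) (eps (rvec c l) k m)) = 0" if i: "i \<in> Iset n" for i k m
  proof (rule sum.neutral, rule ballI)
    fix l assume "l \<in> Iset n"
    then show "spscale (A i l) (eps (rvec c l) k m) = 0"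
      using r[of l] A_first_column[OF i] by (cases "l = 1") (auto simp: eps_def pd_zero_apply Iset_def)
  qed
  have row: "(\<Sum>j\<in>Iset n. Mq i j (?u j) k m) \<in> Jset n" if "i \<in> {2..4*n}" for i k m
    using covariance_vec[of i c k m] c that tail[of i k m] r[OF that] by (simp add: Iset_def pd_zero_apply)
  \<comment> \<open>Index 4n has the largest \<open>ibar\<close>, so row 4n of A vanishes, and the
    bracket with the last entry is zero by assumption.\<close>
  have u4: "?u (4*n) k m = 0" for k m
  proof -
    have "A (4*n) l = 0" if "l \<in> Iset n" for l
    proof (rule ccontr)
      assume "A (4*n) l \<noteq> 0"
      then have "ibar n (4*n) < ibar n l" using that n1 by (intro A_pos) (auto simp: Iset_def)
      then show False using ibar_le[OF that] n1 by (simp add: ibar_def split: if_splits)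
    qed
    then show ?thesis by (simp add: uvec_def dlta_def last)
  qed
  have d: "downset UNIV" by (simp add: downset_def)
  have J1: "JB UNIV (?u l)" if "l \<in> {2*n+2..4*n}" for l
  proof (rule back_substitution_range[OF d, of "4*n" "2*n+2"])
    show "(\<Sum>l\<in>Iset n. Mq (j+1) l (?u l) k m) \<in> Jset n" if "j \<in> {2*n+2..<4*n}" for j k m
      using that by (intro row) auto
    show "JB UNIV (?u l)" if "l \<in> {4*n..4*n}" for l using that by (simp add: JB_def u4)
  qed (use that in auto)
  have I: "2*n \<in> Iset n" "2*n+1 \<in> Iset n" using n1 by (auto simp: Iset_def)
  obtain N1 N2 where N: "\<forall>k>N1. \<forall>m. ?u (2*n) k m = 0" "\<forall>k>N2. \<forall>m. ?u (2*n+1) k m = 0"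
    using uvec_bounded[of c, OF c I(1)] uvec_bounded[of c, OF c I(2)] by blast
  have J2: "JB UNIV (?u (2*n))" "JB UNIV (?u (2*n+1))"
  proof -
    have r: "(\<Sum>l\<in>Iset n. Mq i l (?u l) k m) \<in> Jset n" if "i \<in> {2*n, 2*n+1, 2*n+2}" for i k m
      using that n1 by (intro row) auto
    have v: "validQ n (?u l)" if "l \<in> Iset n" for l by (rule validQ_uvec[OF c that])
    have b: "?u (2*n) k m = 0 \<and> ?u (2*n+1) k m = 0" if "max N1 N2 < k" for k m using N that by simp
    show "JB UNIV (?u (2*n))" "JB UNIV (?u (2*n+1))"
      using middle_rows[OF r J1 v b] by blast+
  qed
  have later: "JB UNIV (?u l)" if l: "l \<in> {2*n..4*n}" for l
  proof -
    consider "l = 2*n" | "l = 2*n+1" | "l \<in> {2*n+2..4*n}" using l by force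
    then show ?thesis using J1 J2 by cases auto
  qed
  have J3: "JB UNIV (?u l)" if "l \<in> {1..4*n}" for l
  proof (rule back_substitution_range[OF d, of "2*n" 1])
    show "(\<Sum>l\<in>Iset n. Mq (j+1) l (?u l) k m) \<in> Jset n" if "j \<in> {1..<2*n}" "k \<in> UNIV" for j k m
      using that by (intro row) auto
  qed (use that later in auto)
  have i1: "1 \<in> Iset n" using n1 by (simp add: Iset_def)
  have "(\<Sum>j\<in>Iset n. Mq 1 j (?u j) k m) \<in> Jset n"
    using JB_Mq[OF d J3] unfolding JB_def by (intro Jset_sum) (auto simp: Iset_def)
  moreover have "(\<Sum>j\<in>Iset n. Mq 1 j (?u j) k m) - brk n a (rvec c 1 k) m \<in> Jset n"
    using covariance_vec[of 1 c k m, OF i1 c] tail[OF i1, of k m] by simp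
  ultimately have "(\<Sum>j\<in>Iset n. Mq 1 j (?u j) k m) - ((\<Sum>j\<in>Iset n. Mq 1 j (?u j) k m) - brk n a (rvec c 1 k) m) \<in> Jset n"
    by (rule Jset_diff)
  then show ?thesis by simp
qed

text \<open>From index 2n on, both parts of \<open>uvec\<close> vanish outright, so back
  substitution can start there and uses only rows 2 to 2n. The error in row 2n+1 reaches these rows
  through A, but not at exponents at most 0.\<close>

lemma gauge_invariant_truncation:
  assumes c: "\<And>j. j \<in> Iset n \<Longrightarrow> inP n (c j)"
    and r: "\<And>i. i \<in> {2..2*n} \<union> {2*n+2..4*n} \<Longrightarrow> rvec c i = 0"
    and rm: "\<And>k. k \<le> 0 \<Longrightarrow> rvec c (2*n+1) k = 0"
    and top: "\<And>j k m. j \<in> {2*n..4*n} \<Longrightarrow> brk n a (c j k) m = 0"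
    and zero: "\<And>j. j \<in> {2*n+2..4*n} \<Longrightarrow> c j = 0"
  shows "brk n a (rvec c 1 0) m \<in> Jset n"
proof -
  let ?u = "uvec c"
  have d: "downset {..0}" by (simp add: downset_def)
  have tail: "(\<Sum>l\<in>Iset n. spscale (A i l) (eps (rvec c l) k m)) = 0" if i: "i \<in> Iset n" and k: "k \<le> 0" for i k m
  proof (rule sum.neutral, rule ballI)
    fix l assume l: "l \<in> Iset n"
    consider "l = 1" | "l = 2*n+1" | "l \<in> {2..2*n} \<union> {2*n+2..4*n}" using l by (force simp: Iset_def)
    then show "spscale (A i l) (eps (rvec c l) k m) = 0"
      using r[of l] A_first_column[OF i] rm[OF k] by cases (auto simp: eps_def pd_zero_apply)
  qed
  have row: "(\<Sum>j\<in>Iset n. Mq i j (?u j) k m) \<in> Jset n" if "i \<in> {2..2*n}" "k \<in> {..0}" for i k m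
    using covariance_vec[of i c k m] c that tail[of i k m] r[of i] by (simp add: Iset_def pd_zero_apply)
  have later: "JB {..0} (?u j)" if j: "j \<in> {2*n..4*n}" for j
  proof -
    have jI: "j \<in> Iset n" using j n1 by (auto simp: Iset_def)
    have "spscale (A j l) (eps (c l) k m) = 0" if l: "l \<in> Iset n" for l k m
    proof (cases "l \<in> {2*n+2..4*n}")
      case True
      then show ?thesis using zero by (simp add: eps_def pd_zero_apply)
    next
      case False
      \<comment> \<open>Here l is at most 2n+1 and j at least 2n, so \<open>ibar\<close> of l, being
        at most 2n, does not exceed that of j.\<close>
      have "A j l = 0"
      proof (rule ccontr)
        assume "A j l \<noteq> 0"
        then have "ibar n j < ibar n l" by (intro A_pos jI l)
        then show False using False l j by (auto simp: ibar_def Iset_def split: if_splits)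
      qed
      then show ?thesis by simp
    qed
    then have "(\<Sum>l\<in>Iset n. spscale (A j l) (eps (c l) k m)) = 0" for k m by (intro sum.neutral) blast
    then show ?thesis using top[OF j] by (simp add: JB_def uvec_def dlta_def)
  qed
  have J3: "JB {..0} (?u l)" if "l \<in> {1..4*n}" for l
  proof (rule back_substitution_range[OF d, of "2*n" 1])
    show "(\<Sum>l\<in>Iset n. Mq (j+1) l (?u l) k m) \<in> Jset n" if "j \<in> {1..<2*n}" "k \<in> {..0}" for j k m
      using that by (intro row) auto
  qed (use that later in auto)
  have i1: "1 \<in> Iset n" using n1 by (simp add: Iset_def)
  have "(\<Sum>j\<in>Iset n. Mq 1 j (?u j) 0 m) \<in> Jset n"
    using JB_Mq[OF d J3] unfolding JB_def by (intro Jset_sum) (auto simp: Iset_def)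
  moreover have "(\<Sum>j\<in>Iset n. Mq 1 j (?u j) 0 m) - brk n a (rvec c 1 0) m \<in> Jset n"
    using covariance_vec[of 1 c 0 m, OF i1 c] tail[OF i1, of 0 m] by simp
  ultimately have "(\<Sum>j\<in>Iset n. Mq 1 j (?u j) 0 m) - ((\<Sum>j\<in>Iset n. Mq 1 j (?u j) 0 m) - brk n a (rvec c 1 0) m) \<in> Jset n"
    by (rule Jset_diff)
  then show ?thesis by simp
qed

end

section \<open>The row determinants are invariant\<close>

abbreviation pd_one :: pd where "pd_one \<equiv> pdconst (spconst 1)"

lemma inP_one [simp]: "inP n pd_one"
  unfolding inP_def by (auto simp: pdconst_def intro!: exI[of _ 0])

lemma brk_pd_one: "brk n a (pdscale c pd_one k) m = 0"
  by (simp add: pdscale_apply pdconst_def brk_scale spconst_eq_mon)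

lemma pdD_pd_one: "pdD n (pdscale c pd_one) k = (if k = 1 then spscale c (spconst 1) else 0)"
  by (simp add: pdD_apply pdscale_apply pdconst_def spconst_eq_mon Dsp_scale sigma_scale)

text \<open>The row operation cancels the entry of M at (2n+1, 2n-1) against that at (2n, 2n-1), the
  column operation the entry at (2n+2, 2n) against that at (2n+2, 2n+1).\<close>

lemma Aop_lower_zero:
  assumes n: "1 \<le> n" and ij: "i \<in> Iset n" "j \<in> Iset n" "j + 1 < i" and S: "inP n S"
  shows "Aop n i j S = 0"
proof (cases "i = 2*n+1")
  case True
  then have j: "j < 2*n" using ij by simp
  show ?thesis
  proof (cases "j = 2*n-1")
    case True
    then have "Mop n (2*n) j S = - S" using Mop_sub(1)[OF n, of j S] n by simp
    moreover have "Mop n (2*n+1) j S = - S" using Mop_sub(4)[OF n, of S] True by simp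
    ultimately show ?thesis using \<open>i = 2*n+1\<close> j by (simp add: Aop_def Nop_def)
  next
    case False
    have "Mop n (2*n+1) j S = 0" "Mop n (2*n) j S = 0"
      using False j ij n by (intro Mop_lower_zero; auto simp: Iset_def)+
    then show ?thesis using True j by (simp add: Aop_def Nop_def)
  qed
next
  case i: False
  show ?thesis
  proof (cases "j = 2*n")
    case True
    show ?thesis
    proof (cases "i = 2*n+2")
      case True
      then show ?thesis using Mop_sub(5,6)[OF n, of S] i \<open>j = 2*n\<close> by (simp add: Aop_def Nop_def)
    next
      case False
      have "Mop n i (2*n) S = 0" "Mop n i (2*n+1) S = 0"
        using False True i ij n by (intro Mop_lower_zero; auto simp: Iset_def)+
      then show ?thesis using True i by (simp add: Aop_def Nop_def)
    qed
  next
    case False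
    have "Mop n i j S = 0" using False i ij n by (intro Mop_lower_zero) auto
    then show ?thesis using False i by (simp add: Aop_def Nop_def)
  qed
qed

text \<open>The operations collect the middle 2 x 2 block into 0 - (D - E) - (D + E) + 0, with E the
  entry \<open>Ebar n (2*n) (2*n)\<close>.\<close>

lemma Aop_middle:
  assumes n: "1 \<le> n" and S: "inP n S"
  shows "Aop n (2*n+1) (2*n) S = pdscale (-2) (pdD n S)"
proof -
  have E: "lmulP n (Ebar n (2*n+1) (2*n+1)) S = - lmulP n (Ebar n (2*n) (2*n)) S"
    "lmulP n (Ebar n (2*n+1) (2*n)) S = 0"
    unfolding Ebar_middle[OF n] by (rule ext, simp add: lmulP_def pd_uminus_apply pd_zero_apply)+
  have m: "Mop n (2*n+1) (2*n) S = 0" by (rule Mop_sub(3)[OF n])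
  have "Aop n (2*n+1) (2*n) S = - pdD n S - pdD n S"
    unfolding Aop_def Nop_def using E m by (simp add: Mop_def)
  also have "\<dots> = pdscale (-2) (pdD n S)"
    using pd.scale_left_distrib[of "-1" "-1" "pdD n S"] by simp
  finally show ?thesis .
qed

lemma Aop_sub:
  assumes n: "1 \<le> n" and S: "inP n S"
  shows "1 \<le> j \<Longrightarrow> j < 2*n \<Longrightarrow> Aop n (j+1) j S = - S"
    "2*n < j \<Longrightarrow> j < 4*n \<Longrightarrow> Aop n (j+1) j S = pdscale (- thsign n (4*n+1-j) (4*n-j)) S"
  using Mop_sub(1,2)[OF n, of j S] by (simp_all add: Aop_def Nop_def)

lemma foldr_eq_inP:
  assumes "\<And>i S. i \<in> set xs \<Longrightarrow> inP n S \<Longrightarrow> f i S = h i S \<and> inP n (h i S)" "inP n s"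
  shows "foldr f xs s = foldr h xs s \<and> inP n (foldr h xs s)"
  using assms by (induction xs) auto

lemma rdet_eq:
  "rdet n N B = (\<Sum>\<sigma>\<in>{\<sigma>. \<sigma> permutes {1..N}}. pdscale (of_int (sign \<sigma>)) (foldr (\<lambda>i. pdmul n (B i (\<sigma> i))) [1..<N+1] pd_one))"
  by (intro ext) (simp add: rdet_def sum_fun_apply pdscale_apply spscale_apply foldr_map comp_def del: upt_Suc)

lemma rdet_mu11:
  assumes n: "1 \<le> n" shows "rdet n (2*n) (mu11 n) = rdet_at {1..2*n} [1..<2*n+1] (Aop n) pd_one"
  unfolding rdet_eq rdet_at_def
proof (rule sum.cong[OF refl], rule arg_cong[of _ _ "pdscale _"])
  fix \<sigma> assume "\<sigma> \<in> {\<sigma>. \<sigma> permutes {1..2*n}}"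
  then have \<sigma>: "\<sigma> i \<in> {1..2*n}" if "i \<in> {1..2*n}" for i using permutes_in_image[of \<sigma> "{1..2*n}" i] that by simp
  have "foldr (\<lambda>i. pdmul n (mu11 n i (\<sigma> i))) [1..<2*n+1] pd_one = foldr (\<lambda>i. Aop n i (\<sigma> i)) [1..<2*n+1] pd_one \<and>
     inP n (foldr (\<lambda>i. Aop n i (\<sigma> i)) [1..<2*n+1] pd_one)"
  proof (rule foldr_eq_inP)
    fix i S assume i: "i \<in> set [1..<2*n+1]" and S: "inP n S"
    then have "i \<in> {1..2*n}" by auto
    then have "i \<in> Iset n" "\<sigma> i \<in> Iset n" using \<sigma>[of i] by (auto simp: Iset_def)
    then show "pdmul n (mu11 n i (\<sigma> i)) S = Aop n i (\<sigma> i) S \<and> inP n (Aop n i (\<sigma> i) S)"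
      using linPD(1)[OF linP_Aop[OF n]] S by (simp add: mu11_def pdmul_Atil)
  qed simp
  then show "foldr (\<lambda>i. pdmul n (mu11 n i (\<sigma> i))) [1..<2*n+1] pd_one = foldr (\<lambda>i. Aop n i (\<sigma> i)) [1..<2*n+1] pd_one" ..
qed

text \<open>The middle row of \<open>\<A>^(2n|2n)\<close> contributes a factor \<open>D^(-1)\<close>, which is absorbed into the row below it.
  The index \<open>i\<close> of \<open>\<A>\<close> corresponds to the index \<open>unshift n i\<close> of \<open>\<A>^(2n|2n)\<close>.\<close>

definition unshift :: "nat \<Rightarrow> nat \<Rightarrow> nat" where
  "unshift n i = (if i \<le> 2*n then i else i + 1)"

definition Bop :: "nat \<Rightarrow> nat \<Rightarrow> nat \<Rightarrow> pd \<Rightarrow> pd" where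
  "Bop n i j S = (if i = 2*n+2 then pdDinv n (Aop n (shift n i) (shift n j) S) else Aop n (shift n i) (shift n j) S)"

lemma shift_unshift [simp]: "shift n (unshift n i) = i"
  by (simp add: shift_def unshift_def)

lemma Bop_unshift: "Bop n (unshift n i) (unshift n j) S =
    (if i = 2*n+1 then pdDinv n (Aop n i j S) else Aop n i j S)"
proof -
  have "unshift n i = 2*n+2 \<longleftrightarrow> i = 2*n+1" by (auto simp: unshift_def)
  then show ?thesis by (simp add: Bop_def)
qed

lemma unshift_image: "unshift n ` {1..4*n} = {1..4*n+1} - {2*n+1}"
proof
  show "{1..4*n+1} - {2*n+1} \<subseteq> unshift n ` {1..4*n}"
  proof
    fix i assume "i \<in> {1..4*n+1} - {2*n+1}"
    then have "i = unshift n (shift n i)" "shift n i \<in> {1..4*n}" by (auto simp: unshift_def shift_def)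
    then show "i \<in> unshift n ` {1..4*n}" by blast
  qed
qed (auto simp: unshift_def)

lemma map_unshift: "1 \<le> n \<Longrightarrow> map (unshift n) [1..<4*n+1] = [1..<2*n+1] @ [2*n+2..<4*n+2]"
proof -
  have "[1..<4*n+1] = [1..<2*n+1] @ [2*n+1..<4*n+1]"
    using upt_add_eq_append[of 1 "2*n+1" "2*n"] by simp
  moreover have "map (unshift n) [1..<2*n+1] = [1..<2*n+1]" by (rule map_idI) (auto simp: unshift_def)
  moreover have "map (unshift n) [2*n+1..<4*n+1] = map Suc [2*n+1..<4*n+1]" by (auto simp: unshift_def)
  moreover have "map Suc [2*n+1..<4*n+1] = [2*n+2..<4*n+2]" unfolding map_Suc_upt by simp
  ultimately show ?thesis by (simp only: map_append)
qed

lemma linP_Bop: "1 \<le> n \<Longrightarrow> shift n i \<in> Iset n \<Longrightarrow> shift n j \<in> Iset n \<Longrightarrow> linP n (Bop n i j)"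
  unfolding Bop_def[abs_def] using linP_Aop linP_comp[OF linP_pdDinv] by (cases "i = 2*n+2") auto

text \<open>A permutation moving 2n+1 meets a zero entry in the middle row. The others are, as
  functions and hence with the same sign, the permutations of the remaining indices, and D^(-1) is
  applied directly after row 2n+2.\<close>

lemma rdet_Abig:
  assumes n: "1 \<le> n"
  shows "rdet n (4*n+1) (Abig n) = rdet_at (unshift n ` {1..4*n}) (map (unshift n) [1..<4*n+1]) (Bop n) pd_one"
proof -
  let ?m = "2*n+1"
  let ?S = "{1..4*n+1} - {?m}"
  define pre where "pre = [1..<?m]"
  define post where "post = [2*n+3..<4*n+2]"
  have upt: "[2*n+2..<4*n+2] = (2*n+2) # [2*n+3..<4*n+2]"
    using n upt_conv_Cons[of "2*n+2" "4*n+2"] by (simp add: eval_nat_numeral del: upt_Suc)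
  have list: "[1..<4*n+1+1] = pre @ ?m # (2*n+2) # post"
  proof -
    have "[1..<4*n+2] = [1..<?m] @ [?m..<4*n+2]" using upt_add_eq_append[of 1 ?m "2*n+1"] by simp
    moreover have "[?m..<4*n+2] = ?m # [2*n+2..<4*n+2]" using n upt_conv_Cons[of ?m "4*n+2"] by simp
    moreover note upt
    ultimately show ?thesis by (simp add: pre_def post_def del: upt_Suc)
  qed
  have list': "map (unshift n) [1..<4*n+1] = pre @ (2*n+2) # post"
    unfolding map_unshift[OF n] upt by (simp only: pre_def post_def)
  have sets: "set pre \<subseteq> ?S" "set post \<subseteq> ?S" "2*n+2 \<notin> set pre" "2*n+2 \<notin> set post" "2*n+2 \<in> ?S"
    using n by (auto simp: pre_def post_def)
  have sh: "shift n i \<in> Iset n" if "i \<in> ?S" for i using that by (auto simp: shift_def Iset_def)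
  let ?f = "\<lambda>\<sigma> i. pdmul n (Abig n i (\<sigma> i))"
  have entry: "pdmul n (Abig n i j) s = Aop n (shift n i) (shift n j) s \<and> inP n (Aop n (shift n i) (shift n j) s)"
    if "i \<in> ?S" "j \<in> ?S" "inP n s" for i j s
    using that linPD(1)[OF linP_Aop[OF n sh[OF that(1)] sh[OF that(2)]]] by (auto simp: Abig_def pdmul_Atil)
  have outside: "foldr (?f \<sigma>) [1..<4*n+1+1] pd_one = 0" if \<sigma>: "\<sigma> permutes {1..4*n+1}" "\<sigma> ?m \<noteq> ?m" for \<sigma>
  proof -
    have "Abig n ?m (\<sigma> ?m) = 0" using \<sigma>(2) by (simp add: Abig_def)
    moreover have "foldr (?f \<sigma>) xs 0 = 0" if "set xs \<subseteq> ?S" for xs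
      using that
    proof (induction xs)
      case (Cons i xs)
      then have i: "i \<in> ?S" by simp
      have "pdmul n (Abig n i (\<sigma> i)) 0 = 0"
      proof (cases "\<sigma> i = ?m")
        case True
        then show ?thesis using i by (simp add: Abig_def)
      next
        case False
        then have j: "\<sigma> i \<in> ?S" using permutes_in_image[OF \<sigma>(1), of i] i by blast
        then show ?thesis using entry[OF i j inP_zero] linP_zero[OF linP_Aop[OF n sh[OF i] sh[OF j]]] by simp
      qed
      then show ?case using Cons by simp
    qed simp
    ultimately show ?thesis unfolding list using sets(1) by simp
  qed
  have inside: "foldr (?f \<sigma>) [1..<4*n+1+1] pd_one = foldr (\<lambda>i. Bop n i (\<sigma> i)) (map (unshift n) [1..<4*n+1]) pd_one"
    if \<sigma>: "\<sigma> permutes ?S" for \<sigma>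
  proof -
    have m: "\<sigma> ?m = ?m" using \<sigma> by (simp add: permutes_not_in)
    have im: "\<sigma> i \<in> ?S" if "i \<in> ?S" for i using permutes_in_image[OF \<sigma>] that by blast
    have B: "?f \<sigma> i s = Bop n i (\<sigma> i) s \<and> inP n (Bop n i (\<sigma> i) s)" if "i \<in> ?S" "i \<noteq> 2*n+2" "inP n s" for i s
      using entry[OF that(1) im[OF that(1)] that(3)] that(2) by (simp add: Bop_def)
    have 1: "foldr (?f \<sigma>) post pd_one = foldr (\<lambda>i. Bop n i (\<sigma> i)) post pd_one \<and>
        inP n (foldr (\<lambda>i. Bop n i (\<sigma> i)) post pd_one)"
      by (rule foldr_eq_inP[OF B]) (use sets in auto)
    let ?s = "foldr (\<lambda>i. Bop n i (\<sigma> i)) post pd_one"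
    have 2: "?f \<sigma> ?m (?f \<sigma> (2*n+2) ?s) = Bop n (2*n+2) (\<sigma> (2*n+2)) ?s \<and> inP n (Bop n (2*n+2) (\<sigma> (2*n+2)) ?s)"
    proof -
      have "pdmul n (Abig n ?m (\<sigma> ?m)) s = pdDinv n s" if "inP n s" for s
        using m that by (simp add: Abig_def pdmul_Dinv)
      then show ?thesis
        using entry[OF sets(5) im[OF sets(5)], of ?s] 1 by (simp add: Bop_def)
    qed
    have 3: "foldr (?f \<sigma>) pre (Bop n (2*n+2) (\<sigma> (2*n+2)) ?s) = foldr (\<lambda>i. Bop n i (\<sigma> i)) pre (Bop n (2*n+2) (\<sigma> (2*n+2)) ?s) \<and>
        inP n (foldr (\<lambda>i. Bop n i (\<sigma> i)) pre (Bop n (2*n+2) (\<sigma> (2*n+2)) ?s))"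
      by (rule foldr_eq_inP[OF B]) (use sets 2 in auto)
    show ?thesis unfolding list list' using 1 2 3 by simp
  qed
  have sub: "{\<sigma>. \<sigma> permutes ?S} \<subseteq> {\<sigma>. \<sigma> permutes {1..4*n+1}}"
    using permutes_subset[of _ ?S "{1..4*n+1}"] by blast
  have "\<sigma> ?m \<noteq> ?m" if "\<sigma> \<in> {\<sigma>. \<sigma> permutes {1..4*n+1}} - {\<sigma>. \<sigma> permutes ?S}" for \<sigma>
    using that permutes_superset[of \<sigma> "{1..4*n+1}" ?S] by auto
  then have "rdet n (4*n+1) (Abig n) = (\<Sum>\<sigma>\<in>{\<sigma>. \<sigma> permutes ?S}. pdscale (of_int (sign \<sigma>)) (foldr (?f \<sigma>) [1..<4*n+1+1] pd_one))"
    unfolding rdet_eq using outside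
    by (intro sum.mono_neutral_right sub finite_permutations) auto
  then show ?thesis unfolding rdet_at_def unshift_image using inside by (simp del: upt_Suc)
qed

lemma rdet_Abig_in_Wset:
  assumes n: "1 \<le> n" shows "rdet n (4*n+1) (Abig n) k \<in> Wset n"
proof -
  \<comment> \<open>The value -2 at 2n is D^(-1) composed with the entry -2D.\<close>
  define \<kappa> where "\<kappa> = (\<lambda>j. if j < 2*n then -1 else if j = 2*n then -2 else - thsign n (4*n+1-j) (4*n-j))"
  have h: "hessenberg n (4*n) (unshift n) \<kappa> (Bop n)"
    unfolding hessenberg_def Iset_eq[symmetric]
  proof (intro ballI conjI impI allI)
    fix i j assume ij: "i \<in> Iset n" "j \<in> Iset n"
    show "linP n (Bop n (unshift n i) (unshift n j))" using ij by (intro linP_Bop n) simp_all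
    fix S assume S: "inP n S"
    show "Bop n (unshift n i) (unshift n j) S = 0" if "j + 1 < i"
      using Aop_lower_zero[OF n ij that S] by (auto simp: Bop_unshift)
    show "Bop n (unshift n i) (unshift n j) S = pdscale (\<kappa> j) S" if i: "i = j + 1"
    proof -
      consider "j < 2*n" | "j = 2*n" | "2*n < j" by linarith
      then show ?thesis
      proof cases
        case 1
        then show ?thesis using Aop_sub(1)[OF n S, of j] ij i by (simp add: Bop_unshift \<kappa>_def Iset_def)
      next
        case 2
        have "pdDinv n (pdscale (-2) (pdD n S)) = pdscale (-2) S"
          using S pdDinv_scale[OF inP_pdD[OF S], of "-2"] pdDinv_pdD[OF S] by (simp only:)
        then show ?thesis using 2 i Aop_middle[OF n S] by (simp add: Bop_unshift \<kappa>_def del: pd.scale_minus_left)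
      next
        case 3
        then show ?thesis using Aop_sub(2)[OF n S, of j] ij i by (simp add: Bop_unshift \<kappa>_def Iset_def)
      qed
    qed
  qed
  have inj: "inj_on (unshift n) {1..4*n}" by (auto simp: inj_on_def unshift_def split: if_splits)
  have "1 \<le> 4*n" using n by simp
  from hessenberg_rdet[OF this inj h inP_one] obtain c where c0: "\<forall>j\<in>{1..4*n}. inP n (c j)"
    "c (4*n) = pdscale (\<Prod>i\<in>{1..<4*n}. - \<kappa> i) pd_one"
    "\<forall>i\<in>{2..4*n}. (\<Sum>j\<in>{1..4*n}. Bop n (unshift n i) (unshift n j) (c j)) = 0"
    "(\<Sum>j\<in>{1..4*n}. Bop n (unshift n 1) (unshift n j) (c j)) =
       rdet_at (unshift n ` {1..4*n}) (map (unshift n) [1..<4*n+1]) (Bop n) pd_one"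
    by blast
  define K where "K = (\<Prod>i\<in>{1..<4*n}. - \<kappa> i)"
  have c: "\<And>j. j \<in> Iset n \<Longrightarrow> inP n (c j)" "c (4*n) = pdscale K pd_one"
    "\<And>i. i \<in> {2..4*n} \<Longrightarrow> (\<Sum>j\<in>Iset n. Bop n (unshift n i) (unshift n j) (c j)) = 0"
    "(\<Sum>j\<in>Iset n. Bop n (unshift n 1) (unshift n j) (c j)) = rdet n (4*n+1) (Abig n)"
    using c0 unfolding rdet_Abig[OF n] Iset_eq K_def by blast+
  \<comment> \<open>Undoes the column operation: M d = N c.\<close>
  define d where "d = (\<lambda>j. c j - (if j = 2*n+1 then c (2*n) else 0))"
  have I: "2*n \<in> Iset n" "2*n+1 \<in> Iset n" "4*n \<in> Iset n" "1 \<in> Iset n" using n by (auto simp: Iset_def)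
  have d: "inP n (d j)" if "j \<in> Iset n" for j using that c(1) I by (simp add: d_def)
  define r where "r = (\<lambda>i. \<Sum>j\<in>Iset n. Mop n i j (d j))"
  have rN: "r i = (\<Sum>j\<in>Iset n. Nop n i j (c j))" if i: "i \<in> Iset n" for i
  proof -
    have "r i = (\<Sum>j\<in>Iset n. Mop n i j (c j) - (if j = 2*n+1 then Mop n i (2*n+1) (c (2*n)) else 0))"
      unfolding r_def d_def using c(1) I by (intro sum.cong refl) (auto simp: linP_diff[OF linP_Mop[OF i]] linP_zero[OF linP_Mop[OF i]])
    also have "\<dots> = (\<Sum>j\<in>Iset n. Mop n i j (c j)) - Mop n i (2*n+1) (c (2*n))"
      using I by (simp add: sum_subtractf)
    also have "\<dots> = (\<Sum>j\<in>Iset n. Mop n i j (c j) - (if j = 2*n then Mop n i (2*n+1) (c (2*n)) else 0))"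
      using I by (simp add: sum_subtractf)
    also have "\<dots> = (\<Sum>j\<in>Iset n. Nop n i j (c j))"
      by (intro sum.cong refl) (auto simp: Nop_def)
    finally show ?thesis .
  qed
  have rA: "(\<Sum>j\<in>Iset n. Aop n i j (c j)) = r i - (if i = 2*n+1 then r (2*n) else 0)" if i: "i \<in> Iset n" for i
    using rN[OF i] rN[OF I(1)] by (simp add: Aop_def sum_subtractf)
  have A0: "(\<Sum>j\<in>Iset n. Aop n i j (c j)) = 0" if i: "i \<in> {2..4*n}" for i
  proof (cases "i = 2*n+1")
    case True
    have P: "inP n (\<Sum>j\<in>Iset n. Aop n i j (c j))"
      using linPD(1)[OF linP_Aop[OF n] c(1)] i by (intro inP_sum) (auto simp: Iset_def)
    \<comment> \<open>Elimination gives zero for this row only behind D^(-1), which is then removed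
      by applying D.\<close>
    have "pdDinv n (\<Sum>j\<in>Iset n. Aop n i j (c j)) = (\<Sum>j\<in>Iset n. pdDinv n (Aop n i j (c j)))"
      using linPD(1)[OF linP_Aop[OF n] c(1)] i by (intro linP_sum[OF _ linP_pdDinv]) (auto simp: Iset_def)
    also have "\<dots> = 0" using c(3)[OF i] True by (simp add: Bop_unshift)
    finally show ?thesis using pdD_pdDinv[OF P] by simp
  next
    case False
    then show ?thesis using c(3)[OF i] by (simp add: Bop_unshift)
  qed
  have r0: "r i = 0" if "i \<in> {2..4*n}" for i
  proof -
    have "r (2*n) = 0" using rA[OF I(1)] A0[of "2*n"] n by simp
    then show ?thesis using rA[of i] A0[OF that] that by (simp add: Iset_def split: if_splits)
  qed
  have r1: "r 1 = rdet n (4*n+1) (Abig n)"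
    using rA[OF I(4)] c(4) n by (simp add: Bop_unshift)
  have d4: "d (4*n) = pdscale K pd_one" using c(2) n by (simp add: d_def)
  show ?thesis
  proof (rule Wset_I)
    have "inP n (r 1)" unfolding r_def using linPD(1)[OF linP_Mop d] I(4) by (intro inP_sum) auto
    then show "rdet n (4*n+1) (Abig n) k \<in> Vp n" unfolding r1 Vp_iff_gval by (rule inP_gval)
    fix a m assume a: "a \<in> basis n" "ibar n (fst a) < ibar n (snd a)"
    then interpret unipotent n a using n by unfold_locales
    show "brk n a (rdet n (4*n+1) (Abig n) k) m \<in> Jset n"
      using gauge_invariant_solution[of d k m, OF d] r0 r1 d4 brk_pd_one by (simp add: rvec_def r_def)
  qed
qed

lemma rdet_mu11_in_Wset:
  assumes n: "1 \<le> n" shows "rdet n (2*n) (mu11 n) 0 \<in> Wset n"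
proof -
  have h: "hessenberg n (2*n) (\<lambda>i. i) (\<lambda>_. -1) (Aop n)"
    unfolding hessenberg_def
  proof (intro ballI conjI impI allI)
    fix i j assume ij: "i \<in> {1..2*n}" "j \<in> {1..2*n}"
    then have I: "i \<in> Iset n" "j \<in> Iset n" by (auto simp: Iset_def)
    show "linP n (Aop n i j)" by (rule linP_Aop[OF n I])
    fix S assume S: "inP n S"
    show "Aop n i j S = 0" if "j + 1 < i" by (rule Aop_lower_zero[OF n I that S])
    show "Aop n i j S = pdscale (-1) S" if "i = j + 1" using Aop_sub(1)[OF n S, of j] that ij by simp
  qed
  have "1 \<le> 2*n" "inj_on (\<lambda>i. i) {1..2*n}" using n by auto
  from hessenberg_rdet[OF this h inP_one] obtain c where c0: "\<forall>j\<in>{1..2*n}. inP n (c j)"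
    "c (2*n) = pdscale (\<Prod>i\<in>{1..<2*n}. - (-1)) pd_one"
    "\<forall>i\<in>{2..2*n}. (\<Sum>j\<in>{1..2*n}. Aop n i j (c j)) = 0"
    "(\<Sum>j\<in>{1..2*n}. Aop n 1 j (c j)) = rdet_at ((\<lambda>i. i) ` {1..2*n}) (map (\<lambda>i. i) [1..<2*n+1]) (Aop n) pd_one"
    by blast
  have c: "\<And>j. j \<in> {1..2*n} \<Longrightarrow> inP n (c j)" "c (2*n) = pd_one"
    "\<And>i. i \<in> {2..2*n} \<Longrightarrow> (\<Sum>j\<in>{1..2*n}. Aop n i j (c j)) = 0"
    "(\<Sum>j\<in>{1..2*n}. Aop n 1 j (c j)) = rdet n (2*n) (mu11 n)"
    using c0(1,3) c0(2) c0(4) unfolding rdet_mu11[OF n] list.map_ident image_ident by (blast, simp, blast, blast)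
  \<comment> \<open>Pads \<open>c\<close> with zeros and undoes the column operation, which puts the
    negative of the last entry at position 2n+1.\<close>
  define d where "d = (\<lambda>j. if j \<le> 2*n then c j else if j = 2*n+1 then - c (2*n) else 0)"
  have I: "2*n \<in> Iset n" "2*n+1 \<in> Iset n" "1 \<in> Iset n" using n by (auto simp: Iset_def)
  have d: "inP n (d j)" if "j \<in> Iset n" for j using that c(1) n by (auto simp: d_def Iset_def)
  define r where "r = (\<lambda>i. \<Sum>j\<in>Iset n. Mop n i j (d j))"
  have rN: "r i = (\<Sum>j\<in>{1..2*n}. Nop n i j (c j))" if i: "i \<in> Iset n" for i
  proof -
    have "r i = (\<Sum>j\<in>{1..2*n} \<union> ({2*n+1} \<union> {2*n+2..4*n}). Mop n i j (d j))"
      unfolding r_def using n by (intro sum.cong) (auto simp: Iset_def)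
    also have "\<dots> = (\<Sum>j\<in>{1..2*n}. Mop n i j (d j)) + (Mop n i (2*n+1) (- c (2*n)) + (\<Sum>j\<in>{2*n+2..4*n}. Mop n i j (d j)))"
      by (subst sum.union_disjoint, simp, simp, force, subst sum.union_disjoint) (auto simp: d_def)
    also have "(\<Sum>j\<in>{2*n+2..4*n}. Mop n i j (d j)) = 0"
      using linP_zero[OF linP_Mop[OF i]] by (intro sum.neutral) (auto simp: d_def Iset_def)
    also have "Mop n i (2*n+1) (- c (2*n)) = - Mop n i (2*n+1) (c (2*n))"
      using linPD(3)[OF linP_Mop[OF i I(2)] c(1), of "2*n" "-1"] n by simp
    also have "(\<Sum>j\<in>{1..2*n}. Mop n i j (d j)) + (- Mop n i (2*n+1) (c (2*n)) + 0) =
       (\<Sum>j\<in>{1..2*n}. Mop n i j (c j) - (if j = 2*n then Mop n i (2*n+1) (c (2*n)) else 0))"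
      using n by (simp add: sum_subtractf d_def)
    also have "\<dots> = (\<Sum>j\<in>{1..2*n}. Nop n i j (c j))"
      by (intro sum.cong refl) (auto simp: Nop_def)
    finally show ?thesis .
  qed
  have rA: "(\<Sum>j\<in>{1..2*n}. Aop n i j (c j)) = r i - (if i = 2*n+1 then r (2*n) else 0)" if i: "i \<in> Iset n" for i
    using rN[OF i] rN[OF I(1)] by (simp add: Aop_def sum_subtractf)
  have r1: "r 1 = rdet n (2*n) (mu11 n)" using rA[OF I(3)] c(4) n by simp
  have low: "r i = 0" if "i \<in> {2..2*n}" for i
    using rA[of i] c(3)[OF that] that by (simp add: Iset_def)
  \<comment> \<open>Row 2n+1 lies outside the eliminated block; among the first 2n columns it has
    only the entry -2D, at column 2n, and this meets the constant 1.\<close>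
  have mid: "r (2*n+1) = pdscale (-2) (pdD n (c (2*n)))"
  proof -
    have "(\<Sum>j\<in>{1..2*n}. Aop n (2*n+1) j (c j)) = (\<Sum>j\<in>{2*n}. Aop n (2*n+1) j (c j))"
      using n c(1) by (intro sum.mono_neutral_right ballI Aop_lower_zero[OF n]) (auto simp: Iset_def)
    then show ?thesis using rA[OF I(2)] low[of "2*n"] n Aop_middle[OF n c(1), of "2*n"]
      by (simp del: pd.scale_minus_left)
  qed
  have high: "r i = 0" if i: "i \<in> {2*n+2..4*n}" for i
  proof -
    have "(\<Sum>j\<in>{1..2*n}. Aop n i j (c j)) = 0"
      using i c(1) n by (intro sum.neutral ballI Aop_lower_zero[OF n]) (auto simp: Iset_def)
    then show ?thesis using rA[of i] i by (simp add: Iset_def)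
  qed
  show ?thesis
  proof (rule Wset_I)
    have "inP n (r 1)" unfolding r_def using linPD(1)[OF linP_Mop d] I(3) by (intro inP_sum) auto
    then show "rdet n (2*n) (mu11 n) 0 \<in> Vp n" unfolding r1 Vp_iff_gval by (rule inP_gval)
    fix a m assume a: "a \<in> basis n" "ibar n (fst a) < ibar n (snd a)"
    then interpret unipotent n a using n by unfold_locales
    have "brk n a (rvec d 1 0) m \<in> Jset n"
    proof (rule gauge_invariant_truncation[OF d])
      show "rvec d i = 0" if "i \<in> {2..2*n} \<union> {2*n+2..4*n}" for i
        using that low high by (auto simp: rvec_def r_def)
      show "rvec d (2*n+1) k = 0" if "k \<le> 0" for k
        using mid that pdD_pd_one[of n 1 k] by (simp add: rvec_def r_def c(2) pdscale_apply pd_uminus_apply)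
      show "brk n a (d j k) m = 0" if "j \<in> {2*n..4*n}" for j k m
        using that c(2) brk_pd_one[of n a 1] by (auto simp: d_def pd_uminus_apply pd_zero_apply)
      show "d j = 0" if "j \<in> {2*n+2..4*n}" for j using that by (simp add: d_def)
    qed
    then show "brk n a (rdet n (2*n) (mu11 n) 0) m \<in> Jset n" using r1 by (simp add: rvec_def r_def)
  qed
qed

theorem mainTheorem13:
  fixes n :: nat
  assumes "1 \<le> n"
  shows "(\<forall>l\<in>{1..4*n-1}. rdet n (4*n+1) (Abig n) (int (4*n-1) - int l) \<in> Wset n)
         \<and> rdet n (2*n) (mu11 n) 0 \<in> Wset n"
  using rdet_Abig_in_Wset[OF assms] rdet_mu11_in_Wset[OF assms] by blast

end
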